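(* Let $u_0\in C_0(\mathsf E)$ and let $u\in C^{1,2}((0,\infty)\times\mathsf E)\cap D_L$ be a solution of the problem $$\begin{cases}\displaystyle \frac{\partial u}{\partial t}(t,\mathsf x)=\frac12\frac{\partial^2u}{\partial x^2}(t,\mathsf x), & t>0,\ \mathsf x\in\mathsf E\setminus\{0\},\\[2mm] \displaystyle c\,\mathfrak D_t^\Phi u(t,0)=b\sum_{k=1}^np_k\,u_k'(t,0), & t>0,\\[2mm] u(0,\mathsf x)=u_0(\mathsf x), & \mathsf x\in\mathsf E,\end{cases}$$ where $u$ is bounded and continuous on $[0,\infty)\times\mathsf E$. Then $u$ has the probabilistic representation $$u(t,\mathsf x)=\mathbb E^{\mathsf x}[u_0(\mathcal Y_t)]=\mathbb E^{\mathsf x}\big[u_0(\mathcal Z\circ V_H^{-1}(t))\big],\qquad t>0,\ \mathsf x\in\mathsf E.$$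
   Context: Star graph: take $n$ copies $\mathsf e_j=[0,\infty)$, $j=1,\dots,n$, denote points by $(j,x)$ ($j$ the ray, $x\ge0$ the distance from the origin), and identify all the points $(j,0)$ to a single vertex $0$; the quotient is $\mathsf E$, with distance $d((j,x),(k,y))=|x-y|$ if $j=k$ and $x+y$ if $j\ne k$. For $f$ on $\mathsf E$ write $f_j(x)=f(j,x)$ and $f_j'(0)=\lim_{r\downarrow0}\frac{\partial}{\partial r}f(j,r)$ (for $u(t,\cdot)$: $u_k'(t,0)$). $C_0(\mathsf E)$ is the space of continuous functions vanishing at infinity; $C_0^2(\mathsf E)$ is the space of $f\in C_0(\mathsf E)$ twice continuously differentiable on each open ray whose second derivative extends to a function in $C_0(\mathsf E)$. $C^{1,2}((0,\infty)\times\mathsf E)$ denotes functions continuously differentiable once in $t$ and twice in the space variable along each ray (up to the vertex). Weights $p_1,\dots,p_n\in[0,1]$ with $\sum_kp_k=1$, and constants $b,c>0$ with $b+c=1$, are fixed; put $\mu=c/b$. $\mathcal Z$ is the standard Brownian motion on $\mathsf E$: the continuous strong Markov process with generator $\frac12f_j''$ and domain $\{f\in C_0^2(\mathsf E):\sum_kp_kf_k'(0)=0\}$. Its radial component $Z$ is a reflected Brownian motion on $[0,\infty)$. Its local time $\ell^{\mathcal Z}$ at the vertex coincides with the local time $\ell^Z$ of $Z$ at $0$, normalized so that $\mathbf P^0(Z(t)\in dy,\ell^Z(t)\in d\omega)=2\frac{y+\omega}{t}g_t(y+\omega)\,dy\,d\omega$, $y,\omega>0$, with $g_t(x)=(2\pi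 t)^{-1/2}e^{-x^2/(2t)}$. $H=\{H_t,t\ge0\}$ is a subordinator independent of $\mathcal Z$ with $\mathbb E[e^{-\lambda H_t}]=e^{-t\Phi(\lambda)}$, $\Phi(\lambda)=\int_0^\infty(1-e^{-\lambda y})\,\phi(dy)$, where $\phi$ is a Lévy measure on $(0,\infty)$ with $\int\min\{1,y\}\,\phi(dy)<\infty$ and $\phi((0,\infty))=\infty$ (so $H$ has a.s. strictly increasing paths). Let $V_H(t)=t+H_{\mu\ell^{\mathcal Z}(t)}$, $V_H^{-1}(t)=\inf\{s\ge0:V_H(s)>t\}$, and $\mathcal Y_t=\mathcal Z(V_H^{-1}(t))$. With $\overline\phi(z)=\phi((z,\infty))$, the non-local operator is $$\mathfrak D_t^\Phi u(t,\mathsf x)=\int_0^t\frac{\partial u}{\partial s}(s,\mathsf x)\,\overline\phi(t-s)\,ds,\qquad t>0.$$ Let $\kappa(ds)=\int_0^\infty\mathbb P^0(H_t\in ds)\,dt$ be the potential measure of $H$, with $\kappa(ds)/ds$ its density. $D_L$ is the set of $\varphi\in C((0,\infty)\times\mathsf E)$ such that $\varrho=\varphi|_{\mathsf x=0}$ satisfies: $\varrho,\ \frac{d\varrho}{dt},\ \mathfrak D_t^\Phi\varrho\in C(0,\infty)$, and $\big|\frac{d\varrho}{dt}(t)\big|\le M_0\frac{\kappa(dt)}{dt}$ for some $M_0>0$. *)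

theory Defs
  imports "HOL-Probability.Probability"
begin

section \<open>The star graph\<close>

text \<open>The rays are indexed by a nonempty finite type, so the number of rays is its cardinality.
  The relation is partial: only pairs with nonnegative second component represent points.\<close>

definition star_rel :: "'n \<times> real \<Rightarrow> 'n \<times> real \<Rightarrow> bool" where
  "star_rel = (\<lambda>(j, x) (k, y). 0 \<le> x \<and> 0 \<le> y \<and> x = y \<and> (j = k \<or> x = 0))"

quotient_type 'n star = "'n \<times> real" / partial: star_rel
proof (rule part_equivpI)
  show "\<exists>x::'n \<times> real. star_rel x x"
    by (rule exI[of _ "(undefined, 0)"]) (simp add: star_rel_def)
  show "symp (star_rel :: 'n \<times> real \<Rightarrow> _)"
    by (auto simp: symp_def star_rel_def)
  show "transp (star_rel :: 'n \<times> real \<Rightarrow> _)"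
    by (auto simp: transp_def star_rel_def)
qed

text \<open>\<open>pt j r\<close> is the point \<open>(j, r)\<close>; it is meaningful for \<open>r \<ge> 0\<close> only.\<close>

definition pt :: "'n \<Rightarrow> real \<Rightarrow> 'n star" where
  "pt j r = abs_star (j, r)"

definition vertex :: "'n star" where
  "vertex = pt undefined 0"

lemma pt_eq_iff:
  assumes "0 \<le> r" "0 \<le> s"
  shows "pt j r = pt k s \<longleftrightarrow> r = s \<and> (j = k \<or> r = 0)"
  using Quotient_rel_abs[OF Quotient_star, of "(j, r)" "(k, s)"] assms
    Quotient_rel[OF Quotient_star, of "(j, r)" "(k, s)"]
  by (auto simp: star_rel_def pt_def)

lemma pt_0 [simp]: "pt j 0 = vertex"
  by (simp add: vertex_def pt_eq_iff)

lemma star_cases: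
  obtains j r where "0 \<le> r" "x = pt j r"
proof -
  obtain j r where jr: "rep_star x = (j, r)" by fastforce
  have "star_rel (j, r) (j, r)"
    using Quotient_rep_reflp[OF Quotient_star, of x] jr by simp
  moreover have "x = pt j r"
    using Quotient_abs_rep[OF Quotient_star, of x] jr by (simp add: pt_def)
  ultimately show ?thesis using that by (auto simp: star_rel_def)
qed

instantiation star :: (type) metric_space
begin

lift_definition dist_star :: "'a star \<Rightarrow> 'a star \<Rightarrow> real"
  is "\<lambda>(j, x) (k, y). if j = k then \<bar>x - y\<bar> else x + y"
  by (auto simp: star_rel_def)

definition uniformity_star :: "('a star \<times> 'a star) filter" where
  "uniformity_star = (INF e\<in>{0 <..}. principal {(x, y). dist x y < e})"

definition open_star :: "'a star set \<Rightarrow> bool" where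
  "open_star U \<longleftrightarrow> (\<forall>x\<in>U. \<forall>\<^sub>F (x', y) in uniformity. x' = x \<longrightarrow> y \<in> U)"

lemma dist_pt:
  assumes "0 \<le> r" "0 \<le> s"
  shows "dist (pt j r) (pt k s) = (if j = k then \<bar>r - s\<bar> else r + s)"
  using assms by (simp add: pt_def dist_star.abs_eq eq_onp_def star_rel_def)

instance
proof
  show "dist x y = 0 \<longleftrightarrow> x = y" for x y :: "'a star"
    by (cases x rule: star_cases; cases y rule: star_cases)
       (auto simp: dist_pt pt_eq_iff)
  show "dist x y \<le> dist x z + dist y z" for x y z :: "'a star"
    by (cases x rule: star_cases; cases y rule: star_cases; cases z rule: star_cases)
       (auto simp: dist_pt)
qed (simp_all add: uniformity_star_def open_star_def)

end

section \<open>Function spaces on the star graph\<close>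

definition C0 :: "('n star \<Rightarrow> real) set" where
  "C0 = {f. continuous_on UNIV f \<and> (\<forall>e>0. \<exists>R. \<forall>x. dist x vertex > R \<longrightarrow> \<bar>f x\<bar> < e)}"

text \<open>\<open>g\<close> lies in \<open>C0\<close> and extends the second derivative of \<open>f\<close> along the open rays.\<close>

definition second_deriv_ext :: "('n star \<Rightarrow> real) \<Rightarrow> ('n star \<Rightarrow> real) \<Rightarrow> bool" where
  "second_deriv_ext f g \<longleftrightarrow> g \<in> C0 \<and>
    (\<forall>j. \<exists>f1. \<forall>r>0. ((\<lambda>s. f (pt j s)) has_real_derivative f1 r) (at r) \<and>
                    (f1 has_real_derivative g (pt j r)) (at r))"

definition C02 :: "('n star \<Rightarrow> real) set" where
  "C02 = {f \<in> C0. \<exists>g. second_deriv_ext f g}"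

definition vertex_deriv :: "('n star \<Rightarrow> real) \<Rightarrow> 'n \<Rightarrow> real" where
  "vertex_deriv f j = Lim (at_right 0) (\<lambda>r. deriv (\<lambda>s. f (pt j s)) r)"

text \<open>The spatial derivatives are taken within \<open>[0, \<infinity>)\<close>, hence one-sided at the vertex, where
  their values may depend on the ray.\<close>

definition C12 :: "(real \<Rightarrow> 'n star \<Rightarrow> real) set" where
  "C12 = {u.
    (\<exists>ut. continuous_on ({0<..} \<times> UNIV) (\<lambda>(t, x). ut t x) \<and>
       (\<forall>t>0. \<forall>x. ((\<lambda>s. u s x) has_real_derivative ut t x) (at t))) \<and>
    (\<forall>j. \<exists>ux uxx.
       continuous_on ({0<..} \<times> {0..}) (\<lambda>(t, r). ux t r) \<and>
       continuous_on ({0<..} \<times> {0..}) (\<lambda>(t, r). uxx t r) \<and>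
       (\<forall>t>0. \<forall>r\<ge>0.
          ((\<lambda>y. u t (pt j y)) has_real_derivative ux t r) (at r within {0..}) \<and>
          (ux t has_real_derivative uxx t r) (at r within {0..})))}"

section \<open>Brownian motion on the star graph\<close>

text \<open>A process under a family of laws is given by a measurable space \<open>M\<close> (only its
  \<open>\<sigma>\<close>-algebra is used), probability measures \<open>P x\<close> on it indexed by the starting point, and
  random variables \<open>Z t\<close>, \<open>t \<ge> 0\<close>. The filtration is indexed by \<open>[0, \<infinity>]\<close> so that stopping
  times may be infinite.\<close>

definition natural_filtration ::
    "'w measure \<Rightarrow> (real \<Rightarrow> 'w \<Rightarrow> 's::topological_space) \<Rightarrow> ennreal \<Rightarrow> 'w measure" where
  "natural_filtration M Z t =
    sigma (space M) {Z s -` B \<inter> space M | s B. 0 \<le> s \<and> ennreal s \<le> t \<and> B \<in> sets borel}"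

definition transition_op ::
    "('s \<Rightarrow> 'w measure) \<Rightarrow> (real \<Rightarrow> 'w \<Rightarrow> 's) \<Rightarrow> real \<Rightarrow> ('s \<Rightarrow> real) \<Rightarrow> 's \<Rightarrow> real" where
  "transition_op P Z t f x = (\<integral>\<omega>. f (Z t \<omega>) \<partial>P x)"

definition continuous_strong_Markov ::
    "'w measure \<Rightarrow> ('s::topological_space \<Rightarrow> 'w measure) \<Rightarrow> (real \<Rightarrow> 'w \<Rightarrow> 's) \<Rightarrow> bool" where
  "continuous_strong_Markov M P Z \<longleftrightarrow>
    (\<forall>x. prob_space (P x) \<and> sets (P x) = sets M) \<and>
    (\<forall>t\<ge>0. Z t \<in> M \<rightarrow>\<^sub>M borel) \<and>
    (\<forall>\<omega>\<in>space M. continuous_on {0..} (\<lambda>t. Z t \<omega>)) \<and>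
    (\<forall>x. AE \<omega> in P x. Z 0 \<omega> = x) \<and>
    (\<forall>t\<ge>0. (\<lambda>x. distr (P x) borel (Z t)) \<in> borel \<rightarrow>\<^sub>M prob_algebra borel) \<and>
    (\<forall>x \<tau> t f. stopping_time (natural_filtration M Z) \<tau> \<longrightarrow> 0 \<le> t \<longrightarrow>
       f \<in> borel_measurable borel \<longrightarrow> bounded (range f) \<longrightarrow>
       (AE \<omega> in P x.
          real_cond_exp (P x) (filtration.pre_sigma (space M) (natural_filtration M Z) \<tau>)
            (\<lambda>\<omega>. indicator {\<omega>. \<tau> \<omega> < \<infinity>} \<omega> * f (Z (enn2real (\<tau> \<omega>) + t) \<omega>)) \<omega>
          = indicator {\<omega>. \<tau> \<omega> < \<infinity>} \<omega> * transition_op P Z t f (Z (enn2real (\<tau> \<omega>)) \<omega>)))"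

text \<open>The graph of the infinitesimal generator on \<open>C0\<close>, with respect to the supremum norm.\<close>

definition C0_generator ::
    "(real \<Rightarrow> ('n star \<Rightarrow> real) \<Rightarrow> 'n star \<Rightarrow> real) \<Rightarrow> ('n star \<Rightarrow> real) \<Rightarrow> ('n star \<Rightarrow> real) \<Rightarrow> bool" where
  "C0_generator T f g \<longleftrightarrow> f \<in> C0 \<and> g \<in> C0 \<and>
    uniform_limit UNIV (\<lambda>t x. (T t f x - f x) / t) g (at_right 0)"

definition star_domain :: "('n::finite \<Rightarrow> real) \<Rightarrow> ('n star \<Rightarrow> real) set" where
  "star_domain p = {f \<in> C02. (\<Sum>k\<in>UNIV. p k * vertex_deriv f k) = 0}"

definition star_Brownian_motion ::
    "('n::finite \<Rightarrow> real) \<Rightarrow> 'w measure \<Rightarrow> ('n star \<Rightarrow> 'w measure) \<Rightarrow> (real \<Rightarrow> 'w \<Rightarrow> 'n star) \<Rightarrow> bool" where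
  "star_Brownian_motion p M P Z \<longleftrightarrow>
    continuous_strong_Markov M P Z \<and>
    (\<forall>t\<ge>0. \<forall>f\<in>C0. transition_op P Z t f \<in> C0) \<and>
    (\<forall>f g. C0_generator (transition_op P Z) f g \<longleftrightarrow>
       f \<in> star_domain p \<and> (\<exists>h. second_deriv_ext f h \<and> g = (\<lambda>x. 1/2 * h x)))"

text \<open>A local time of the radial component \<open>dist (Z t) vertex\<close> at \<open>0\<close>: a continuous nondecreasing
  process which is the occupation density at \<open>0\<close>, up to a multiplicative constant \<open>K\<close>.
  The constant is fixed by the normalization below.\<close>

definition vertex_local_time ::
    "'w measure \<Rightarrow> ('n star \<Rightarrow> 'w measure) \<Rightarrow> (real \<Rightarrow> 'w \<Rightarrow> 'n star) \<Rightarrow> (real \<Rightarrow> 'w \<Rightarrow> real) \<Rightarrow> bool" where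
  "vertex_local_time M P Z L \<longleftrightarrow>
    (\<forall>t\<ge>0. L t \<in> borel_measurable M) \<and>
    (\<forall>\<omega>\<in>space M. L 0 \<omega> = 0 \<and> mono_on {0..} (\<lambda>t. L t \<omega>) \<and> continuous_on {0..} (\<lambda>t. L t \<omega>)) \<and>
    (\<exists>K>0. \<forall>x. AE \<omega> in P x. \<forall>t\<ge>0.
       ((\<lambda>e. K / e * measure lborel {s \<in> {0..t}. dist (Z s \<omega>) vertex < e}) \<longlongrightarrow> L t \<omega>) (at_right 0))"

definition gauss :: "real \<Rightarrow> real \<Rightarrow> real" where
  "gauss t x = (2 * pi * t) powr (-1/2) * exp (- x\<^sup>2 / (2 * t))"

definition local_time_normalized ::
    "('n star \<Rightarrow> 'w measure) \<Rightarrow> (real \<Rightarrow> 'w \<Rightarrow> 'n star) \<Rightarrow> (real \<Rightarrow> 'w \<Rightarrow> real) \<Rightarrow> bool" where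
  "local_time_normalized P Z L \<longleftrightarrow>
    (\<forall>t>0. distributed (P vertex) (lborel \<Otimes>\<^sub>M lborel) (\<lambda>\<omega>. (dist (Z t \<omega>) vertex, L t \<omega>))
       (\<lambda>(y, w). if 0 < y \<and> 0 < w then ennreal (2 * ((y + w) / t) * gauss t (y + w)) else 0))"

section \<open>Subordinators and the time change\<close>

definition Levy_measure :: "real measure \<Rightarrow> bool" where
  "Levy_measure \<phi> \<longleftrightarrow> sets \<phi> = sets borel \<and> emeasure \<phi> {..0} = 0 \<and>
    (\<integral>\<^sup>+y. ennreal (min 1 y) \<partial>\<phi>) < \<infinity>"

definition Laplace_exponent :: "real measure \<Rightarrow> real \<Rightarrow> real" where
  "Laplace_exponent \<phi> l = (\<integral>y. 1 - exp (- l * y) \<partial>\<phi>)"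

definition subordinator :: "'w measure \<Rightarrow> (real \<Rightarrow> 'w \<Rightarrow> real) \<Rightarrow> bool" where
  "subordinator Q H \<longleftrightarrow>
    prob_space Q \<and>
    (\<forall>t\<ge>0. H t \<in> borel_measurable Q) \<and>
    (\<forall>\<omega>\<in>space Q. H 0 \<omega> = 0 \<and> mono_on {0..} (\<lambda>t. H t \<omega>) \<and>
       (\<forall>t\<ge>0. continuous (at_right t) (\<lambda>s. H s \<omega>))) \<and>
    (\<forall>s t. 0 \<le> s \<and> s \<le> t \<longrightarrow>
       distr Q borel (\<lambda>\<omega>. H t \<omega> - H s \<omega>) = distr Q borel (H (t - s)) \<and>
       prob_space.indep_set Q
         (sets (natural_filtration Q H (ennreal s)))
         (sets (vimage_algebra (space Q) (\<lambda>\<omega>. H t \<omega> - H s \<omega>) borel)))"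

definition subordinator_with :: "real measure \<Rightarrow> 'w measure \<Rightarrow> (real \<Rightarrow> 'w \<Rightarrow> real) \<Rightarrow> bool" where
  "subordinator_with \<phi> Q H \<longleftrightarrow> subordinator Q H \<and>
    (\<forall>l\<ge>0. \<forall>t\<ge>0. (\<integral>\<omega>. exp (- l * H t \<omega>) \<partial>Q) = exp (- t * Laplace_exponent \<phi> l))"

definition independent_processes ::
    "'w measure \<Rightarrow> (real \<Rightarrow> 'w \<Rightarrow> 's::topological_space) \<Rightarrow> (real \<Rightarrow> 'w \<Rightarrow> real) \<Rightarrow> bool" where
  "independent_processes Q Z H \<longleftrightarrow>
    prob_space.indep_set Q
      (sets (natural_filtration Q Z \<infinity>)) (sets (natural_filtration Q H \<infinity>))"

definition V_H :: "real \<Rightarrow> (real \<Rightarrow> 'w \<Rightarrow> real) \<Rightarrow> (real \<Rightarrow> 'w \<Rightarrow> real) \<Rightarrow> real \<Rightarrow> 'w \<Rightarrow> real" where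
  "V_H \<mu> H L t \<omega> = t + H (\<mu> * L t \<omega>) \<omega>"

definition V_H_inv :: "real \<Rightarrow> (real \<Rightarrow> 'w \<Rightarrow> real) \<Rightarrow> (real \<Rightarrow> 'w \<Rightarrow> real) \<Rightarrow> real \<Rightarrow> 'w \<Rightarrow> real" where
  "V_H_inv \<mu> H L t \<omega> = Inf {s. 0 \<le> s \<and> V_H \<mu> H L s \<omega> > t}"

definition Y_process :: "real \<Rightarrow> (real \<Rightarrow> 'w \<Rightarrow> real) \<Rightarrow> (real \<Rightarrow> 'w \<Rightarrow> real) \<Rightarrow> (real \<Rightarrow> 'w \<Rightarrow> 's) \<Rightarrow>
    real \<Rightarrow> 'w \<Rightarrow> 's" where
  "Y_process \<mu> H L Z t \<omega> = Z (V_H_inv \<mu> H L t \<omega>) \<omega>"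

definition potential_measure :: "'w measure \<Rightarrow> (real \<Rightarrow> 'w \<Rightarrow> real) \<Rightarrow> real measure" where
  "potential_measure Q H = measure_of UNIV (sets borel)
    (\<lambda>A. \<integral>\<^sup>+t. indicator {0..} t * emeasure Q {\<omega> \<in> space Q. H t \<omega> \<in> A} \<partial>lborel)"

section \<open>The non-local operator\<close>

definition tail :: "real measure \<Rightarrow> real \<Rightarrow> real" where
  "tail \<phi> z = measure \<phi> {z<..}"

definition nonlocal :: "real measure \<Rightarrow> (real \<Rightarrow> 'x \<Rightarrow> real) \<Rightarrow> real \<Rightarrow> 'x \<Rightarrow> real" where
  "nonlocal \<phi> u t x = (LBINT s=0..t. deriv (\<lambda>\<sigma>. u \<sigma> x) s * tail \<phi> (t - s))"

text \<open>\<open>k\<close> is a version of the density of the potential measure \<open>\<kappa>\<close>; since versions may be changed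
  on null sets, the pointwise bound for some version is the bound almost everywhere. The
  integrability clause says that the integral defining the non-local operator converges.\<close>

definition D_L :: "real measure \<Rightarrow> real measure \<Rightarrow> (real \<Rightarrow> 'n star \<Rightarrow> real) set" where
  "D_L \<phi> \<kappa> = {v.
    continuous_on ({0<..} \<times> UNIV) (\<lambda>(t, x). v t x) \<and>
    (let \<rho> = (\<lambda>t. v t vertex) in
      continuous_on {0<..} \<rho> \<and>
      (\<forall>t>0. \<rho> differentiable (at t)) \<and> continuous_on {0<..} (deriv \<rho>) \<and>
      (\<forall>t>0. interval_lebesgue_integrable lborel 0 (ereal t) (\<lambda>s. deriv \<rho> s * tail \<phi> (t - s))) \<and>
      continuous_on {0<..} (\<lambda>t. nonlocal \<phi> v t vertex) \<and>
      (\<exists>k M0. k \<in> borel_measurable borel \<and> (\<forall>s. 0 \<le> k s) \<and>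
         \<kappa> = density lborel (\<lambda>s. ennreal (k s)) \<and>
         0 < M0 \<and> (\<forall>t>0. \<bar>deriv \<rho> t\<bar> \<le> M0 * k t)))}"

end

theory Submission
  imports Defs
begin

text \<open>Both sides are bounded and continuous in \<open>t\<close>, so it suffices to compare their Laplace transforms.
  These are used in probabilistic form: \<open>expo l\<close> is the law of an exponential time of rate \<open>l\<close>, and
  \<open>\<integral>t. f t \<partial>expo l\<close> is \<open>l\<close> times the Laplace transform of \<open>f\<close> at \<open>l\<close>. Put \<open>\<Phi> = Laplace_exponent \<phi> l\<close>,
  \<open>a = \<mu> * \<Phi>\<close>, \<open>s = sqrt (2 * l)\<close>, \<open>w = u0 - u0 vertex\<close>, and write \<open>|x|\<close> for \<open>dist x vertex\<close>.

  The analytic side. Averaging \<open>u t x\<close> over \<open>expo l\<close> gives a function \<open>v\<close> on the star graph. The heat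
  equation becomes \<open>1/2 v'' = l (v - u0)\<close> on the rays; a maximum principle shows that \<open>v\<close> vanishes at
  infinity. The bound on the time derivative at the vertex by the potential density makes the
  non-local term Laplace transformable: it is a convolution with the tail of \<open>\<phi>\<close>, whose transform is
  \<open>\<Phi> / l\<close>, and the transform of the potential measure, \<open>1 / \<Phi>\<close>, is finite. Hence the vertex condition
  becomes the elastic condition \<open>\<Sum>p\<^sub>k v\<^sub>k'(0) = a (v(0) - u0(0))\<close> (lemmas
  \<open>nonlocal_Laplace\<close> and \<open>elliptic_problem\<close>).

  The probabilistic side. The trajectory \<open>Y\<close> differs from \<open>Z\<close> only by being held at the vertex during
  the jumps of \<open>H\<close>, and there \<open>w\<close> vanishes. A change of variables along each path, followed by
  averaging over the independent subordinator, turns the transform of \<open>E w(Y\<^sub>t)\<close> into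
  \<open>Ra a l w x = \<integral> E\<^sup>x [exp (- a L\<^sub>t) w (Z\<^sub>t)] expo l (dt)\<close>, which is \<open>l\<close> times the resolvent of \<open>Z\<close> killed at
  rate \<open>a\<close> by its local time at the vertex (lemma \<open>Y_Laplace\<close>).

  The two sides meet in \<open>Ra_boundary_problem\<close>: \<open>Ra a l w = v - u0(0)\<close>. There the local time is
  approximated by additive functionals \<open>\<integral>q\<^sub>N(Z) dt\<close> with \<open>q\<^sub>N\<close> a multiple of \<open>N exp (- N |x|)\<close>, for which a
  Feynman-Kac identity follows from the Markov property at fixed times and the description of the
  generator. As \<open>N\<close> grows, \<open>q\<^sub>N\<close> charges only the vertex, and the identity for a function \<open>g\<close> in the
  domain of the generator tends to \<open>Ra a l f = g - g(0) (1 - Ra a l 1)\<close>, where \<open>l f = l g - 1/2 g''\<close>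
  (lemma \<open>Ra_core\<close>). Two choices of \<open>g\<close> suffice. Smoothed copies of \<open>exp (- s |x|)\<close> give
  \<open>1 - Ra a l 1 = a / (s + a) * exp (- s |x|)\<close>; the constant in the occupation density of the local time
  is identified from \<open>E L\<^sub>t\<close>, computed from the given joint density. The other choice is
  \<open>v + (a / s) (v(0) - u0(0)) exp (- s |x|)\<close>, where the exponential corrects the vertex condition of \<open>v\<close>
  to that of the domain.\<close>

section \<open>Measurability of processes with right-continuous paths\<close>

lemma (in finite_measure) bounded_convergence:
  fixes f :: "nat \<Rightarrow> 'a \<Rightarrow> real"
  assumes "\<And>n. f n \<in> borel_measurable M" "g \<in> borel_measurable M"
    and "AE x in M. (\<lambda>n. f n x) \<longlonglongrightarrow> g x"
    and "\<And>n. AE x in M. \<bar>f n x\<bar> \<le> B"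
  shows "(\<lambda>n. \<integral>x. f n x \<partial>M) \<longlonglongrightarrow> (\<integral>x. g x \<partial>M)"
  by (rule integral_dominated_convergence[where w="\<lambda>_. B"]) (use assms in auto)

text \<open>The process sampled at the next point of a grid of mesh \<open>1 / (n + 1)\<close> is measurable, being a
  countable case distinction; right-continuity lets the mesh tend to zero. The grid point has to lie
  strictly to the right of \<open>s\<close>, hence the added one.\<close>

lemma right_continuous_jointly_measurable:
  fixes f :: "real \<Rightarrow> 'a \<Rightarrow> real"
  assumes m: "\<And>s. f s \<in> borel_measurable M"
    and c: "\<And>s \<omega>. \<omega> \<in> space M \<Longrightarrow> continuous (at_right s) (\<lambda>s. f s \<omega>)"
  shows "(\<lambda>(s, \<omega>). f s \<omega>) \<in> borel_measurable (borel \<Otimes>\<^sub>M M)"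
proof -
  define d where "d n s = (real_of_int \<lfloor>real (Suc n) * s\<rfloor> + 1) / real (Suc n)" for n s
  have dgt: "s < d n s" for n s
    using floor_correct[of "real (Suc n) * s"]
    by (simp add: d_def pos_less_divide_eq mult.commute del: of_nat_Suc)
  have dle: "d n s \<le> s + 1 / real (Suc n)" for n s
    using floor_correct[of "real (Suc n) * s"]
    by (simp add: d_def pos_divide_le_eq distrib_right mult.commute field_simps del: of_nat_Suc)
  have dlim: "(\<lambda>n. d n s) \<longlonglongrightarrow> s" for s
  proof (rule tendsto_sandwich)
    show "\<forall>\<^sub>F n in sequentially. s \<le> d n s" "\<forall>\<^sub>F n in sequentially. d n s \<le> s + 1 / real (Suc n)"
      using dgt dle less_imp_le by (blast intro: always_eventually)+
    show "(\<lambda>n. s + 1 / real (Suc n)) \<longlonglongrightarrow> s"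
      using tendsto_add[OF tendsto_const[of s] LIMSEQ_inverse_real_of_nat] by (simp add: divide_inverse)
  qed simp
  show ?thesis
  proof (rule borel_measurable_LIMSEQ_real)
    show "(\<lambda>z. f (d n (fst z)) (snd z)) \<in> borel_measurable (borel \<Otimes>\<^sub>M M)" for n
      unfolding d_def
    proof (rule measurable_compose_countable[where f="\<lambda>i z. f ((real_of_int i + 1) / real (Suc n)) (snd z)"
          and g="\<lambda>z. \<lfloor>real (Suc n) * fst z\<rfloor>"])
      show "(\<lambda>z. f ((real_of_int i + 1) / real (Suc n)) (snd z)) \<in> borel_measurable (borel \<Otimes>\<^sub>M M)" for i
        by (rule measurable_compose[OF measurable_snd m])
    qed measurable
    fix z :: "real \<times> 'a" assume z: "z \<in> space (borel \<Otimes>\<^sub>M M)"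
    then have "snd z \<in> space M" by (auto simp: space_pair_measure)
    from c[OF this, of "fst z"] have "((\<lambda>s. f s (snd z)) \<longlongrightarrow> f (fst z) (snd z)) (at_right (fst z))"
      by (simp add: continuous_within)
    moreover have "filterlim (\<lambda>n. d n (fst z)) (at_right (fst z)) sequentially"
      unfolding filterlim_at using dlim dgt by (simp add: less_imp_neq[symmetric])
    ultimately show "(\<lambda>n. f (d n (fst z)) (snd z)) \<longlonglongrightarrow> (case z of (s, \<omega>) \<Rightarrow> f s \<omega>)"
      by (auto simp: split_beta dest: filterlim_compose)
  qed
qed

lemma right_continuous_at_random_time:
  fixes f :: "real \<Rightarrow> 'a \<Rightarrow> real"
  assumes m: "\<And>s. f s \<in> borel_measurable M"
    and c: "\<And>s \<omega>. \<omega> \<in> space M \<Longrightarrow> continuous (at_right s) (\<lambda>s. f s \<omega>)"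
    and [measurable]: "\<tau> \<in> borel_measurable M"
  shows "(\<lambda>\<omega>. f (\<tau> \<omega>) \<omega>) \<in> borel_measurable M"
proof -
  have "(\<lambda>\<omega>. (\<tau> \<omega>, \<omega>)) \<in> M \<rightarrow>\<^sub>M borel \<Otimes>\<^sub>M M" by measurable
  from measurable_compose[OF this right_continuous_jointly_measurable[OF m c]]
  show ?thesis by simp
qed

section \<open>Laplace transforms as expectations at exponential times\<close>

definition expo :: "real \<Rightarrow> real measure" where
  "expo l = density lborel (\<lambda>t. ennreal (exponential_density l t))"

lemma sets_expo [simp, measurable_cong]: "sets (expo l) = sets borel"
  by (simp add: expo_def)

lemma space_expo [simp]: "space (expo l) = UNIV"
  by (simp add: expo_def)

lemma prob_space_expo: "0 < l \<Longrightarrow> prob_space (expo l)"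
  using prob_space_exponential_density by (simp add: expo_def)

lemma integral_expo:
  fixes f :: "real \<Rightarrow> real"
  assumes "f \<in> borel_measurable borel" "0 < l"
  shows "(\<integral>t. f t \<partial>expo l) = (\<integral>t. exponential_density l t * f t \<partial>lborel)"
  unfolding expo_def by (subst integral_density) (use assms exponential_density_nonneg in auto)

lemma AE_expo_pos: "AE t in expo l. 0 < t"
proof -
  have "AE t in lborel. t \<noteq> (0::real)" by (rule AE_lborel_singleton)
  then show ?thesis
    unfolding expo_def by (subst AE_density) (auto simp: exponential_density_def)
qed

lemma integrable_expo_bounded:
  fixes f :: "real \<Rightarrow> real"
  assumes "0 < l" "f \<in> borel_measurable borel" "\<And>t. 0 < t \<Longrightarrow> \<bar>f t\<bar> \<le> B"
  shows "integrable (expo l) f"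
proof -
  interpret prob_space "expo l" by (rule prob_space_expo) fact
  have "AE t in expo l. norm (f t) \<le> B" using AE_expo_pos[of l] by eventually_elim (simp add: assms(3))
  then show ?thesis using assms(2) by (intro integrable_const_bound) auto
qed

text \<open>The transforms at rates \<open>1, 2, \<dots>\<close> are the moments of \<open>f\<close> against powers of \<open>exp (- t)\<close>. By the
  Weierstrass theorem \<open>f\<close> is then orthogonal to every continuous function of \<open>exp (- t)\<close>, in particular
  to \<open>F (exp (- t)) = exp (- t) * f t\<close>. The factor \<open>exp (- t)\<close> makes \<open>F\<close> continuous at \<open>0\<close>, that is, at
  infinite time.\<close>

lemma Laplace_unique:
  fixes f :: "real \<Rightarrow> real"
  assumes c: "continuous_on {0..} f" and m: "f \<in> borel_measurable borel"
    and B: "\<And>t. 0 \<le> t \<Longrightarrow> \<bar>f t\<bar> \<le> B"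
    and z: "\<And>l. 0 < l \<Longrightarrow> (\<integral>t. f t \<partial>expo l) = 0"
    and t: "0 \<le> t"
  shows "f t = 0"
proof -
  interpret E: prob_space "expo 1" by (rule prob_space_expo) simp
  note [measurable] = m
  have B0: "0 \<le> B" using B[of 0] by auto
  define F where "F x = (if x \<le> 0 then 0 else x * f (- ln x))" for x :: real
  have Fexp: "F (exp (- t)) = exp (- t) * f t" for t by (simp add: F_def)
  have moments: "(\<integral>t. exp (- t) ^ k * f t \<partial>expo 1) = 0" for k
  proof -
    have "(\<integral>t. exp (- t) ^ k * f t \<partial>expo 1) = (\<integral>t. exponential_density 1 t * (exp (- t) ^ k * f t) \<partial>lborel)"
      by (rule integral_expo) auto
    also have "\<dots> = (\<integral>t. (1 / (real k + 1)) * (exponential_density (real k + 1) t * f t) \<partial>lborel)"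
    proof (rule Bochner_Integration.integral_cong)
      fix t :: real
      have "exp (- t) ^ k = exp (- (real k * t))"
        by (simp flip: exp_of_nat_mult)
      then have "exp (- t) * exp (- t) ^ k = exp (- t * (real k + 1))"
        by (simp add: exp_add[symmetric] ring_distribs)
      then show "exponential_density 1 t * (exp (- t) ^ k * f t) =
          1 / (real k + 1) * (exponential_density (real k + 1) t * f t)"
        by (simp add: exponential_density_def)
    qed simp
    also have "\<dots> = (1 / (real k + 1)) * (\<integral>t. f t \<partial>expo (real k + 1))"
      by (subst integral_expo) (auto simp: m)
    also have "\<dots> = 0" using z[of "real k + 1"] by simp
    finally show ?thesis .
  qed
  have contF: "continuous_on {0..1} F"
    unfolding continuous_on_eq_continuous_within
  proof
    fix x :: real assume x: "x \<in> {0..1}"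
    show "continuous (at x within {0..1}) F"
    proof (cases "x = 0")
      case True
      have lim0: "((\<lambda>y. \<bar>y\<bar> * B) \<longlongrightarrow> \<bar>0\<bar> * B) (at 0 within {0..1})"
        by (intro tendsto_mult tendsto_rabs tendsto_const tendsto_ident_at)
      have "(F \<longlongrightarrow> 0) (at 0 within {0..1})"
      proof (rule Lim_null_comparison[where g="\<lambda>y. \<bar>y\<bar> * B"])
        show "\<forall>\<^sub>F y in at 0 within {0..1}. norm (F y) \<le> \<bar>y\<bar> * B"
          unfolding eventually_at_topological
          by (intro exI[of _ UNIV]) (auto simp: F_def abs_mult intro!: mult_left_mono B)
      qed (use lim0 in simp)
      then show ?thesis using True by (simp add: continuous_within) (simp add: F_def)
    next
      case False
      with x have x0: "0 < x" "x \<le> 1" by auto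
      have "continuous_on {x/2..1} (\<lambda>y. y * f (- ln y))"
        using x0 by (intro continuous_intros continuous_on_compose2[OF c]) (auto simp: ln_le_zero_iff)
      then have "continuous_on {x/2..1} F"
        by (rule continuous_on_eq) (use x0 in \<open>auto simp: F_def\<close>)
      then have "continuous (at x within {x/2..1}) F"
        using x0 by (auto simp: continuous_on_eq_continuous_within)
      moreover have "at x within {x/2..1} = at x within {0..1}"
        by (rule at_within_nhd[of _ "{x/2<..}"]) (use x0 in auto)
      ultimately show ?thesis by (metis continuous_within)
    qed
  qed
  have int: "integrable (expo 1) (\<lambda>t. exp (- t) * (f t)\<^sup>2)"
  proof (rule integrable_expo_bounded[where B="B\<^sup>2"])
    show "\<bar>exp (- t) * (f t)\<^sup>2\<bar> \<le> B\<^sup>2" if "0 < t" for t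
      using that B[of t] mult_mono[of "exp (- t)" 1 "(f t)\<^sup>2" "B\<^sup>2"] power_mono[of "\<bar>f t\<bar>" B 2]
      by (auto simp: abs_mult)
  qed auto
  have sq: "(\<integral>t. exp (- t) * (f t)\<^sup>2 \<partial>expo 1) = 0"
  proof -
    have "\<bar>\<integral>t. exp (- t) * (f t)\<^sup>2 \<partial>expo 1\<bar> \<le> e * B" if e: "0 < e" for e
    proof -
      obtain g where g: "real_polynomial_function g" "\<And>x. x \<in> {0..1} \<Longrightarrow> \<bar>F x - g x\<bar> < e"
        by (rule Stone_Weierstrass_real_polynomial_function[OF _ contF e]) auto
      then obtain a n where gs: "g = (\<lambda>x. \<Sum>i\<le>n. a i * x ^ i)"
        unfolding real_polynomial_function_iff_sum by blast
      have intk: "integrable (expo 1) (\<lambda>t. exp (- t) ^ k * f t)" for k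
      proof (rule integrable_expo_bounded[where B=B])
        show "\<bar>exp (- t) ^ k * f t\<bar> \<le> B" if "0 < t" for t
          using that B[of t] mult_mono[of "exp (- t) ^ k" 1 "\<bar>f t\<bar>" B] 
          by (auto simp: abs_mult power_le_one)
      qed auto
      have g0: "(\<integral>t. g (exp (- t)) * f t \<partial>expo 1) = 0"
        unfolding gs sum_distrib_right mult.assoc
        by (subst Bochner_Integration.integral_sum) (auto intro: intk simp: moments)
      have ig: "integrable (expo 1) (\<lambda>t. g (exp (- t)) * f t)"
        unfolding gs sum_distrib_right mult.assoc by (intro Bochner_Integration.integrable_sum integrable_mult_right intk)
      have "(\<integral>t. exp (- t) * (f t)\<^sup>2 \<partial>expo 1) = (\<integral>t. exp (- t) * (f t)\<^sup>2 - g (exp (- t)) * f t \<partial>expo 1)"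
        using int ig g0 by simp
      also have "\<bar>\<dots>\<bar> \<le> (\<integral>t. \<bar>exp (- t) * (f t)\<^sup>2 - g (exp (- t)) * f t\<bar> \<partial>expo 1)"
        using integral_norm_bound by auto
      also have "\<dots> \<le> (\<integral>t. e * B \<partial>expo 1)"
      proof (rule integral_mono_AE)
        show "AE t in expo 1. \<bar>exp (- t) * (f t)\<^sup>2 - g (exp (- t)) * f t\<bar> \<le> e * B"
          using AE_expo_pos[of 1]
        proof eventually_elim
          case (elim t)
          have "exp (- t) * (f t)\<^sup>2 - g (exp (- t)) * f t = (F (exp (- t)) - g (exp (- t))) * f t"
            by (simp add: Fexp power2_eq_square algebra_simps)
          also have "\<bar>\<dots>\<bar> \<le> e * B"
            unfolding abs_mult using g(2)[of "exp (- t)"] elim B[of t] e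
            by (intro mult_mono) auto
          finally show ?case .
        qed
      qed (use int ig in auto)
      also have "\<dots> = e * B" by (simp add: E.prob_space[simplified])
      finally show ?thesis .
    qed
    note bd = this
    have "\<bar>\<integral>t. exp (- t) * (f t)\<^sup>2 \<partial>expo 1\<bar> \<le> e" if "0 < e" for e
    proof -
      have "e / (B + 1) * B \<le> e" using that B0 by (simp add: field_simps)
      with bd[of "e / (B + 1)"] that B0 show ?thesis by auto
    qed
    then have "\<bar>\<integral>t. exp (- t) * (f t)\<^sup>2 \<partial>expo 1\<bar> \<le> 0" by (rule field_le_epsilon) simp
    then show ?thesis by (simp only: abs_le_zero_iff)
  qed
  have "AE t in expo 1. exp (- t) * (f t)\<^sup>2 = 0"
    using integral_nonneg_eq_0_iff_AE[OF int] sq by simp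
  then have "AE t in lborel. 0 < ennreal (exponential_density 1 t) \<longrightarrow> exp (- t) * (f t)\<^sup>2 = 0"
    unfolding expo_def by (subst (asm) AE_density) simp_all
  then have ae: "AE t in lborel. 0 \<le> t \<longrightarrow> f t = 0"
    by eventually_elim (simp add: exponential_density_def)
  have "((\<lambda>x. (f x)\<^sup>2) has_integral 0) (cbox 0 (t + 1))"
  proof -
    have "AE x in lborel. indicator (cbox 0 (t + 1)) x *\<^sub>R (f x)\<^sup>2 = 0"
      using ae by eventually_elim (auto simp: indicator_def)
    then have "has_bochner_integral lborel (\<lambda>x. indicator (cbox 0 (t + 1)) x *\<^sub>R (f x)\<^sup>2) 0"
      by (subst has_bochner_integral_cong_AE[where g="\<lambda>_. 0"]) auto
    then have "integrable lborel (\<lambda>x. indicator (cbox 0 (t + 1)) x *\<^sub>R (f x)\<^sup>2)"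
      "(\<integral>x. indicator (cbox 0 (t + 1)) x *\<^sub>R (f x)\<^sup>2 \<partial>lborel) = 0"
      by (simp_all only: has_bochner_integral_iff)
    from has_integral_integral_lborel[OF this(1)] this(2)
    have "((\<lambda>x. indicator (cbox 0 (t + 1)) x *\<^sub>R (f x)\<^sup>2) has_integral 0) UNIV" by simp
    then show ?thesis
      by (subst has_integral_restrict_UNIV[symmetric], rule has_integral_eq[rotated]) (auto simp: indicator_def)
  qed
  then have "(f t)\<^sup>2 = 0"
    by (rule has_integral_0_cbox_imp_0[rotated 2])
       (use t in \<open>auto intro!: continuous_intros continuous_on_subset[OF c]\<close>)
  then show ?thesis by simp
qed

section \<open>Bounded solutions of the resolvent equation on a half-line\<close>

lemma nonpositive_by_maximum_principle:
  fixes y :: "real \<Rightarrow> real"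
  assumes ab: "a < b"
    and c: "continuous_on {a..b} y" and bd: "y a \<le> 0" "y b \<le> 0"
    and d1: "\<And>r. a < r \<Longrightarrow> r < b \<Longrightarrow> (y has_real_derivative y1 r) (at r)"
    and d2: "\<And>r. a < r \<Longrightarrow> r < b \<Longrightarrow> (y1 has_real_derivative y2 r) (at r)"
    and pos: "\<And>r. a < r \<Longrightarrow> r < b \<Longrightarrow> 0 < y r \<Longrightarrow> 0 < y2 r"
    and m: "m \<in> {a..b}"
  shows "y m \<le> 0"
proof (rule ccontr)
  assume "\<not> y m \<le> 0"
  obtain x where x: "x \<in> {a..b}" "\<And>z. z \<in> {a..b} \<Longrightarrow> y z \<le> y x"
    using continuous_attains_sup[OF _ _ c] ab by auto
  then have yx: "0 < y x" using m \<open>\<not> y m \<le> 0\<close> by force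
  with bd x have xab: "a < x" "x < b" by (auto simp: order_le_less)
  have "y1 x = 0"
  proof (rule DERIV_local_max[OF d1[OF xab], of "min (x - a) (b - x)"])
    show "\<forall>z. \<bar>x - z\<bar> < min (x - a) (b - x) \<longrightarrow> y z \<le> y x"
      using x(2) by (auto simp: abs_if split: if_splits)
  qed (use xab in auto)
  moreover obtain d where d: "0 < d" "\<And>h. 0 < h \<Longrightarrow> h < d \<Longrightarrow> y1 x < y1 (x + h)"
    using DERIV_pos_inc_right[OF d2[OF xab] pos[OF xab yx]] by auto
  define h where "h = min (d / 2) ((b - x) / 2)"
  have h: "0 < h" "h < d" "x + h < b" using d xab by (auto simp: h_def min_def field_simps)
  obtain \<xi> where \<xi>: "x < \<xi>" "\<xi> < x + h" "y (x + h) - y x = (x + h - x) * y1 \<xi>"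
    using MVT2[of x "x + h" y y1] h xab d1 by auto
  have "0 < y1 \<xi>" using d(2)[of "\<xi> - x"] \<xi>(1,2) h(2) \<open>y1 x = 0\<close> by simp
  then have "y x < y (x + h)" using \<xi>(3) mult_pos_pos[OF h(1) \<open>0 < y1 \<xi>\<close>] by simp
  with x(2)[of "x + h"] h xab show False by auto
qed

text \<open>On an interval of half-width \<open>d\<close> around \<open>m\<close>, a bounded solution lies below the barrier
  \<open>e / 2 + B cosh (s (r - m)) / cosh (s d)\<close>, which dominates \<open>B\<close> at the end points and solves the
  homogeneous equation up to the constant. At the centre the second summand is \<open>B / cosh (s d)\<close>, which
  is small once \<open>m\<close> is far from the region where the inhomogeneity is large.\<close>

lemma bounded_solution_vanishes_at_infinity:
  fixes v :: "real \<Rightarrow> real"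
  assumes l: "0 < l" and B: "\<And>r. 0 \<le> r \<Longrightarrow> \<bar>v r\<bar> \<le> B"
    and d1: "\<And>r. 0 < r \<Longrightarrow> (v has_real_derivative v1 r) (at r)"
    and d2: "\<And>r. 0 < r \<Longrightarrow> (v1 has_real_derivative 2 * l * (v r - f r)) (at r)"
    and f: "\<And>e. 0 < e \<Longrightarrow> \<exists>R. \<forall>r>R. \<bar>f r\<bar> < e"
    and e: "0 < e"
  shows "\<exists>R. \<forall>r>R. \<bar>v r\<bar> < e"
proof -
  define s where "s = sqrt (2 * l)"
  have s: "0 < s" "s\<^sup>2 = 2 * l" using l by (auto simp: s_def)
  obtain R0 where R0: "\<And>r. r > R0 \<Longrightarrow> \<bar>f r\<bar> < e / 2" using f[of "e / 2"] e by auto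
  define R where "R = max 1 (R0 + 1)"
  have B0: "0 \<le> B" using B[of 0] by auto
  have barrier: "\<bar>v m\<bar> \<le> e / 2 + B / cosh (s * (m - R))" if m: "m > R" for m
  proof -
    define d where "d = m - R"
    have d: "0 < d" using m by (simp add: d_def)
    define C where "C = B / cosh (s * d)"
    have C0: "0 \<le> C" using B0 by (simp add: C_def)
    have one: "\<sigma> * v m \<le> e / 2 + C" if \<sigma>: "\<sigma> = 1 \<or> \<sigma> = -1" for \<sigma>
    proof -
      define y where "y r = \<sigma> * v r - e / 2 - C * cosh (s * (r - m))" for r
      define y1 where "y1 r = \<sigma> * v1 r - C * s * sinh (s * (r - m))" for r
      define y2 where "y2 r = \<sigma> * (2 * l * (v r - f r)) - C * s\<^sup>2 * cosh (s * (r - m))" for r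
      have "y m \<le> 0"
      proof (rule nonpositive_by_maximum_principle[of "m - d" "m + d" y y1 y2])
        have Rp: "R \<ge> 1" "R \<ge> R0 + 1" by (auto simp: R_def)
        have md: "m - d = R" by (simp add: d_def)
        show D1: "(y has_real_derivative y1 r) (at r)" if "m - d < r" for r
          unfolding y_def y1_def using that md Rp
          by (auto intro!: derivative_eq_intros d1 simp: power2_eq_square)
        show "(y1 has_real_derivative y2 r) (at r)" if "m - d < r" for r
          unfolding y1_def y2_def using that md Rp
          by (auto intro!: derivative_eq_intros d2 simp: power2_eq_square)
        show "continuous_on {m - d..m + d} y"
          unfolding y_def using Rp md
          by (auto intro!: continuous_intros DERIV_continuous_on[of _ v v1] has_field_derivative_at_within[OF d1])
        have \<sigma>v: "\<sigma> * v r \<le> B" if "0 \<le> r" for r using B[OF that] \<sigma> by auto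
        show "y (m - d) \<le> 0" "y (m + d) \<le> 0"
          using \<sigma>v[of "m - d"] \<sigma>v[of "m + d"] md Rp d e by (auto simp: y_def C_def)
        show "0 < y2 r" if "m - d < r" "0 < y r" for r
        proof -
          have "\<bar>f r\<bar> < e / 2" using that md Rp by (intro R0) auto
          then have "\<sigma> * f r < e / 2" using \<sigma> by auto
          then have "0 < \<sigma> * v r - \<sigma> * f r - C * cosh (s * (r - m))"
            using that(2) by (simp add: y_def)
          then have "0 < s\<^sup>2 * (\<sigma> * v r - \<sigma> * f r - C * cosh (s * (r - m)))"
            using s(1) by (intro mult_pos_pos) auto
          also have "\<dots> = y2 r" by (simp add: y2_def s algebra_simps)
          finally show ?thesis .
        qed
      qed (use d in auto)
      then show ?thesis by (simp add: y_def)
    qed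
    from one[of 1] one[of "-1"] show ?thesis by (simp add: C_def d_def)
  qed
  have "((\<lambda>m. B / cosh (s * (m - R))) \<longlongrightarrow> 0) at_top"
  proof -
    have "filterlim (\<lambda>m. - R + m) at_top at_top"
      by (rule filterlim_tendsto_add_at_top[OF tendsto_const filterlim_ident])
    from filterlim_tendsto_pos_mult_at_top[OF tendsto_const s(1) this]
    have "filterlim (\<lambda>m. s * (m - R)) at_top at_top" by simp
    from filterlim_compose[OF cosh_real_at_top this] show ?thesis
      by (intro tendsto_divide_0[OF tendsto_const] filterlim_at_top_imp_at_infinity)
  qed
  then have "\<forall>\<^sub>F m in at_top. B / cosh (s * (m - R)) < e / 2"
    using e by (intro order_tendstoD) auto
  then obtain R1 where R1: "\<And>m. m \<ge> R1 \<Longrightarrow> B / cosh (s * (m - R)) < e / 2"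
    by (auto simp: eventually_at_top_linorder)
  show ?thesis
  proof (intro exI allI impI)
    fix r assume "r > max R R1"
    then have "\<bar>v r\<bar> \<le> e / 2 + B / cosh (s * (r - R))" "B / cosh (s * (r - R)) < e / 2"
      using barrier[of r] R1[of r] by simp_all
    then show "\<bar>v r\<bar> < e" by linarith
  qed
qed

section \<open>Levy measures, convolutions and the potential measure\<close>

lemma emeasure_greaterThan_eq_nn_integral:
  fixes \<phi> :: "real measure"
  assumes "sets \<phi> = sets borel"
  shows "emeasure \<phi> {z<..} = (\<integral>\<^sup>+y. (if z < y then 1 else 0) \<partial>\<phi>)"
proof -
  have "emeasure \<phi> {z<..} = (\<integral>\<^sup>+y. indicator {z<..} y \<partial>\<phi>)" using assms by simp
  also have "\<dots> = (\<integral>\<^sup>+y. (if z < y then 1 else 0) \<partial>\<phi>)"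
    by (intro nn_integral_cong) (simp add: indicator_def)
  finally show ?thesis .
qed

lemma Levy_tail_finite:
  assumes L: "Levy_measure \<phi>" and z: "0 < z"
  shows "emeasure \<phi> {z<..} < \<infinity>"
proof -
  have [measurable_cong]: "sets \<phi> = sets borel" using L by (simp add: Levy_measure_def)
  define c where "c = min 1 z"
  have c: "0 < c" using z by (simp add: c_def)
  have "emeasure \<phi> {z<..} = (\<integral>\<^sup>+y. (if z < y then 1 else 0) \<partial>\<phi>)"
    by (rule emeasure_greaterThan_eq_nn_integral) (use L in \<open>simp add: Levy_measure_def\<close>)
  also have "\<dots> \<le> (\<integral>\<^sup>+y. ennreal (1 / c) * ennreal (min 1 y) \<partial>\<phi>)"
  proof (intro nn_integral_mono)
    fix y :: real
    show "(if z < y then 1 else 0) \<le> ennreal (1 / c) * ennreal (min 1 y)"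
      using z c by (auto simp: indicator_def c_def min_def divide_simps simp flip: ennreal_mult ennreal_1 split: if_splits)
  qed
  also have "\<dots> = ennreal (1 / c) * (\<integral>\<^sup>+y. ennreal (min 1 y) \<partial>\<phi>)"
    by (rule nn_integral_cmult) measurable
  also have "\<dots> < \<infinity>"
    using L by (simp add: Levy_measure_def ennreal_mult_less_top)
  finally show ?thesis .
qed

lemma Levy_sigma_finite:
  assumes L: "Levy_measure \<phi>"
  shows "sigma_finite_measure \<phi>"
proof
  have S: "sets \<phi> = sets borel" using L by (simp add: Levy_measure_def)
  then have sp: "space \<phi> = UNIV" by (metis sets_eq_imp_space_eq space_borel)
  let ?A = "insert {..0} (range (\<lambda>n. {1 / real (Suc n)<..}))"
  show "\<exists>A. countable A \<and> A \<subseteq> sets \<phi> \<and> \<Union> A = space \<phi> \<and> (\<forall>a\<in>A. emeasure \<phi> a \<noteq> \<infinity>)"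
  proof (intro exI[of _ ?A] conjI ballI)
    show "\<Union> ?A = space \<phi>"
    proof -
      have "x \<in> \<Union> ?A" for x :: real
      proof (cases "x \<le> 0")
        case False
        then obtain n where "inverse (real (Suc n)) < x" using reals_Archimedean[of x] by auto
        then show ?thesis by (auto simp: inverse_eq_divide)
      qed auto
      then show ?thesis by (auto simp: sp)
    qed
    show "emeasure \<phi> a \<noteq> \<infinity>" if "a \<in> ?A" for a
      using that Levy_tail_finite[OF L] L by (auto simp: Levy_measure_def less_top)
  qed (auto simp: S)
qed

lemma Levy_AE_pos:
  assumes L: "Levy_measure \<phi>"
  shows "AE y in \<phi>. 0 < y"
proof -
  have S: "sets \<phi> = sets borel" using L by (simp add: Levy_measure_def)
  then have sp: "space \<phi> = UNIV" by (metis sets_eq_imp_space_eq space_borel)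
  show ?thesis
    by (rule AE_I[where N="{..0}"]) (use L S sp in \<open>auto simp: Levy_measure_def\<close>)
qed

lemma Levy_integrable_exponent:
  assumes L: "Levy_measure \<phi>" and l: "0 < l"
  shows "integrable \<phi> (\<lambda>y. 1 - exp (- l * y))"
proof (rule Bochner_Integration.integrable_bound)
  have [measurable_cong]: "sets \<phi> = sets borel" using L by (simp add: Levy_measure_def)
  have "(\<integral>\<^sup>+y. ennreal (norm (max 1 l * max 0 (min 1 y))) \<partial>\<phi>) =
      (\<integral>\<^sup>+y. ennreal (max 1 l) * ennreal (min 1 y) \<partial>\<phi>)"
    by (intro nn_integral_cong) (auto simp: abs_mult ennreal_mult max_def ennreal_neg)
  also have "\<dots> = ennreal (max 1 l) * (\<integral>\<^sup>+y. ennreal (min 1 y) \<partial>\<phi>)"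
    by (rule nn_integral_cmult) measurable
  also have "\<dots> < \<infinity>"
    using L by (simp add: Levy_measure_def ennreal_mult_less_top)
  finally show "integrable \<phi> (\<lambda>y. max 1 l * max 0 (min 1 y))"
    by (intro integrableI_bounded) auto
  show "(\<lambda>y. 1 - exp (- l * y)) \<in> borel_measurable \<phi>" by measurable
  show "AE y in \<phi>. norm (1 - exp (- l * y)) \<le> norm (max 1 l * max 0 (min 1 y))"
    using Levy_AE_pos[OF L]
  proof eventually_elim
    case (elim y)
    have "1 - exp (- l * y) \<le> l * y" using exp_ge_add_one_self[of "- l * y"] by linarith
    moreover have "1 - exp (- l * y) \<le> 1" by simp
    moreover have "l * y \<le> max 1 l * y" using elim by (intro mult_right_mono) auto
    moreover have "1 \<le> max 1 l * 1" by simp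
    moreover have "max 0 (min 1 y) = y \<or> max 0 (min 1 y) = 1" using elim by auto
    ultimately have "1 - exp (- l * y) \<le> max 1 l * max 0 (min 1 y)"
      by (metis order_trans)
    moreover have "0 \<le> 1 - exp (- l * y)" using elim l by simp
    ultimately show ?case by simp
  qed
qed

lemma Laplace_exponent_pos:
  assumes L: "Levy_measure \<phi>" and inf: "emeasure \<phi> {0<..} = \<infinity>" and l: "0 < l"
  shows "0 < Laplace_exponent \<phi> l"
proof -
  have S: "sets \<phi> = sets borel" using L by (simp add: Levy_measure_def)
  have nn: "AE y in \<phi>. 0 \<le> 1 - exp (- l * y)"
    using Levy_AE_pos[OF L] by eventually_elim (use l in simp)
  have "0 \<le> Laplace_exponent \<phi> l"
    unfolding Laplace_exponent_def by (rule integral_nonneg_AE[OF nn])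
  moreover have "Laplace_exponent \<phi> l \<noteq> 0"
  proof
    assume "Laplace_exponent \<phi> l = 0"
    then have "AE y in \<phi>. 1 - exp (- l * y) = 0"
      unfolding Laplace_exponent_def
      using integral_nonneg_eq_0_iff_AE[OF Levy_integrable_exponent[OF L l] nn] by simp
    then have "AE y in \<phi>. y \<notin> {0<..}"
      by eventually_elim (use l in auto)
    then have "emeasure \<phi> {0<..} = 0"
      by (subst (asm) AE_iff_null_sets[symmetric]) (auto simp: S null_sets_def)
    with inf show False by simp
  qed
  ultimately show ?thesis by linarith
qed

lemma tail_measurable:
  assumes L: "Levy_measure \<phi>"
  shows "tail \<phi> \<in> borel_measurable borel"
proof -
  have S [measurable_cong]: "sets \<phi> = sets borel" using L by (simp add: Levy_measure_def)
  interpret sigma_finite_measure \<phi> by (rule Levy_sigma_finite[OF L])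
  have E: "emeasure \<phi> {z<..} = (\<integral>\<^sup>+y. (if z < y then 1 else 0) \<partial>\<phi>)" for z
    by (rule emeasure_greaterThan_eq_nn_integral[OF S])
  have "(\<lambda>z. tail \<phi> z) \<in> borel_measurable borel"
    unfolding tail_def measure_def E by measurable
  then show ?thesis by simp
qed

text \<open>Exchanging the integrals, a jump size \<open>y\<close> contributes the probability \<open>1 - exp (- l y)\<close> that an
  exponential time falls below \<open>y\<close>.\<close>

lemma nn_integral_tail_expo:
  assumes L: "Levy_measure \<phi>" and l: "0 < l"
  shows "(\<integral>\<^sup>+z. ennreal (tail \<phi> z) \<partial>expo l) = ennreal (Laplace_exponent \<phi> l)"
proof -
  have S [measurable_cong]: "sets \<phi> = sets borel" using L by (simp add: Levy_measure_def)
  interpret sigma_finite_measure \<phi> by (rule Levy_sigma_finite[OF L])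
  interpret pair_sigma_finite lborel \<phi> ..
  have E: "emeasure \<phi> {z<..} = (\<integral>\<^sup>+y. (if z < y then 1 else 0) \<partial>\<phi>)" for z
    by (rule emeasure_greaterThan_eq_nn_integral[OF S])
  note tm = tail_measurable[OF L]
  have "(\<integral>\<^sup>+z. ennreal (tail \<phi> z) \<partial>expo l) =
      (\<integral>\<^sup>+z. ennreal (exponential_density l z) * ennreal (tail \<phi> z) \<partial>lborel)"
    unfolding expo_def by (subst nn_integral_density) (use tm in auto)
  also have "\<dots> = (\<integral>\<^sup>+z. \<integral>\<^sup>+y. ennreal (exponential_density l z) * (if z < y then 1 else 0) \<partial>\<phi> \<partial>lborel)"
  proof (rule nn_integral_cong_AE)
    have "AE z in lborel. z \<noteq> (0::real)" by (rule AE_lborel_singleton)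
    then show "AE z in lborel. ennreal (exponential_density l z) * ennreal (tail \<phi> z) =
        (\<integral>\<^sup>+y. ennreal (exponential_density l z) * (if z < y then 1 else 0) \<partial>\<phi>)"
    proof eventually_elim
      case (elim z)
      show ?case
      proof (cases "0 < z")
        case True
        have "ennreal (tail \<phi> z) = (\<integral>\<^sup>+y. (if z < y then 1 else 0) \<partial>\<phi>)"
          unfolding E[symmetric] tail_def using Levy_tail_finite[OF L True]
          by (subst emeasure_eq_ennreal_measure) auto
        then show ?thesis by (subst nn_integral_cmult) auto
      qed (use elim in \<open>auto simp: exponential_density_def\<close>)
    qed
  qed
  also have "\<dots> = (\<integral>\<^sup>+y. \<integral>\<^sup>+z. ennreal (exponential_density l z) * (if z < y then 1 else 0) \<partial>lborel \<partial>\<phi>)"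
    by (rule Fubini'[symmetric]) measurable
  also have "\<dots> = (\<integral>\<^sup>+y. ennreal (1 - exp (- l * y)) \<partial>\<phi>)"
  proof (rule nn_integral_cong_AE)
    show "AE y in \<phi>. (\<integral>\<^sup>+z. ennreal (exponential_density l z) * (if z < y then 1 else 0) \<partial>lborel) = ennreal (1 - exp (- l * y))"
      using Levy_AE_pos[OF L]
    proof eventually_elim
      case (elim y)
      have "(\<integral>\<^sup>+z. ennreal (exponential_density l z) * (if z < y then 1 else 0) \<partial>lborel) =
          (\<integral>\<^sup>+z. ennreal (l * exp (- l * z)) * indicator {0..y} z \<partial>lborel)"
      proof (rule nn_integral_cong_AE)
        have "AE z in lborel. z \<noteq> y" by (rule AE_lborel_singleton)
        then show "AE z in lborel. ennreal (exponential_density l z) * (if z < y then 1 else 0) =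
            ennreal (l * exp (- l * z)) * indicator {0..y} z"
          by eventually_elim (auto simp: exponential_density_def indicator_def mult.commute)
      qed
      also have "\<dots> = ennreal (- exp (- l * y) - - exp (- l * 0))"
        by (rule nn_integral_FTC_Icc) (use l elim in \<open>auto intro!: derivative_eq_intros\<close>)
      finally show ?case by simp
    qed
  qed
  also have "\<dots> = ennreal (Laplace_exponent \<phi> l)"
    unfolding Laplace_exponent_def
  proof (rule nn_integral_eq_integral[OF Levy_integrable_exponent[OF L l]])
    show "AE y in \<phi>. 0 \<le> 1 - exp (- l * y)"
      using Levy_AE_pos[OF L] by eventually_elim (use l in simp)
  qed
  finally show ?thesis .
qed

lemma tail_expo:
  assumes L: "Levy_measure \<phi>" and l: "0 < l"
  shows "integrable (expo l) (tail \<phi>)" "(\<integral>z. tail \<phi> z \<partial>expo l) = Laplace_exponent \<phi> l"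
proof -
  have m: "tail \<phi> \<in> borel_measurable (expo l)" using tail_measurable[OF L] by simp
  have nn: "0 \<le> tail \<phi> z" for z by (simp add: tail_def)
  show i: "integrable (expo l) (tail \<phi>)"
    using nn_integral_tail_expo[OF assms] m by (intro integrableI_bounded) (simp_all add: nn)
  have "0 \<le> Laplace_exponent \<phi> l"
    unfolding Laplace_exponent_def
    using Levy_AE_pos[OF L] l by (intro integral_nonneg_AE) (auto elim: eventually_mono)
  moreover have "ennreal (\<integral>z. tail \<phi> z \<partial>expo l) = ennreal (Laplace_exponent \<phi> l)"
    using nn_integral_tail_expo[OF assms] nn_integral_eq_integral[OF i] nn by simp
  ultimately show "(\<integral>z. tail \<phi> z \<partial>expo l) = Laplace_exponent \<phi> l"
    by (subst (asm) ennreal_inj) (auto intro!: Bochner_Integration.integral_nonneg nn)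
qed

text \<open>The convolution theorem; the factor \<open>1 / l\<close> comes from normalizing \<open>expo l\<close> to total mass one.\<close>

lemma convolution_expo:
  fixes f g :: "real \<Rightarrow> real"
  assumes l: "0 < l" and f: "integrable (expo l) f" and g: "integrable (expo l) g"
  defines "N \<equiv> \<lambda>t. LBINT s=0..t. f s * g (t - s)"
  shows "integrable (expo l) N" "(\<integral>t. N t \<partial>expo l) = (\<integral>t. f t \<partial>expo l) * (\<integral>t. g t \<partial>expo l) / l"
proof -
  have [measurable]: "f \<in> borel_measurable borel" "g \<in> borel_measurable borel"
    using f g by (auto dest: borel_measurable_integrable)
  define \<alpha> where "\<alpha> h s = indicator {0<..} s * exp (- l * s) * h s" for h :: "real \<Rightarrow> real" and s
  have [measurable]: "\<alpha> f \<in> borel_measurable borel" "\<alpha> g \<in> borel_measurable borel"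
    unfolding \<alpha>_def[abs_def] by measurable
  have \<alpha>_expo: "AE s in lborel. exponential_density l s * h s = l * \<alpha> h s" for h
  proof -
    have "AE z in lborel. z \<noteq> (0::real)" by (rule AE_lborel_singleton)
    then show ?thesis
      by eventually_elim (auto simp: \<alpha>_def exponential_density_def mult.commute)
  qed
  have int: "integrable lborel (\<alpha> h)" "(\<integral>s. h s \<partial>expo l) = l * (\<integral>s. \<alpha> h s \<partial>lborel)"
    if h: "integrable (expo l) h" and [measurable]: "\<alpha> h \<in> borel_measurable borel" for h
  proof -
    have [measurable]: "h \<in> borel_measurable borel" using h by (auto dest: borel_measurable_integrable)
    have "integrable lborel (\<lambda>s. exponential_density l s * h s)"
      using h unfolding expo_def by (subst (asm) integrable_density) (use l exponential_density_nonneg in auto)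
    then have "integrable lborel (\<lambda>s. l * \<alpha> h s)"
      by (rule integrable_cong_AE_imp) (use \<alpha>_expo[of h] in auto)
    then show "integrable lborel (\<alpha> h)" using l by simp
    have "(\<integral>s. h s \<partial>expo l) = (\<integral>s. exponential_density l s * h s \<partial>lborel)"
      by (rule integral_expo) (use l in auto)
    also have "\<dots> = (\<integral>s. l * \<alpha> h s \<partial>lborel)"
      by (rule integral_cong_AE) (use \<alpha>_expo[of h] in auto)
    finally show "(\<integral>s. h s \<partial>expo l) = l * (\<integral>s. \<alpha> h s \<partial>lborel)" by simp
  qed
  note intf = int[OF f \<open>\<alpha> f \<in> _\<close>] and intg = int[OF g \<open>\<alpha> g \<in> _\<close>]
  have shift: "integrable lborel (\<lambda>t. \<alpha> g (t - s))" "(\<integral>t. \<alpha> g (t - s) \<partial>lborel) = (\<integral>t. \<alpha> g t \<partial>lborel)"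
    "(\<integral>t. \<bar>\<alpha> g (t - s)\<bar> \<partial>lborel) = (\<integral>t. \<bar>\<alpha> g t\<bar> \<partial>lborel)" for s
    using lborel_integrable_real_affine[OF intg(1), of 1 "- s"]
      lborel_integral_real_affine[of 1 "\<alpha> g" "- s"] lborel_integral_real_affine[of 1 "\<lambda>t. \<bar>\<alpha> g t\<bar>" "- s"]
    by simp_all
  have prod: "integrable (lborel \<Otimes>\<^sub>M lborel) (\<lambda>(s, t). \<alpha> f s * \<alpha> g (t - s))"
  proof (rule lborel_pair.Fubini_integrable)
    show "integrable lborel (\<lambda>s. \<integral>t. norm (case (s, t) of (s, t) \<Rightarrow> \<alpha> f s * \<alpha> g (t - s)) \<partial>lborel)"
      using intf(1) by (simp add: abs_mult shift)
    show "AE s in lborel. integrable lborel (\<lambda>t. case (s, t) of (s, t) \<Rightarrow> \<alpha> f s * \<alpha> g (t - s))"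
      using shift(1) by simp
  qed measurable
  have N: "exponential_density l t * N t = l * (\<integral>s. \<alpha> f s * \<alpha> g (t - s) \<partial>lborel)" for t
  proof (cases "0 < t")
    case True
    have "N t = (\<integral>s. indicator {0<..<t} s * (f s * g (t - s)) \<partial>lborel)"
      using True by (simp add: N_def interval_lebesgue_integral_def set_lebesgue_integral_def zero_ereal_def)
    then have "exponential_density l t * N t = l * (\<integral>s. exp (- l * t) * (indicator {0<..<t} s * (f s * g (t - s))) \<partial>lborel)"
      using True by (simp add: exponential_density_def mult.commute)
    also have "(\<integral>s. exp (- l * t) * (indicator {0<..<t} s * (f s * g (t - s))) \<partial>lborel)
        = (\<integral>s. \<alpha> f s * \<alpha> g (t - s) \<partial>lborel)"
    proof (rule Bochner_Integration.integral_cong)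
      fix s
      have "exp (- l * t) = exp (- l * s) * exp (- l * (t - s))"
        by (simp add: exp_add[symmetric] algebra_simps)
      then show "exp (- l * t) * (indicator {0<..<t} s * (f s * g (t - s))) = \<alpha> f s * \<alpha> g (t - s)"
        by (auto simp: \<alpha>_def indicator_def)
    qed simp
    finally show ?thesis .
  next
    case False
    then have "(\<lambda>s. \<alpha> f s * \<alpha> g (t - s)) = (\<lambda>s. 0)"
      by (auto simp: \<alpha>_def indicator_def fun_eq_iff)
    then have "(\<integral>s. \<alpha> f s * \<alpha> g (t - s) \<partial>lborel) = 0" by simp
    moreover have "exponential_density l t * N t = 0"
      using False by (cases "t = 0") (auto simp: exponential_density_def N_def zero_ereal_def)
    ultimately show ?thesis by simp
  qed
  have intN: "integrable lborel (\<lambda>t. exponential_density l t * N t)"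
    unfolding N using lborel_pair.integrable_snd[OF prod] by simp
  have "(\<integral>t. exponential_density l t * N t \<partial>lborel) = l * (\<integral>t. \<integral>s. \<alpha> f s * \<alpha> g (t - s) \<partial>lborel \<partial>lborel)"
    unfolding N by simp
  also have "\<dots> = l * (\<integral>s. \<integral>t. \<alpha> f s * \<alpha> g (t - s) \<partial>lborel \<partial>lborel)"
    using lborel_pair.Fubini_integral[OF prod] by simp
  also have "\<dots> = l * (\<integral>s. \<alpha> f s \<partial>lborel) * (\<integral>s. \<alpha> g s \<partial>lborel)"
    by (simp add: shift)
  finally have I: "(\<integral>t. exponential_density l t * N t \<partial>lborel) = (\<integral>t. f t \<partial>expo l) * (\<integral>t. g t \<partial>expo l) / l"
    using l by (simp add: intf intg)
  have [measurable]: "N \<in> borel_measurable borel"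
  proof -
    have "(\<lambda>t. \<integral>s. indicator {s. 0 < s \<and> s < t} s * (f s * g (t - s)) \<partial>lborel) \<in> borel_measurable borel"
      by measurable
    then have "(\<lambda>t. if 0 \<le> t then \<integral>s. indicator {s. 0 < s \<and> s < t} s * (f s * g (t - s)) \<partial>lborel
       else - (\<integral>s. indicator {s. t < s \<and> s < 0} s * (f s * g (t - s)) \<partial>lborel)) \<in> borel_measurable borel"
      by measurable
    also have "(\<lambda>t. if 0 \<le> t then \<integral>s. indicator {s. 0 < s \<and> s < t} s * (f s * g (t - s)) \<partial>lborel
       else - (\<integral>s. indicator {s. t < s \<and> s < 0} s * (f s * g (t - s)) \<partial>lborel)) = N"
      by (auto simp: fun_eq_iff N_def interval_lebesgue_integral_def set_lebesgue_integral_def zero_ereal_def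
          einterval_def indicator_def intro!: Bochner_Integration.integral_cong)
    finally show ?thesis .
  qed
  show "integrable (expo l) N"
    unfolding expo_def using intN by (subst integrable_density) (use l exponential_density_nonneg in auto)
  show "(\<integral>t. N t \<partial>expo l) = (\<integral>t. f t \<partial>expo l) * (\<integral>t. g t \<partial>expo l) / l"
    using I by (subst integral_expo) (use l in auto)
qed

text \<open>Integration by parts. The derivative may be singular at \<open>0\<close> and is only required to be integrable;
  the boundary value is picked up from the continuity of \<open>\<rho>\<close>.\<close>

lemma expo_derivative:
  fixes \<rho> \<rho>' :: "real \<Rightarrow> real"
  assumes l: "0 < l" and c: "continuous_on {0..} \<rho>" and B: "\<And>t. 0 \<le> t \<Longrightarrow> \<bar>\<rho> t\<bar> \<le> B"
    and m: "\<rho> \<in> borel_measurable borel"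
    and d: "\<And>t. 0 < t \<Longrightarrow> (\<rho> has_real_derivative \<rho>' t) (at t)" and c': "continuous_on {0<..} \<rho>'"
    and i: "integrable (expo l) \<rho>'"
  shows "(\<integral>t. \<rho>' t \<partial>expo l) = l * ((\<integral>t. \<rho> t \<partial>expo l) - \<rho> 0)"
proof -
  have [measurable]: "\<rho>' \<in> borel_measurable borel" using i by (auto dest: borel_measurable_integrable)
  note [measurable] = m
  have i\<rho>: "integrable (expo l) \<rho>" by (rule integrable_expo_bounded[OF l m B]) simp
  define D where "D t = exp (- l * t) * (\<rho>' t - l * \<rho> t)" for t
  have "l * (indicator {0<..} t * D t) = exponential_density l t * (\<rho>' t - l * \<rho> t)" if "t \<noteq> 0" for t
    using that by (auto simp: D_def indicator_def exponential_density_def mult.commute)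
  moreover have "AE z in lborel. z \<noteq> (0::real)" by (rule AE_lborel_singleton)
  ultimately have ind: "AE t in lborel. exponential_density l t * (\<rho>' t - l * \<rho> t) = l * (indicator {0<..} t * D t)"
    by (auto elim: eventually_mono)
  have [measurable]: "D \<in> borel_measurable borel" unfolding D_def[abs_def] by measurable
  have int1: "integrable lborel (\<lambda>t. exponential_density l t * (\<rho>' t - l * \<rho> t))"
    using Bochner_Integration.integrable_diff[OF i integrable_mult_right[OF i\<rho>, of l]] unfolding expo_def
    by (subst (asm) integrable_density) (use l exponential_density_nonneg in auto)
  have "integrable lborel (\<lambda>t. l * (indicator {0<..} t * D t))"
    by (rule integrable_cong_AE_imp[OF int1 _ ind]) measurable
  then have int2: "integrable lborel (\<lambda>t. indicator {0<..} t * D t)" using l by simp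
  have "(\<integral>t. \<rho>' t \<partial>expo l) - l * (\<integral>t. \<rho> t \<partial>expo l) = (\<integral>t. \<rho>' t - l * \<rho> t \<partial>expo l)"
    using i i\<rho> by simp
  also have "\<dots> = (\<integral>t. exponential_density l t * (\<rho>' t - l * \<rho> t) \<partial>lborel)"
    by (rule integral_expo) (use l in auto)
  also have "\<dots> = (\<integral>t. l * (indicator {0<..} t * D t) \<partial>lborel)"
    by (rule integral_cong_AE[OF _ _ ind]) measurable
  also have "\<dots> = l * (LBINT t=0..\<infinity>. D t)"
    by (simp add: interval_lebesgue_integral_def set_lebesgue_integral_def zero_ereal_def)
  also have "(LBINT t=0..\<infinity>. D t) = 0 - \<rho> 0"
  proof (rule interval_integral_FTC_integrable[where F="\<lambda>t. exp (- l * t) * \<rho> t"])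
    show "((\<lambda>t. exp (- l * t) * \<rho> t) has_vector_derivative D x) (at x)" if "0 < ereal x" "ereal x < \<infinity>" for x
      unfolding has_real_derivative_iff_has_vector_derivative[symmetric] D_def
      using that by (auto intro!: derivative_eq_intros d simp: algebra_simps)
    show "isCont D x" if "0 < ereal x" "ereal x < \<infinity>" for x
    proof -
      have "continuous_on {0<..} D"
        unfolding D_def by (intro continuous_intros c' continuous_on_subset[OF c]) auto
      then show ?thesis using that by (simp add: continuous_on_eq_continuous_at)
    qed
    show "set_integrable lborel (einterval 0 \<infinity>) D"
      using int2 by (simp add: set_integrable_def zero_ereal_def)
    have "((\<lambda>t. exp (- l * t) * \<rho> t) \<longlongrightarrow> exp (- l * 0) * \<rho> 0) (at_right 0)"
    proof (intro tendsto_intros)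
      have "(\<rho> \<longlongrightarrow> \<rho> 0) (at 0 within {0..})" using c by (auto simp: continuous_on_def)
      then show "(\<rho> \<longlongrightarrow> \<rho> 0) (at_right 0)" by (rule tendsto_within_subset) auto
    qed
    then show "(((\<lambda>t. exp (- l * t) * \<rho> t) \<circ> real_of_ereal) \<longlongrightarrow> \<rho> 0) (at_right 0)"
      by (simp add: ereal_tendsto_simps zero_ereal_def)
    have "((\<lambda>t. exp (- l * t) * \<rho> t) \<longlongrightarrow> 0) at_top"
    proof (rule Lim_null_comparison)
      show "\<forall>\<^sub>F t in at_top. norm (exp (- l * t) * \<rho> t) \<le> exp (- l * t) * B"
        using eventually_ge_at_top[of 0] by eventually_elim (auto simp: abs_mult B)
      have "filterlim (\<lambda>t. - l * t) at_bot at_top"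
        using l filterlim_tendsto_pos_mult_at_top[OF tendsto_const l filterlim_ident]
        by (simp add: filterlim_uminus_at_bot)
      from filterlim_compose[OF exp_at_bot this] have "((\<lambda>t. exp (- l * t)) \<longlongrightarrow> 0) at_top" .
      from tendsto_mult_left_zero[OF this] show "((\<lambda>t. exp (- l * t) * B) \<longlongrightarrow> 0) at_top" .
    qed
    then show "(((\<lambda>t. exp (- l * t) * \<rho> t) \<circ> real_of_ereal) \<longlongrightarrow> 0) (at_left \<infinity>)"
      by (simp add: ereal_tendsto_simps)
  qed simp
  finally show ?thesis by (simp add: algebra_simps)
qed

lemma clamped_borel_measurable:
  fixes f :: "real \<Rightarrow> real"
  assumes "continuous_on {0..} f"
  shows "(\<lambda>t. f (max 0 t)) \<in> borel_measurable borel"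
  by (intro borel_measurable_continuous_onI continuous_on_compose2[OF assms] continuous_intros) auto

text \<open>Here and below, time is clamped by \<open>max 0\<close>: the processes are unspecified at negative times, whereas
  joint measurability is wanted on the whole line.\<close>

lemma subordinator_jointly_measurable:
  assumes H: "subordinator Q H"
  shows "(\<lambda>(t, \<omega>). H (max 0 t) \<omega>) \<in> borel_measurable (borel \<Otimes>\<^sub>M Q)"
proof (rule right_continuous_jointly_measurable)
  show "H (max 0 s) \<in> borel_measurable Q" for s using H by (simp add: subordinator_def)
  show "continuous (at_right s) (\<lambda>s. H (max 0 s) \<omega>)" if "\<omega> \<in> space Q" for s \<omega>
  proof (cases "0 \<le> s")
    case True
    then have "continuous (at_right s) (\<lambda>s. H s \<omega>)" using H that by (simp add: subordinator_def)
    then have "((\<lambda>s. H s \<omega>) \<longlongrightarrow> H s \<omega>) (at_right s)" by (simp add: continuous_within)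
    then have "((\<lambda>s. H (max 0 s) \<omega>) \<longlongrightarrow> H s \<omega>) (at_right s)"
      by (rule Lim_transform_eventually)
         (use True in \<open>auto simp: eventually_at_filter max_def\<close>)
    then show ?thesis using True by (simp add: continuous_within max_def)
  next
    case False
    have "((\<lambda>_. H 0 \<omega>) \<longlongrightarrow> H 0 \<omega>) (at_right s)" by simp
    then have "((\<lambda>s. H (max 0 s) \<omega>) \<longlongrightarrow> H 0 \<omega>) (at_right s)"
    proof (rule Lim_transform_eventually)
      have "\<forall>\<^sub>F x in at_right s. x < 0" using False by (intro eventually_at_rightI[of _ 0]) auto
      then show "\<forall>\<^sub>F x in at_right s. H 0 \<omega> = H (max 0 x) \<omega>" by eventually_elim (simp add: max_def)
    qed
    then show ?thesis using False by (simp add: continuous_within max_def)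
  qed
qed

text \<open>The potential measure is the image of \<open>dt \<otimes> Q\<close> under \<open>(t, \<omega>) \<mapsto> H t \<omega>\<close>, so its Laplace transform
  is \<open>\<integral> exp (- t \<Phi>) dt\<close>. In particular the set function defining it is a measure.\<close>

lemma potential_measure_Laplace:
  assumes H: "subordinator_with \<phi> Q H" and l: "0 < l" and \<Phi>: "0 < Laplace_exponent \<phi> l"
  shows "(\<integral>\<^sup>+y. ennreal (exp (- l * y)) \<partial>potential_measure Q H) = ennreal (1 / Laplace_exponent \<phi> l)"
proof -
  have sub: "subordinator Q H" using H by (simp add: subordinator_with_def)
  interpret Q: prob_space Q using sub by (simp add: subordinator_def)
  note [measurable] = subordinator_jointly_measurable[OF sub]
  define T where "T = density lborel (indicator {0::real..})"
  have [measurable_cong, simp]: "sets T = sets borel" by (simp add: T_def)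
  interpret T: sigma_finite_measure T
    unfolding T_def by (rule sigma_finite_measure.sigma_finite_iff_density_finite[THEN iffD2])
      (auto simp: indicator_def sigma_finite_lborel)
  interpret pair_sigma_finite T Q ..
  define \<kappa> where "\<kappa> = distr (T \<Otimes>\<^sub>M Q) borel (\<lambda>(t, \<omega>). H (max 0 t) \<omega>)"
  have em: "emeasure \<kappa> A = (\<integral>\<^sup>+t. indicator {0..} t * emeasure Q {\<omega> \<in> space Q. H t \<omega> \<in> A} \<partial>lborel)"
    if [measurable]: "A \<in> sets borel" for A
  proof -
    have Hm: "(\<lambda>(t, \<omega>). H (max 0 t) \<omega>) \<in> borel_measurable (T \<Otimes>\<^sub>M Q)" by measurable
    have "emeasure \<kappa> A = emeasure (T \<Otimes>\<^sub>M Q) ((\<lambda>(t, \<omega>). H (max 0 t) \<omega>) -` A \<inter> space (T \<Otimes>\<^sub>M Q))"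
      unfolding \<kappa>_def by (rule emeasure_distr[OF Hm]) fact
    also have "\<dots> = (\<integral>\<^sup>+t. emeasure Q (Pair t -` ((\<lambda>(t, \<omega>). H (max 0 t) \<omega>) -` A \<inter> space (T \<Otimes>\<^sub>M Q))) \<partial>T)"
      by (rule Q.emeasure_pair_measure_alt) (use Hm in measurable)
    also have "\<dots> = (\<integral>\<^sup>+t. emeasure Q {\<omega> \<in> space Q. H (max 0 t) \<omega> \<in> A} \<partial>T)"
      by (intro nn_integral_cong arg_cong[where f="emeasure Q"]) (auto simp: space_pair_measure T_def)
    also have "\<dots> = (\<integral>\<^sup>+t. indicator {0..} t * emeasure Q {\<omega> \<in> space Q. H (max 0 t) \<omega> \<in> A} \<partial>lborel)"
    proof -
      have "(\<lambda>t. emeasure Q {\<omega> \<in> space Q. H (max 0 t) \<omega> \<in> A}) \<in> borel_measurable borel"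
        by measurable
      then show ?thesis unfolding T_def by (subst nn_integral_density) auto
    qed
    finally show ?thesis
      by (simp add: indicator_def max_def cong: nn_integral_cong if_cong)
        (intro nn_integral_cong, auto)
  qed
  have "potential_measure Q H = measure_of (space \<kappa>) (sets \<kappa>) (emeasure \<kappa>)"
    unfolding potential_measure_def
    by (simp add: \<kappa>_def) (rule measure_of_eq, use em[unfolded \<kappa>_def] in \<open>auto simp: sets.sigma_sets_eq[of borel, simplified]\<close>)
  then have pot: "potential_measure Q H = \<kappa>" by (simp add: measure_of_of_measure)
  have "(\<integral>\<^sup>+y. ennreal (exp (- l * y)) \<partial>\<kappa>) = (\<integral>\<^sup>+z. ennreal (exp (- l * (case z of (t, \<omega>) \<Rightarrow> H (max 0 t) \<omega>))) \<partial>(T \<Otimes>\<^sub>M Q))"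
    unfolding \<kappa>_def by (subst nn_integral_distr) auto
  also have "\<dots> = (\<integral>\<^sup>+t. \<integral>\<^sup>+\<omega>. ennreal (exp (- l * H (max 0 t) \<omega>)) \<partial>Q \<partial>T)"
    by (subst Q.nn_integral_fst[symmetric]) (auto intro!: nn_integral_cong)
  also have "\<dots> = (\<integral>\<^sup>+t. ennreal (exp (- max 0 t * Laplace_exponent \<phi> l)) \<partial>T)"
  proof (intro nn_integral_cong)
    fix t :: real
    have "integrable Q (\<lambda>\<omega>. exp (- l * H (max 0 t) \<omega>))"
    proof (rule ccontr)
      assume "\<not> integrable Q (\<lambda>\<omega>. exp (- l * H (max 0 t) \<omega>))"
      then have "(\<integral>\<omega>. exp (- l * H (max 0 t) \<omega>) \<partial>Q) = 0" by (rule not_integrable_integral_eq)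
      with H l show False by (simp add: subordinator_with_def)
    qed
    then show "(\<integral>\<^sup>+\<omega>. ennreal (exp (- l * H (max 0 t) \<omega>)) \<partial>Q) = ennreal (exp (- max 0 t * Laplace_exponent \<phi> l))"
      using H l by (subst nn_integral_eq_integral) (auto simp: subordinator_with_def)
  qed
  also have "\<dots> = (\<integral>\<^sup>+t. ennreal (exp (- t * Laplace_exponent \<phi> l)) * indicator {0..} t \<partial>lborel)"
    unfolding T_def by (subst nn_integral_density) (auto intro!: nn_integral_cong simp: indicator_def)
  also have "\<dots> = ennreal (0 - - exp (- 0 * Laplace_exponent \<phi> l) / Laplace_exponent \<phi> l)"
  proof -
    let ?\<Phi> = "Laplace_exponent \<phi> l"
    have "(\<integral>\<^sup>+t. ennreal (exp (- t * ?\<Phi>)) * indicator {0..} t \<partial>lborel) = ennreal (0 - (- exp (- 0 * ?\<Phi>) / ?\<Phi>))"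
    proof (rule nn_integral_FTC_atLeast)
      show "((\<lambda>t. - exp (- t * ?\<Phi>) / ?\<Phi>) has_real_derivative exp (- x * ?\<Phi>)) (at x)" for x
        using \<Phi> by (auto intro!: derivative_eq_intros)
      have "filterlim (\<lambda>t. - t * ?\<Phi>) at_bot at_top"
        using filterlim_tendsto_pos_mult_at_top[OF tendsto_const \<Phi> filterlim_ident]
        by (simp add: filterlim_uminus_at_bot mult.commute)
      from filterlim_compose[OF exp_at_bot this] have "((\<lambda>t. exp (- t * ?\<Phi>)) \<longlongrightarrow> 0) at_top" .
      from tendsto_divide[OF tendsto_minus[OF this] tendsto_const] \<Phi>
      show "((\<lambda>t. - exp (- t * ?\<Phi>) / ?\<Phi>) \<longlongrightarrow> 0) at_top" by auto
    qed auto
    then show ?thesis by simp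
  qed
  finally show ?thesis by (simp add: pot)
qed

section \<open>The Markov property at fixed times\<close>

lemma space_natural_filtration [simp]: "space (natural_filtration M Z t) = space M"
  unfolding natural_filtration_def by (intro space_measure_of) auto

lemma sets_natural_filtration:
  "sets (natural_filtration M Z t) =
    sigma_sets (space M) {Z s -` B \<inter> space M | s B. 0 \<le> s \<and> ennreal s \<le> t \<and> B \<in> sets borel}"
  unfolding natural_filtration_def by (intro sets_measure_of) auto

lemma natural_filtration_mono:
  "s \<le> t \<Longrightarrow> sets (natural_filtration M Z s) \<subseteq> sets (natural_filtration M Z t)"
  unfolding sets_natural_filtration by (intro sigma_sets_mono') (auto intro: order_trans)

lemma natural_filtration_subset:
  assumes "\<And>t. 0 \<le> t \<Longrightarrow> Z t \<in> M \<rightarrow>\<^sub>M borel"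
  shows "sets (natural_filtration M Z t) \<subseteq> sets M"
  unfolding sets_natural_filtration
  by (intro sets.sigma_sets_subset) (use assms in \<open>auto intro: measurable_sets\<close>)

lemma natural_filtration_adapted:
  assumes "0 \<le> s" "ennreal s \<le> t"
  shows "Z s \<in> natural_filtration M Z t \<rightarrow>\<^sub>M borel"
proof (rule measurableI)
  show "Z s -` B \<inter> space (natural_filtration M Z t) \<in> sets (natural_filtration M Z t)" if "B \<in> sets borel" for B
    unfolding sets_natural_filtration using assms that by (intro sigma_sets.Basic) auto
qed auto

lemma filtration_natural_filtration: "filtration (space M) (natural_filtration M Z)"
  by standard (simp_all add: natural_filtration_mono)

lemma natural_filtration_cong_space:
  "space M = space N \<Longrightarrow> natural_filtration M Z = natural_filtration N Z"
  by (simp add: natural_filtration_def fun_eq_iff)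

lemma continuous_imp_jointly_measurable:
  fixes f :: "real \<Rightarrow> 'a \<Rightarrow> real"
  assumes m: "\<And>s. f s \<in> borel_measurable N"
    and c: "\<And>\<omega>. \<omega> \<in> space N \<Longrightarrow> continuous_on UNIV (\<lambda>s. f s \<omega>)"
  shows "(\<lambda>(s, \<omega>). f s \<omega>) \<in> borel_measurable (borel \<Otimes>\<^sub>M N)"
  by (rule right_continuous_jointly_measurable[OF m])
     (use c in \<open>auto simp: continuous_on_eq_continuous_at intro: continuous_within_subset\<close>)

locale star_BM =
  fixes p :: "'n::finite \<Rightarrow> real"
    and M :: "'w measure"
    and P :: "'n star \<Rightarrow> 'w measure"
    and Z :: "real \<Rightarrow> 'w \<Rightarrow> 'n star"
  assumes BM: "star_Brownian_motion p M P Z"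
begin

lemma prob_P: "prob_space (P x)"
  and sets_P [simp, measurable_cong]: "sets (P x) = sets M"
  using BM by (auto simp: star_Brownian_motion_def continuous_strong_Markov_def)

lemma space_P [simp]: "space (P x) = space M"
  by (rule sets_eq_imp_space_eq) simp

lemma measurable_P [simp]: "measurable (P x) N = measurable M N"
  by (rule measurable_cong_sets) simp_all

lemma Z_measurable: "0 \<le> t \<Longrightarrow> Z t \<in> M \<rightarrow>\<^sub>M borel"
  using BM by (auto simp: star_Brownian_motion_def continuous_strong_Markov_def)

lemma Z_continuous: "\<omega> \<in> space M \<Longrightarrow> continuous_on {0..} (\<lambda>t. Z t \<omega>)"
  using BM by (auto simp: star_Brownian_motion_def continuous_strong_Markov_def)

lemma Z_0: "AE \<omega> in P x. Z 0 \<omega> = x"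
  using BM by (auto simp: star_Brownian_motion_def continuous_strong_Markov_def)

text \<open>The process continued to negative times by its initial value, so that its paths are continuous on the
  whole line.\<close>

definition Zc :: "real \<Rightarrow> 'w \<Rightarrow> 'n star" where
  "Zc t = Z (max 0 t)"

lemma Zc_eq: "0 \<le> t \<Longrightarrow> Zc t = Z t"
  by (simp add: Zc_def max_def)

lemma Zc_measurable [measurable]: "Zc t \<in> M \<rightarrow>\<^sub>M borel"
  by (simp add: Zc_def Z_measurable)

lemma Zc_continuous: "\<omega> \<in> space M \<Longrightarrow> continuous_on UNIV (\<lambda>t. Zc t \<omega>)"
  unfolding Zc_def by (rule continuous_on_compose2[OF Z_continuous]) (auto intro!: continuous_intros)

lemma Zc_compose_continuous:
  "\<omega> \<in> space M \<Longrightarrow> continuous_on UNIV f \<Longrightarrow> continuous_on UNIV (\<lambda>t. f (Zc t \<omega>))"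
  by (rule continuous_on_compose2[OF _ Zc_continuous]) auto

lemma Zc_compose_measurable:
  "continuous_on UNIV f \<Longrightarrow> (\<lambda>\<omega>. f (Zc t \<omega>)) \<in> borel_measurable M"
  by (rule measurable_compose[OF Zc_measurable borel_measurable_continuous_onI])

definition T :: "real \<Rightarrow> ('n star \<Rightarrow> real) \<Rightarrow> 'n star \<Rightarrow> real" where
  "T = transition_op P Z"

text \<open>The strong Markov property at the constant stopping time \<open>s\<close>, freed from conditional expectations:
  \<open>X\<close> may be any bounded variable observable at time \<open>s\<close>.\<close>

lemma Markov_property:
  assumes s: "0 \<le> s" and h: "0 \<le> h"
    and X: "X \<in> borel_measurable (natural_filtration M Z (ennreal s))"
      "\<And>\<omega>. \<omega> \<in> space M \<Longrightarrow> \<bar>X \<omega>\<bar> \<le> B"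
    and f: "f \<in> borel_measurable borel" "bounded (range f)"
  shows "(\<integral>\<omega>. X \<omega> * f (Z (s + h) \<omega>) \<partial>P x) = (\<integral>\<omega>. X \<omega> * T h f (Z s \<omega>) \<partial>P x)"
proof -
  interpret prob_space "P x" by (rule prob_P)
  interpret F: filtration "space M" "natural_filtration M Z" by (rule filtration_natural_filtration)
  define \<tau> where "\<tau> = (\<lambda>_::'w. ennreal s)"
  have st: "stopping_time (natural_filtration M Z) \<tau>"
    unfolding \<tau>_def by (rule stopping_time_const)
  let ?G = "F.pre_sigma \<tau>"
  have sets_G: "sets ?G \<subseteq> sets M"
  proof
    fix A assume "A \<in> sets ?G"
    from F.sets_pre_sigmaD[OF st this, of "ennreal s"] have "A \<in> sets (natural_filtration M Z (ennreal s))"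
      by (simp add: \<tau>_def)
    then show "A \<in> sets M" using natural_filtration_subset[of Z M] Z_measurable by blast
  qed
  have sub: "subalgebra (P x) ?G"
    unfolding subalgebra_def using sets_G by (simp add: F.space_pre_sigma)
  interpret finite_measure_subalgebra "P x" ?G by standard (rule sub)
  have XG: "X \<in> borel_measurable ?G"
  proof (rule measurableI)
    fix B :: "real set" assume "B \<in> sets borel"
    then have "X -` B \<inter> space M \<in> sets (natural_filtration M Z (ennreal s))"
      using measurable_sets[OF X(1)] by simp
    moreover have "{\<omega> \<in> X -` B \<inter> space M. \<tau> \<omega> \<le> t} = (if ennreal s \<le> t then X -` B \<inter> space M else {})" for t
      by (auto simp: \<tau>_def)
    ultimately have "{\<omega> \<in> X -` B \<inter> space M. \<tau> \<omega> \<le> t} \<in> sets (natural_filtration M Z t)" for t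
      using natural_filtration_mono[of "ennreal s" t M Z] by auto
    then show "X -` B \<inter> space ?G \<in> sets ?G"
      unfolding F.space_pre_sigma by (intro F.sets_pre_sigmaI[OF st])
  qed simp
  have XM: "X \<in> borel_measurable (P x)"
    using measurable_from_subalg[OF sub XG] .
  obtain C where C: "\<And>y. \<bar>f y\<bar> \<le> C" using f(2) by (auto simp: bounded_iff)
  have fm: "(\<lambda>\<omega>. f (Z (s + h) \<omega>)) \<in> borel_measurable (P x)"
    using measurable_compose[OF Z_measurable f(1), of "s + h"] s h by (simp)
  have int: "integrable (P x) (\<lambda>\<omega>. X \<omega> * f (Z (s + h) \<omega>))"
  proof (rule integrable_const_bound[where B="B * C"])
    show "AE \<omega> in P x. norm (X \<omega> * f (Z (s + h) \<omega>)) \<le> B * C"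
    proof (rule AE_I2)
      fix \<omega> assume "\<omega> \<in> space (P x)"
      then have "\<bar>X \<omega>\<bar> \<le> B" using X(2) by simp
      then show "norm (X \<omega> * f (Z (s + h) \<omega>)) \<le> B * C"
        unfolding real_norm_def abs_mult by (intro mult_mono) (use C in auto)
    qed
  qed (use XM fm in measurable)
  let ?ce = "real_cond_exp (P x) ?G (\<lambda>\<omega>. f (Z (s + h) \<omega>))"
  have "AE \<omega> in P x. real_cond_exp (P x) ?G
            (\<lambda>\<omega>. indicator {\<omega>. \<tau> \<omega> < \<infinity>} \<omega> * f (Z (enn2real (\<tau> \<omega>) + h) \<omega>)) \<omega>
          = indicator {\<omega>. \<tau> \<omega> < \<infinity>} \<omega> * transition_op P Z h f (Z (enn2real (\<tau> \<omega>)) \<omega>)"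
    using BM st h f unfolding star_Brownian_motion_def continuous_strong_Markov_def by blast
  then have ae: "AE \<omega> in P x. ?ce \<omega> = T h f (Z s \<omega>)"
    using s by (simp add: \<tau>_def T_def)
  have Tm: "(\<lambda>\<omega>. T h f (Z s \<omega>)) \<in> borel_measurable (P x)"
  proof -
    have "(\<lambda>y. distr (P y) borel (Z h)) \<in> borel \<rightarrow>\<^sub>M prob_algebra borel"
      using BM h by (auto simp: star_Brownian_motion_def continuous_strong_Markov_def)
    then have 1: "(\<lambda>y. distr (P y) borel (Z h)) \<in> borel \<rightarrow>\<^sub>M subprob_algebra borel"
      by (rule measurable_prob_algebraD)
    have "(\<lambda>y. \<integral>z. f z \<partial>distr (P y) borel (Z h)) \<in> borel_measurable borel"
      by (rule measurable_compose[OF 1 integral_measurable_subprob_algebra]) (rule f(1))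
    also have "(\<lambda>y. \<integral>z. f z \<partial>distr (P y) borel (Z h)) = T h f"
      unfolding T_def transition_op_def fun_eq_iff
      using Z_measurable[OF h] f(1) by (intro allI integral_distr) (simp_all)
    finally have "T h f \<in> borel_measurable borel" .
    from measurable_compose[OF Z_measurable[OF s] this] show ?thesis
      by (simp)
  qed
  have "(\<integral>\<omega>. X \<omega> * f (Z (s + h) \<omega>) \<partial>P x) = (\<integral>\<omega>. X \<omega> * ?ce \<omega> \<partial>P x)"
    using real_cond_exp_intg(2)[OF int XG fm] by simp
  also have "\<dots> = (\<integral>\<omega>. X \<omega> * T h f (Z s \<omega>) \<partial>P x)"
  proof (rule integral_cong_AE)
    show "AE \<omega> in P x. X \<omega> * ?ce \<omega> = X \<omega> * T h f (Z s \<omega>)" using ae by eventually_elim simp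
    show "(\<lambda>\<omega>. X \<omega> * ?ce \<omega>) \<in> borel_measurable (P x)"
      by (rule borel_measurable_times[OF XM borel_measurable_cond_exp2])
    show "(\<lambda>\<omega>. X \<omega> * T h f (Z s \<omega>)) \<in> borel_measurable (P x)"
      by (rule borel_measurable_times[OF XM Tm])
  qed
  finally show ?thesis .
qed

section \<open>Additive functionals\<close>

definition Af :: "('n star \<Rightarrow> real) \<Rightarrow> real \<Rightarrow> 'w \<Rightarrow> real" where
  "Af q t \<omega> = (\<integral>s. indicator {0..t} s * q (Zc s \<omega>) \<partial>lborel)"

text \<open>The integrand is stopped at \<open>t\<close>, so that joint measurability holds with respect to the
  \<open>\<sigma>\<close>-algebra of time \<open>t\<close> rather than that of the whole path.\<close>

lemma Af_adapted:
  assumes q: "continuous_on UNIV q"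
  shows "Af q t \<in> borel_measurable (natural_filtration M Z (ennreal t))"
proof (cases "0 \<le> t")
  case True
  let ?F = "natural_filtration M Z (ennreal t)"
  have "(\<lambda>(s, \<omega>). q (Zc (min t s) \<omega>)) \<in> borel_measurable (borel \<Otimes>\<^sub>M ?F)"
  proof (rule continuous_imp_jointly_measurable)
    show "(\<lambda>\<omega>. q (Zc (min t s) \<omega>)) \<in> borel_measurable ?F" for s
      unfolding Zc_def using True
      by (intro measurable_compose[OF natural_filtration_adapted borel_measurable_continuous_onI[OF q]])
         (auto intro!: ennreal_leI)
    show "continuous_on UNIV (\<lambda>s. q (Zc (min t s) \<omega>))" if "\<omega> \<in> space ?F" for \<omega>
      by (rule continuous_on_compose2[OF Zc_compose_continuous[OF _ q]])
         (use that in \<open>auto intro!: continuous_intros\<close>)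
  qed
  then have j: "(\<lambda>z. q (Zc (min t (fst z)) (snd z))) \<in> borel_measurable (borel \<Otimes>\<^sub>M ?F)"
    by (simp add: split_beta')
  have sw: "(\<lambda>z. (snd z, fst z)) \<in> ?F \<Otimes>\<^sub>M lborel \<rightarrow>\<^sub>M borel \<Otimes>\<^sub>M ?F"
    by measurable
  have [measurable]: "(\<lambda>z. q (Zc (min t (snd z)) (fst z))) \<in> borel_measurable (?F \<Otimes>\<^sub>M lborel)"
    using measurable_compose[OF sw j] by simp
  have "(\<lambda>\<omega>. \<integral>s. indicator {0..t} s * q (Zc (min t s) \<omega>) \<partial>lborel) \<in> borel_measurable ?F"
    by (rule lborel.borel_measurable_lebesgue_integral) (simp add: split_beta')
  also have "(\<lambda>\<omega>. \<integral>s. indicator {0..t} s * q (Zc (min t s) \<omega>) \<partial>lborel) = Af q t"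
    unfolding Af_def by (intro ext Bochner_Integration.integral_cong) (auto simp: indicator_def min_def)
  finally show ?thesis .
next
  case False
  then have "Af q t = (\<lambda>_. 0)" by (auto simp: Af_def fun_eq_iff)
  then show ?thesis by simp
qed

lemma Af_measurable:
  assumes q: "continuous_on UNIV q"
  shows "Af q t \<in> borel_measurable M"
proof (rule measurable_from_subalg[OF _ Af_adapted[OF q]])
  show "subalgebra M (natural_filtration M Z (ennreal t))"
    unfolding subalgebra_def using natural_filtration_subset[of Z M] Z_measurable by simp
qed

lemma Af_integral:
  assumes q: "continuous_on UNIV q" and \<omega>: "\<omega> \<in> space M"
  shows "Af q t \<omega> = integral {0..t} (\<lambda>s. q (Zc s \<omega>))"
proof -
  have "continuous_on {0..t} (\<lambda>s. q (Zc s \<omega>))"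
    using Zc_compose_continuous[OF \<omega> q] by (rule continuous_on_subset) simp
  then have "set_integrable lborel {0..t} (\<lambda>s. q (Zc s \<omega>))"
    by (rule borel_integrable_atLeastAtMost')
  from set_borel_integral_eq_integral(2)[OF this] show ?thesis
    by (simp add: Af_def set_lebesgue_integral_def)
qed

lemma Af_has_derivative:
  assumes q: "continuous_on UNIV q" and \<omega>: "\<omega> \<in> space M" and t: "0 < t"
  shows "((\<lambda>t. Af q t \<omega>) has_real_derivative q (Zc t \<omega>)) (at t)"
proof -
  have c: "continuous_on {0..t + 1} (\<lambda>s. q (Zc s \<omega>))"
    using Zc_compose_continuous[OF \<omega> q] by (rule continuous_on_subset) simp
  have "((\<lambda>t. integral {0..t} (\<lambda>s. q (Zc s \<omega>))) has_real_derivative q (Zc t \<omega>)) (at t within {0..t+1})"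
    by (rule integral_has_real_derivative[OF c]) (use t in auto)
  moreover have "at t within {0..t+1} = at t" using t by (intro at_within_interior) auto
  ultimately show ?thesis using Af_integral[OF q \<omega>] by simp
qed

lemma Af_Lipschitz:
  assumes q: "continuous_on UNIV q" and Q: "\<And>y. \<bar>q y\<bar> \<le> Q" and \<omega>: "\<omega> \<in> space M"
    and st: "0 \<le> s" "s \<le> t"
  shows "\<bar>Af q t \<omega> - Af q s \<omega>\<bar> \<le> Q * (t - s)"
proof -
  have c: "continuous_on {a..b} (\<lambda>s. q (Zc s \<omega>))" for a b
    using Zc_compose_continuous[OF \<omega> q] by (rule continuous_on_subset) simp
  have "integral {0..s} (\<lambda>s. q (Zc s \<omega>)) + integral {s..t} (\<lambda>s. q (Zc s \<omega>)) = integral {0..t} (\<lambda>s. q (Zc s \<omega>))"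
    by (rule Henstock_Kurzweil_Integration.integral_combine) (use st in \<open>simp_all add: integrable_continuous_real[OF c]\<close>)
  then have "\<bar>Af q t \<omega> - Af q s \<omega>\<bar> = \<bar>integral {s..t} (\<lambda>s. q (Zc s \<omega>))\<bar>"
    using Af_integral[OF q \<omega>] by simp
  also have "\<dots> \<le> Q * (t - s)"
    using integral_bound[OF st(2) c, of Q] Q by simp
  finally show ?thesis .
qed

lemma Af_nonneg: "(\<And>y. 0 \<le> q y) \<Longrightarrow> 0 \<le> Af q t \<omega>"
  unfolding Af_def by (intro Bochner_Integration.integral_nonneg) auto

lemma Af_0 [simp]: "t \<le> 0 \<Longrightarrow> Af q t \<omega> = 0"
proof -
  assume "t \<le> 0"
  have "AE s in lborel. s \<noteq> (0::real)" by (rule AE_lborel_singleton)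
  then have "AE s in lborel. indicator {0..t} s * q (Zc s \<omega>) = 0"
    by eventually_elim (use \<open>t \<le> 0\<close> in \<open>auto simp: indicator_def\<close>)
  then show ?thesis unfolding Af_def by (rule integral_eq_zero_AE)
qed

lemma Af_continuous:
  assumes q: "continuous_on UNIV q" and Q: "\<And>y. \<bar>q y\<bar> \<le> Q" and \<omega>: "\<omega> \<in> space M"
  shows "continuous_on UNIV (\<lambda>t. Af q t \<omega>)"
proof -
  have 0: "\<bar>Af q t \<omega> - Af q s \<omega>\<bar> \<le> Q * \<bar>t - s\<bar>" if "s \<le> t" for s t
  proof -
    have Q0: "0 \<le> Q" using Q[of vertex] by linarith
    have clamp: "Af q r \<omega> = Af q (max 0 r) \<omega>" for r by (cases "0 \<le> r") simp_all
    have "\<bar>Af q t \<omega> - Af q s \<omega>\<bar> \<le> Q * (max 0 t - max 0 s)"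
      unfolding clamp[of t] clamp[of s] by (rule Af_Lipschitz[OF q Q \<omega>]) (use that in simp_all)
    also have "\<dots> \<le> Q * \<bar>t - s\<bar>" using that Q0 by (intro mult_left_mono) auto
    finally show ?thesis .
  qed
  have "Q-lipschitz_on UNIV (\<lambda>t. Af q t \<omega>)"
  proof (rule lipschitz_onI)
    show "dist (Af q s \<omega>) (Af q t \<omega>) \<le> Q * dist s t" for s t
      using 0[of s t] 0[of t s] by (cases "s \<le> t") (auto simp: dist_real_def abs_minus_commute)
    show "0 \<le> Q" using Q[of vertex] by linarith
  qed
  then show ?thesis by (rule lipschitz_on_continuous_on)
qed

end

section \<open>Functions on the star graph\<close>

lemma (in finite_measure) continuous_on_integral_bounded:
  fixes f :: "real \<Rightarrow> 'a \<Rightarrow> real"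
  assumes m: "\<And>t. f t \<in> borel_measurable M"
    and c: "\<And>\<omega>. \<omega> \<in> space M \<Longrightarrow> continuous_on UNIV (\<lambda>t. f t \<omega>)"
    and B: "\<And>t \<omega>. \<omega> \<in> space M \<Longrightarrow> \<bar>f t \<omega>\<bar> \<le> B"
  shows "continuous_on UNIV (\<lambda>t. \<integral>\<omega>. f t \<omega> \<partial>M)"
  unfolding continuous_on_sequentially
proof (intro allI ballI impI)
  fix X :: "nat \<Rightarrow> real" and t assume X: "(\<forall>n. X n \<in> UNIV) \<and> X \<longlonglongrightarrow> t"
  have "(\<lambda>n. \<integral>\<omega>. f (X n) \<omega> \<partial>M) \<longlonglongrightarrow> (\<integral>\<omega>. f t \<omega> \<partial>M)"
  proof (rule bounded_convergence)
    show "AE \<omega> in M. (\<lambda>n. f (X n) \<omega>) \<longlonglongrightarrow> f t \<omega>"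
      by (rule AE_I2) (use c X in \<open>auto simp: continuous_on_sequentially comp_def\<close>)
    show "AE \<omega> in M. \<bar>f (X n) \<omega>\<bar> \<le> B" for n by (rule AE_I2) (rule B)
  qed (rule m)+
  then show "((\<lambda>t. \<integral>\<omega>. f t \<omega> \<partial>M) \<circ> X) \<longlonglongrightarrow> (\<integral>\<omega>. f t \<omega> \<partial>M)"
    by (simp add: comp_def)
qed

lemma exp_minus_Lipschitz:
  fixes u v :: real
  assumes "0 \<le> u" "0 \<le> v"
  shows "\<bar>exp (- u) - exp (- v)\<bar> \<le> \<bar>u - v\<bar>"
proof -
  have *: "exp (- u) - exp (- v) \<le> v - u" if "0 \<le> u" "u \<le> v" for u v :: real
  proof -
    have "exp (- u) - exp (- v) = exp (- u) * (1 - exp (u - v))"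
      by (simp add: exp_diff exp_minus field_simps)
    also have "\<dots> \<le> 1 * (1 - exp (u - v))"
      using that by (intro mult_right_mono) auto
    also have "1 * (1 - exp (u - v)) \<le> v - u" using exp_ge_add_one_self[of "u - v"] unfolding mult_1 by linarith
    finally show ?thesis .
  qed
  show ?thesis
  proof (cases "u \<le> v")
    case True
    with *[OF assms(1) True] show ?thesis by simp
  next
    case False
    with *[OF assms(2), of u] show ?thesis by simp
  qed
qed

lemma dist_pt_vertex [simp]: "0 \<le> r \<Longrightarrow> dist (pt j r) vertex = r"
  using dist_pt[of r 0 j j] by simp

lemma pt_continuous: "continuous_on {0..} (pt j)"
  unfolding continuous_on_iff by (auto simp: dist_pt dist_real_def)

lemma C0_bounded:
  fixes f :: "'n::finite star \<Rightarrow> real"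
  assumes "f \<in> C0"
  shows "bounded (range f)"
proof -
  have c: "continuous_on UNIV f" using assms by (simp add: C0_def)
  obtain R where R: "\<And>x. dist x vertex > R \<Longrightarrow> \<bar>f x\<bar> < 1"
    using assms zero_less_one unfolding C0_def by blast
  have cov: "range f \<subseteq> (\<Union>j. (\<lambda>r. f (pt j r)) ` {0..R}) \<union> {-1..1}"
  proof safe
    fix x assume "f x \<notin> {-1..1}"
    obtain j r where "0 \<le> r" "x = pt j r" by (cases x rule: star_cases)
    moreover have "r \<le> R"
    proof (rule ccontr)
      assume "\<not> r \<le> R"
      with R[of x] calculation \<open>f x \<notin> {-1..1}\<close> show False by auto
    qed
    ultimately show "f x \<in> (\<Union>j. (\<lambda>r. f (pt j r)) ` {0..R})"
      by (intro UN_I[of j]) auto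
  qed
  moreover have "bounded ((\<Union>j. (\<lambda>r. f (pt j r)) ` {0..R}) \<union> {-1..1})"
  proof -
    have "bounded ((\<lambda>r. f (pt j r)) ` {0..R})" for j
      by (intro compact_imp_bounded compact_continuous_image continuous_on_compose2[OF c]
          continuous_on_subset[OF pt_continuous]) auto
    then show ?thesis by (auto simp: bounded_UN)
  qed
  ultimately show ?thesis by (rule bounded_subset[rotated])
qed

lemma C0_add:
  assumes "f \<in> C0" "g \<in> C0"
  shows "(\<lambda>x. a * f x + b * g x) \<in> C0"
  unfolding C0_def mem_Collect_eq
proof (intro conjI allI impI)
  show "continuous_on UNIV (\<lambda>x. a * f x + b * g x)"
    using assms by (auto simp: C0_def intro!: continuous_intros)
  fix e :: real assume e: "0 < e"
  define M where "M = \<bar>a\<bar> + \<bar>b\<bar> + 1"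
  have M: "0 < M" by (simp add: M_def)
  from e M have eM: "0 < e / M" by simp
  obtain R1 where R1: "\<And>x. dist x vertex > R1 \<Longrightarrow> \<bar>f x\<bar> < e / M"
    using assms(1) eM unfolding C0_def by blast
  obtain R2 where R2: "\<And>x. dist x vertex > R2 \<Longrightarrow> \<bar>g x\<bar> < e / M"
    using assms(2) eM unfolding C0_def by blast
  have "\<bar>a * f x + b * g x\<bar> < e" if "dist x vertex > max R1 R2" for x
  proof -
    have "\<bar>a * f x + b * g x\<bar> \<le> \<bar>a\<bar> * \<bar>f x\<bar> + \<bar>b\<bar> * \<bar>g x\<bar>"
      using abs_triangle_ineq[of "a * f x" "b * g x"] by (simp add: abs_mult)
    also have "\<dots> \<le> \<bar>a\<bar> * (e / M) + \<bar>b\<bar> * (e / M)"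
      using R1[of x] R2[of x] that by (intro add_mono mult_left_mono) auto
    also have "\<dots> = (\<bar>a\<bar> + \<bar>b\<bar>) * (e / M)" by (rule distrib_right[symmetric])
    also have "\<dots> < M * (e / M)" using eM by (intro mult_strict_right_mono) (auto simp: M_def)
    also have "\<dots> = e" using M by simp
    finally show ?thesis .
  qed
  then show "\<exists>R. \<forall>x. dist x vertex > R \<longrightarrow> \<bar>a * f x + b * g x\<bar> < e" by blast
qed

lemma exp_dist_C0:
  assumes m: "0 < m"
  shows "(\<lambda>x. exp (- m * dist x vertex)) \<in> C0"
  unfolding C0_def mem_Collect_eq
proof (intro conjI allI impI)
  show "continuous_on UNIV (\<lambda>x. exp (- m * dist x vertex))" by (intro continuous_intros)
  fix e :: real assume e: "0 < e"
  have "\<bar>exp (- m * dist x vertex)\<bar> < e" if "dist x vertex > - ln e / m" for x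
  proof -
    have "- ln e < m * dist x vertex" using that m by (simp add: field_simps)
    then have "exp (- m * dist x vertex) < exp (ln e)" by simp
    then show ?thesis using e by simp
  qed
  then show "\<exists>R. \<forall>x. dist x vertex > R \<longrightarrow> \<bar>exp (- m * dist x vertex)\<bar> < e" by blast
qed

text \<open>Membership in the domain from explicit first and second derivatives along the open rays; \<open>D\<close>
  collects the limits of the first derivatives at the vertex.\<close>

lemma star_domainI:
  fixes p :: "'n::finite \<Rightarrow> real"
  assumes f: "f \<in> C0" and h: "h \<in> C0"
    and d1: "\<And>j r. 0 < r \<Longrightarrow> ((\<lambda>s. f (pt j s)) has_real_derivative f1 j r) (at r)"
    and d2: "\<And>j r. 0 < r \<Longrightarrow> (f1 j has_real_derivative h (pt j r)) (at r)"
    and v: "\<And>j. (f1 j \<longlongrightarrow> D j) (at_right 0)"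
    and s: "(\<Sum>k\<in>UNIV. p k * D k) = 0"
  shows "f \<in> star_domain p" "second_deriv_ext f h"
proof -
  show 1: "second_deriv_ext f h"
    unfolding second_deriv_ext_def using h d1 d2 by blast
  have "vertex_deriv f j = D j" for j
    unfolding vertex_deriv_def
  proof (rule tendsto_Lim)
    show "((\<lambda>r. deriv (\<lambda>s. f (pt j s)) r) \<longlongrightarrow> D j) (at_right 0)"
    proof (rule Lim_transform_eventually[OF v])
      show "\<forall>\<^sub>F r in at_right 0. f1 j r = deriv (\<lambda>s. f (pt j s)) r"
        using d1 by (auto simp: eventually_at_filter intro!: always_eventually DERIV_imp_deriv[symmetric])
    qed
  qed simp
  then show "f \<in> star_domain p"
    unfolding star_domain_def C02_def using f 1 s by auto
qed

section \<open>The Feynman-Kac identity\<close>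

context star_BM
begin

text \<open>Pairs of a function and its image under the generator, in a class that contains the domain and also
  the constants, which do not vanish at infinity.\<close>

definition core :: "('n star \<Rightarrow> real) \<Rightarrow> ('n star \<Rightarrow> real) \<Rightarrow> bool" where
  "core g g' \<longleftrightarrow> continuous_on UNIV g \<and> bounded (range g) \<and> continuous_on UNIV g' \<and> bounded (range g') \<and>
    (\<forall>h\<ge>0. continuous_on UNIV (T h g)) \<and>
    uniform_limit UNIV (\<lambda>h x. (T h g x - g x) / h) g' (at_right 0)"

lemma core_domain:
  assumes "f \<in> star_domain p" "second_deriv_ext f h"
  shows "core f (\<lambda>x. 1/2 * h x)"
proof -
  have "C0_generator (transition_op P Z) f (\<lambda>x. 1/2 * h x)"
    using BM assms unfolding star_Brownian_motion_def by blast
  then have g: "f \<in> C0" "(\<lambda>x. 1/2 * h x) \<in> C0"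
    "uniform_limit UNIV (\<lambda>t x. (T t f x - f x) / t) (\<lambda>x. 1/2 * h x) (at_right 0)"
    unfolding C0_generator_def T_def by blast+
  moreover have "T t f \<in> C0" if "0 \<le> t" for t
    using BM that g(1) unfolding star_Brownian_motion_def T_def by blast
  ultimately show ?thesis
    unfolding core_def using C0_bounded[OF g(1)] C0_bounded[OF g(2)]
    unfolding C0_def by blast
qed

lemma T_const: "T h (\<lambda>_. c) = (\<lambda>_. c)"
proof
  fix x
  interpret prob_space "P x" by (rule prob_P)
  show "T h (\<lambda>_. c) x = c"
    unfolding T_def transition_op_def using prob_space by simp
qed

lemma core_const: "core (\<lambda>_. c) (\<lambda>_. 0)"
  unfolding core_def by (auto simp: T_const image_constant_conv intro!: uniform_limit_intros)

text \<open>\<open>R q l\<close> is \<open>l\<close> times the \<open>l\<close>-resolvent of the process killed at rate \<open>q\<close>.\<close>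

definition R :: "('n star \<Rightarrow> real) \<Rightarrow> real \<Rightarrow> ('n star \<Rightarrow> real) \<Rightarrow> 'n star \<Rightarrow> real" where
  "R q l f x = (\<integral>t. \<integral>\<omega>. exp (- Af q t \<omega>) * f (Zc t \<omega>) \<partial>P x \<partial>expo l)"

context
  fixes q :: "'n star \<Rightarrow> real" and Q :: real
  assumes q: "continuous_on UNIV q" and q0: "\<And>y. 0 \<le> q y" and qQ: "\<And>y. q y \<le> Q"
begin

lemma qQ': "\<bar>q y\<bar> \<le> Q" using q0[of y] qQ[of y] by simp

lemma E_le_1: "exp (- Af q t \<omega>) \<le> 1"
  using Af_nonneg[of q t \<omega>] q0 by simp

lemma Ef_bound:
  assumes B: "\<And>y. \<bar>f y\<bar> \<le> B"
  shows "\<bar>exp (- Af q t \<omega>) * f y\<bar> \<le> B"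
  using mult_mono[OF E_le_1 B[of y], of t \<omega>] by (simp add: abs_mult)

lemma Ef_measurable:
  assumes f: "continuous_on UNIV f"
  shows "(\<lambda>\<omega>. exp (- Af q t \<omega>) * f (Zc s \<omega>)) \<in> borel_measurable M"
  by (intro borel_measurable_times Zc_compose_measurable f)
     (use Af_measurable[OF q] in measurable)

lemma Ef_integrable:
  assumes f: "continuous_on UNIV f" and B: "\<And>y. \<bar>f y\<bar> \<le> B"
  shows "integrable (P x) (\<lambda>\<omega>. exp (- Af q t \<omega>) * f (Zc s \<omega>))"
proof -
  interpret prob_space "P x" by (rule prob_P)
  show ?thesis
  proof (rule integrable_const_bound[where B=B])
    show "AE \<omega> in P x. norm (exp (- Af q t \<omega>) * f (Zc s \<omega>)) \<le> B"
      by (rule AE_I2) (unfold real_norm_def, rule Ef_bound[OF B])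
  qed (use Ef_measurable[OF f] in simp)
qed

lemma Ef_continuous:
  assumes f: "continuous_on UNIV f" and B: "\<And>y. \<bar>f y\<bar> \<le> B"
  shows "continuous_on UNIV (\<lambda>t. \<integral>\<omega>. exp (- Af q t \<omega>) * f (Zc t \<omega>) \<partial>P x)"
proof -
  interpret prob_space "P x" by (rule prob_P)
  show ?thesis
  proof (rule continuous_on_integral_bounded)
    show "continuous_on UNIV (\<lambda>t. exp (- Af q t \<omega>) * f (Zc t \<omega>))" if "\<omega> \<in> space (P x)" for \<omega>
      using that Af_continuous[OF q qQ'] by (intro continuous_intros Zc_compose_continuous f) auto
  qed (use Ef_measurable[OF f] Ef_bound[OF B] in auto)
qed

lemma Ef_expectation_bound:
  assumes f: "continuous_on UNIV f" and B: "\<And>y. \<bar>f y\<bar> \<le> B"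
  shows "\<bar>\<integral>\<omega>. exp (- Af q t \<omega>) * f (Zc s \<omega>) \<partial>P x\<bar> \<le> B"
proof -
  interpret prob_space "P x" by (rule prob_P)
  have "\<bar>\<integral>\<omega>. exp (- Af q t \<omega>) * f (Zc s \<omega>) \<partial>P x\<bar> \<le> (\<integral>\<omega>. \<bar>exp (- Af q t \<omega>) * f (Zc s \<omega>)\<bar> \<partial>P x)"
    using integral_norm_bound by auto
  also have "\<dots> \<le> (\<integral>\<omega>. B \<partial>P x)"
    by (rule integral_mono) (use Ef_integrable[OF f B] Ef_bound[OF B] in auto)
  also have "\<dots> = B" using prob_space by simp
  finally show ?thesis .
qed

lemma Ef_expo_integrable:
  assumes l: "0 < l" and f: "continuous_on UNIV f" and B: "\<And>y. \<bar>f y\<bar> \<le> B"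
  shows "integrable (expo l) (\<lambda>t. \<integral>\<omega>. exp (- Af q t \<omega>) * f (Zc t \<omega>) \<partial>P x)"
  by (rule integrable_expo_bounded[OF l]) (auto intro: borel_measurable_continuous_onI Ef_continuous[OF f B] Ef_expectation_bound[OF f B])

lemma R_bound:
  assumes l: "0 < l" and f: "continuous_on UNIV f" and B: "\<And>y. \<bar>f y\<bar> \<le> B"
  shows "\<bar>R q l f x\<bar> \<le> B"
proof -
  interpret prob_space "expo l" by (rule prob_space_expo[OF l])
  have "\<bar>R q l f x\<bar> \<le> (\<integral>t. \<bar>\<integral>\<omega>. exp (- Af q t \<omega>) * f (Zc t \<omega>) \<partial>P x\<bar> \<partial>expo l)"
    unfolding R_def using integral_norm_bound by auto
  also have "\<dots> \<le> (\<integral>t. B \<partial>expo l)"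
    by (rule integral_mono) (use Ef_expo_integrable[OF l f B] Ef_expectation_bound[OF f B] in auto)
  also have "\<dots> = B" using prob_space by simp
  finally show ?thesis .
qed

lemma R_linear:
  assumes l: "0 < l" and f: "continuous_on UNIV f" "\<And>y. \<bar>f y\<bar> \<le> B"
    and g: "continuous_on UNIV g" "\<And>y. \<bar>g y\<bar> \<le> C"
  shows "R q l (\<lambda>y. a * f y + b * g y) x = a * R q l f x + b * R q l g x"
proof -
  have "(\<integral>\<omega>. exp (- Af q t \<omega>) * (a * f (Zc t \<omega>) + b * g (Zc t \<omega>)) \<partial>P x) =
      a * (\<integral>\<omega>. exp (- Af q t \<omega>) * f (Zc t \<omega>) \<partial>P x) + b * (\<integral>\<omega>. exp (- Af q t \<omega>) * g (Zc t \<omega>) \<partial>P x)" for t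
  proof -
    have "(\<integral>\<omega>. exp (- Af q t \<omega>) * (a * f (Zc t \<omega>) + b * g (Zc t \<omega>)) \<partial>P x) =
       (\<integral>\<omega>. a * (exp (- Af q t \<omega>) * f (Zc t \<omega>)) + b * (exp (- Af q t \<omega>) * g (Zc t \<omega>)) \<partial>P x)"
      by (simp add: algebra_simps)
    then show ?thesis using Ef_integrable[OF f, of x t t] Ef_integrable[OF g, of x t t] by simp
  qed
  then show ?thesis
    unfolding R_def using Ef_expo_integrable[OF l f, of x] Ef_expo_integrable[OF l g, of x] by simp
qed

lemma R_mono:
  assumes l: "0 < l" and f: "continuous_on UNIV f" "\<And>y. \<bar>f y\<bar> \<le> B"
    and g: "continuous_on UNIV g" "\<And>y. \<bar>g y\<bar> \<le> C" and le: "\<And>y. f y \<le> g y"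
  shows "R q l f x \<le> R q l g x"
  unfolding R_def
proof (rule integral_mono[OF Ef_expo_integrable[OF l f] Ef_expo_integrable[OF l g]])
  show "(\<integral>\<omega>. exp (- Af q t \<omega>) * f (Zc t \<omega>) \<partial>P x) \<le> (\<integral>\<omega>. exp (- Af q t \<omega>) * g (Zc t \<omega>) \<partial>P x)" for t
    by (rule integral_mono[OF Ef_integrable[OF f] Ef_integrable[OF g]]) (simp add: le)
qed

text \<open>With \<open>E\<close> the killing factor and \<open>a < b\<close> the ordered pair of \<open>t\<close> and \<open>t + h\<close>, the increment of
  \<open>E\<^sub>t g (Z\<^sub>t)\<close> is \<open>(E\<^sub>b - E\<^sub>a) g (Z\<^sub>b) + E\<^sub>a (g (Z\<^sub>b) - g (Z\<^sub>a))\<close>. The first part yields \<open>- q g\<close> by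
  differentiating along paths. By the Markov property at \<open>a\<close>, the second has the same expectation as
  \<open>E\<^sub>a (T\<^sub>b\<^sub>-\<^sub>a g - g) (Z\<^sub>a)\<close>, and the difference quotient of the semigroup converges uniformly in space.
  Treating both signs of \<open>h\<close> at once gives a two-sided derivative.\<close>

lemma killed_semigroup_derivative:
  assumes core: "core g g'" and t: "0 < t"
  shows "((\<lambda>t. \<integral>\<omega>. exp (- Af q t \<omega>) * g (Zc t \<omega>) \<partial>P x) has_real_derivative
    (\<integral>\<omega>. exp (- Af q t \<omega>) * (g' (Zc t \<omega>) - q (Zc t \<omega>) * g (Zc t \<omega>)) \<partial>P x)) (at t)"
proof -
  interpret prob_space "P x" by (rule prob_P)
  have cg: "continuous_on UNIV g" "continuous_on UNIV g'" "\<And>h. 0 \<le> h \<Longrightarrow> continuous_on UNIV (T h g)"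
    and ul: "uniform_limit UNIV (\<lambda>h x. (T h g x - g x) / h) g' (at_right 0)"
    using core by (auto simp: core_def)
  obtain B where B: "\<And>y. \<bar>g y\<bar> \<le> B" using core by (auto simp: core_def bounded_iff)
  obtain B' where B': "\<And>y. \<bar>g' y\<bar> \<le> B'" using core by (auto simp: core_def bounded_iff)
  have B0: "0 \<le> B" using B[of vertex] by linarith
  have Q0: "0 \<le> Q" using qQ'[of vertex] by linarith
  have TB: "\<bar>T h g y\<bar> \<le> B" if "0 \<le> h" for h y
  proof -
    interpret Py: prob_space "P y" by (rule prob_P)
    have gm: "(\<lambda>\<omega>. g (Z h \<omega>)) \<in> borel_measurable M"
      using Zc_compose_measurable[OF cg(1), of h] that by (simp add: Zc_eq)
    have "\<bar>\<integral>\<omega>. g (Z h \<omega>) \<partial>P y\<bar> \<le> (\<integral>\<omega>. \<bar>g (Z h \<omega>)\<bar> \<partial>P y)"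
      using integral_norm_bound by auto
    also have "\<dots> \<le> (\<integral>\<omega>. B \<partial>P y)"
      by (rule integral_mono) (use gm B in \<open>auto intro!: Py.integrable_const_bound[where B=B]\<close>)
    also have "\<dots> = B" using Py.prob_space by simp
    finally show ?thesis by (simp add: T_def transition_op_def)
  qed
  define E where "E t \<omega> = exp (- Af q t \<omega>)" for t \<omega>
  define \<rho> where "\<rho> t = (\<integral>\<omega>. E t \<omega> * g (Zc t \<omega>) \<partial>P x)" for t
  have E1: "0 \<le> E t \<omega>" "E t \<omega> \<le> 1" for t \<omega> using E_le_1 by (auto simp: E_def)
  have Em [measurable]: "E t \<in> borel_measurable M" for t
    unfolding E_def[abs_def] using Af_measurable[OF q] by measurable
  have [measurable]: "(\<lambda>\<omega>. g (Zc s \<omega>)) \<in> borel_measurable M" "(\<lambda>\<omega>. g' (Zc s \<omega>)) \<in> borel_measurable M"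
    "(\<lambda>\<omega>. q (Zc s \<omega>)) \<in> borel_measurable M" for s
    by (intro Zc_compose_measurable cg q)+
  have bint: "integrable (P x) f" if "f \<in> borel_measurable M" "\<And>\<omega>. \<omega> \<in> space M \<Longrightarrow> \<bar>f \<omega>\<bar> \<le> K" for f :: "'w \<Rightarrow> real" and K
    using that by (intro integrable_const_bound[where B=K]) auto
  have "((\<lambda>h. (\<rho> (t + h) - \<rho> t) / h) \<longlongrightarrow>
      (\<integral>\<omega>. E t \<omega> * (g' (Zc t \<omega>) - q (Zc t \<omega>) * g (Zc t \<omega>)) \<partial>P x)) (at 0 within {-t<..})"
    unfolding tendsto_at_iff_sequentially
  proof (intro allI impI)
    fix X :: "nat \<Rightarrow> real"
    assume "\<forall>n. X n \<in> {-t<..} - {0}" and X0: "X \<longlonglongrightarrow> 0"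
    then have Xtn: "- t < X n \<and> X n \<noteq> 0" for n by (simp add: Ball_def)
    have Xt: "0 < t + X n" and Xn: "X n \<noteq> 0" for n using Xtn[of n] by linarith+
    define a where "a n = min t (t + X n)" for n
    define b where "b n = max t (t + X n)" for n
    define G where "G n y = (T \<bar>X n\<bar> g y - g y) / \<bar>X n\<bar>" for n y
    have ab: "0 < a n" "a n < b n" "b n - a n = \<bar>X n\<bar>" for n
      using Xt[of n] Xn[of n] t by (auto simp: a_def b_def)
    have at: "a \<longlonglongrightarrow> t"
      using tendsto_min[OF tendsto_const[of t] tendsto_add[OF tendsto_const[of t] X0]] by (simp add: a_def[abs_def])
    have bt: "b \<longlonglongrightarrow> t"
      using tendsto_max[OF tendsto_const[of t] tendsto_add[OF tendsto_const[of t] X0]] by (simp add: b_def[abs_def])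
    have Zlim: "(\<lambda>n. f (Zc (c n) \<omega>)) \<longlonglongrightarrow> f (Zc t \<omega>)"
      if "\<omega> \<in> space M" "continuous_on UNIV f" "c \<longlonglongrightarrow> t" for \<omega> c and f :: "'n star \<Rightarrow> real"
      using Zc_compose_continuous[OF that(1,2)] that(3) by (auto simp: continuous_on_sequentially comp_def)
    have Elim: "(\<lambda>n. E (a n) \<omega>) \<longlonglongrightarrow> E t \<omega>" if "\<omega> \<in> space M" for \<omega>
    proof -
      have "continuous_on UNIV (\<lambda>t. E t \<omega>)"
        unfolding E_def by (intro continuous_intros Af_continuous[OF q qQ' that])
      then show ?thesis using at by (auto simp: continuous_on_sequentially comp_def)
    qed
    have Gm [measurable]: "(\<lambda>\<omega>. G n (Zc s \<omega>)) \<in> borel_measurable M" for n s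
      unfolding G_def by (rule Zc_compose_measurable) (intro continuous_intros cg, use Xn in auto)
    have GB: "\<bar>G n y\<bar> \<le> 2 * B / \<bar>X n\<bar>" for n y
    proof -
      have "\<bar>T \<bar>X n\<bar> g y - g y\<bar> \<le> 2 * B" using TB[of "\<bar>X n\<bar>" y] B[of y] by linarith
      then show ?thesis by (simp add: G_def divide_right_mono)
    qed
    define I1 where "I1 n = (\<integral>\<omega>. (E (b n) \<omega> - E (a n) \<omega>) / (b n - a n) * g (Zc (b n) \<omega>) \<partial>P x)" for n
    define I2 where "I2 n = (\<integral>\<omega>. E (a n) \<omega> * g' (Zc (a n) \<omega>) \<partial>P x)" for n
    define I3 where "I3 n = (\<integral>\<omega>. E (a n) \<omega> * (G n (Zc (a n) \<omega>) - g' (Zc (a n) \<omega>)) \<partial>P x)" for n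
    have Ediff: "\<bar>(E (b n) \<omega> - E (a n) \<omega>) / (b n - a n)\<bar> \<le> Q" if "\<omega> \<in> space M" for n \<omega>
    proof -
      have "\<bar>E (b n) \<omega> - E (a n) \<omega>\<bar> \<le> \<bar>Af q (b n) \<omega> - Af q (a n) \<omega>\<bar>"
        unfolding E_def by (intro exp_minus_Lipschitz Af_nonneg q0)
      also have "\<dots> \<le> Q * (b n - a n)"
        by (rule Af_Lipschitz[OF q qQ' that]) (use ab[of n] in auto)
      finally show ?thesis using ab[of n] by (simp add: abs_divide pos_divide_le_eq)
    qed
    have i1: "integrable (P x) (\<lambda>\<omega>. (E (b n) \<omega> - E (a n) \<omega>) / (b n - a n) * g (Zc (b n) \<omega>))" for n
    proof (rule bint[of _ "Q * B"])
      fix \<omega> assume "\<omega> \<in> space M"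
      then show "\<bar>(E (b n) \<omega> - E (a n) \<omega>) / (b n - a n) * g (Zc (b n) \<omega>)\<bar> \<le> Q * B"
        unfolding abs_mult by (intro mult_mono Ediff B Q0) auto
    qed measurable
    have i2: "integrable (P x) (\<lambda>\<omega>. E (a n) \<omega> * g' (Zc (a n) \<omega>))" for n
      unfolding E_def by (rule Ef_integrable[OF cg(2) B'])
    have i3: "integrable (P x) (\<lambda>\<omega>. E (a n) \<omega> * G n (Zc (a n) \<omega>))" for n
    proof (rule bint[of _ "1 * (2 * B / \<bar>X n\<bar>)"])
      fix \<omega>
      show "\<bar>E (a n) \<omega> * G n (Zc (a n) \<omega>)\<bar> \<le> 1 * (2 * B / \<bar>X n\<bar>)"
        unfolding abs_mult using E1 by (intro mult_mono GB) (auto simp: abs_mult)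
    qed measurable
    have iEg: "integrable (P x) (\<lambda>\<omega>. E s \<omega> * g (Zc r \<omega>))" for s r
      unfolding E_def by (rule Ef_integrable[OF cg(1) B])
    \<comment> \<open>\<open>I1\<close> is the killing part, \<open>I2\<close> the generator part and \<open>I3\<close> the error of the difference quotient
      of the semigroup.\<close>
    have quot: "(\<rho> (t + X n) - \<rho> t) / X n = I1 n + I2 n + I3 n" for n
    proof -
      have h: "0 < b n - a n" using ab(2)[of n] by simp
      have "(\<rho> (t + X n) - \<rho> t) / X n = (\<rho> (b n) - \<rho> (a n)) / (b n - a n)"
        using Xn[of n] by (cases "0 < X n") (auto simp: a_def b_def min_def max_def divide_simps)
      moreover have "\<rho> (b n) - \<rho> (a n) = (b n - a n) * (I1 n + I2 n + I3 n)"
      proof -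
        have "(\<integral>\<omega>. E (a n) \<omega> * g (Z (a n + (b n - a n)) \<omega>) \<partial>P x)
            = (\<integral>\<omega>. E (a n) \<omega> * T (b n - a n) g (Z (a n) \<omega>) \<partial>P x)"
        proof (rule Markov_property[where B=1])
          show "E (a n) \<in> borel_measurable (natural_filtration M Z (ennreal (a n)))"
            unfolding E_def[abs_def] using Af_adapted[OF q, of "a n"] by measurable
          show "\<bar>E (a n) \<omega>\<bar> \<le> 1" for \<omega> using E1 by simp
          show "g \<in> borel_measurable borel" by (rule borel_measurable_continuous_onI[OF cg(1)])
          show "bounded (range g)" using core by (simp add: core_def)
        qed (use ab[of n] in auto)
        moreover have "a n + (b n - a n) = b n" by simp
        ultimately have Mk: "(\<integral>\<omega>. E (a n) \<omega> * g (Zc (b n) \<omega>) \<partial>P x)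
            = (\<integral>\<omega>. E (a n) \<omega> * (g (Zc (a n) \<omega>) + (b n - a n) * G n (Zc (a n) \<omega>)) \<partial>P x)"
          using ab[of n] Xn[of n] by (simp only: Zc_eq less_imp_le less_trans[OF ab(1) ab(2)]) (simp add: G_def)
        have "(b n - a n) * I1 n = (\<integral>\<omega>. E (b n) \<omega> * g (Zc (b n) \<omega>) - E (a n) \<omega> * g (Zc (b n) \<omega>) \<partial>P x)"
          unfolding I1_def using h
          by (subst Bochner_Integration.integral_mult_right_zero[symmetric])
             (intro Bochner_Integration.integral_cong, auto simp: field_simps)
        also have "\<dots> = \<rho> (b n) - (\<integral>\<omega>. E (a n) \<omega> * g (Zc (b n) \<omega>) \<partial>P x)"
          unfolding \<rho>_def by (intro Bochner_Integration.integral_diff iEg)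
        finally have e1: "(b n - a n) * I1 n = \<rho> (b n) - (\<integral>\<omega>. E (a n) \<omega> * g (Zc (b n) \<omega>) \<partial>P x)" .
        have "(\<integral>\<omega>. E (a n) \<omega> * (g (Zc (a n) \<omega>) + (b n - a n) * G n (Zc (a n) \<omega>)) \<partial>P x) =
            (\<integral>\<omega>. E (a n) \<omega> * g (Zc (a n) \<omega>) + (b n - a n) * (E (a n) \<omega> * G n (Zc (a n) \<omega>)) \<partial>P x)"
          by (intro Bochner_Integration.integral_cong) (auto simp: algebra_simps)
        also have "\<dots> = \<rho> (a n) + (b n - a n) * (\<integral>\<omega>. E (a n) \<omega> * G n (Zc (a n) \<omega>) \<partial>P x)"
          unfolding \<rho>_def using iEg i3 by simp
        also have "(\<integral>\<omega>. E (a n) \<omega> * G n (Zc (a n) \<omega>) \<partial>P x) = I2 n + I3 n"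
          unfolding I2_def I3_def using i2[of n] i3[of n] by (simp add: right_diff_distrib)
        finally show ?thesis using e1 Mk by (simp add: algebra_simps)
      qed
      ultimately show ?thesis using h by simp
    qed
    have L1: "I1 \<longlonglongrightarrow> (\<integral>\<omega>. - q (Zc t \<omega>) * E t \<omega> * g (Zc t \<omega>) \<partial>P x)"
      unfolding I1_def
    proof (rule bounded_convergence[where B="Q * B"])
      show "AE \<omega> in P x. (\<lambda>n. (E (b n) \<omega> - E (a n) \<omega>) / (b n - a n) * g (Zc (b n) \<omega>)) \<longlonglongrightarrow> - q (Zc t \<omega>) * E t \<omega> * g (Zc t \<omega>)"
      proof (rule AE_I2, rule tendsto_mult)
        fix \<omega> assume "\<omega> \<in> space (P x)" then have \<omega>: "\<omega> \<in> space M" by simp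
        show "(\<lambda>n. g (Zc (b n) \<omega>)) \<longlonglongrightarrow> g (Zc t \<omega>)" by (rule Zlim[OF \<omega> cg(1) bt])
        have "((\<lambda>t. E t \<omega>) has_real_derivative E t \<omega> * - q (Zc t \<omega>)) (at t)"
          unfolding E_def by (auto intro!: derivative_eq_intros Af_has_derivative[OF q \<omega> t])
        then have "((\<lambda>h. (E (t + h) \<omega> - E t \<omega>) / h) \<longlongrightarrow> E t \<omega> * - q (Zc t \<omega>)) (at 0)"
          by (simp add: DERIV_def)
        then have "(\<lambda>n. (E (t + X n) \<omega> - E t \<omega>) / X n) \<longlonglongrightarrow> E t \<omega> * - q (Zc t \<omega>)"
          using Xn X0 by (auto simp: tendsto_at_iff_sequentially comp_def)
        moreover have "(E (t + X n) \<omega> - E t \<omega>) / X n = (E (b n) \<omega> - E (a n) \<omega>) / (b n - a n)" for n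
          using Xn[of n] by (cases "0 < X n") (auto simp: a_def b_def min_def max_def divide_simps)
        ultimately show "(\<lambda>n. (E (b n) \<omega> - E (a n) \<omega>) / (b n - a n)) \<longlonglongrightarrow> - q (Zc t \<omega>) * E t \<omega>"
          by (simp add: mult.commute)
      qed
      show "AE \<omega> in P x. \<bar>(E (b n) \<omega> - E (a n) \<omega>) / (b n - a n) * g (Zc (b n) \<omega>)\<bar> \<le> Q * B" for n
        by (rule AE_I2) (unfold abs_mult, intro mult_mono Ediff B Q0, auto)
    qed measurable
    have L2: "I2 \<longlonglongrightarrow> (\<integral>\<omega>. E t \<omega> * g' (Zc t \<omega>) \<partial>P x)"
      unfolding I2_def
    proof (rule bounded_convergence[where B=B'])
      show "AE \<omega> in P x. (\<lambda>n. E (a n) \<omega> * g' (Zc (a n) \<omega>)) \<longlonglongrightarrow> E t \<omega> * g' (Zc t \<omega>)"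
        by (rule AE_I2, rule tendsto_mult) (use Elim Zlim[OF _ cg(2) at] in auto)
      show "AE \<omega> in P x. \<bar>E (a n) \<omega> * g' (Zc (a n) \<omega>)\<bar> \<le> B'" for n
        by (rule AE_I2) (unfold E_def, rule Ef_bound[OF B'])
    qed measurable
    have L3: "I3 \<longlonglongrightarrow> 0"
    proof (rule LIMSEQ_I)
      fix e :: real assume e: "0 < e"
      have "\<forall>\<^sub>F h in at_right 0. \<forall>y. dist ((T h g y - g y) / h) (g' y) < e / 2"
        using uniform_limitD[OF ul, of "e / 2"] e by simp
      then obtain d where d: "0 < d" "\<And>h y. 0 < h \<Longrightarrow> h < d \<Longrightarrow> dist ((T h g y - g y) / h) (g' y) < e / 2"
        unfolding eventually_at_right_field by auto
      obtain n0 where n0: "\<And>n. n \<ge> n0 \<Longrightarrow> \<bar>X n\<bar> < d"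
        using LIMSEQ_D[OF X0 d(1)] by auto
      have "\<bar>I3 n\<bar> < e" if "n \<ge> n0" for n
      proof -
        have Gg: "\<bar>G n y - g' y\<bar> \<le> e / 2" for y
          using d(2)[of "\<bar>X n\<bar>" y] n0[OF that] Xn[of n] by (simp add: G_def dist_real_def)
        have "continuous_on UNIV (\<lambda>y. G n y - g' y)"
          unfolding G_def by (intro continuous_intros cg) (use Xn in auto)
        from Ef_expectation_bound[OF this Gg, where t="a n" and s="a n" and x=x] show ?thesis
          using e by (simp add: I3_def E_def)
      qed
      then show "\<exists>n0. \<forall>n\<ge>n0. norm (I3 n - 0) < e" by auto
    qed
    have "(\<lambda>n. I1 n + I2 n + I3 n) \<longlonglongrightarrow>
       (\<integral>\<omega>. - q (Zc t \<omega>) * E t \<omega> * g (Zc t \<omega>) \<partial>P x) + (\<integral>\<omega>. E t \<omega> * g' (Zc t \<omega>) \<partial>P x) + 0"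
      by (intro tendsto_add L1 L2 L3)
    also have "(\<integral>\<omega>. - q (Zc t \<omega>) * E t \<omega> * g (Zc t \<omega>) \<partial>P x) + (\<integral>\<omega>. E t \<omega> * g' (Zc t \<omega>) \<partial>P x) + 0
        = (\<integral>\<omega>. E t \<omega> * (g' (Zc t \<omega>) - q (Zc t \<omega>) * g (Zc t \<omega>)) \<partial>P x)"
    proof -
      have "integrable (P x) (\<lambda>\<omega>. E t \<omega> * g' (Zc t \<omega>))"
        unfolding E_def by (rule Ef_integrable[OF cg(2) B'])
      moreover have "integrable (P x) (\<lambda>\<omega>. E t \<omega> * (q (Zc t \<omega>) * g (Zc t \<omega>)))"
        unfolding E_def
      proof (rule Ef_integrable[where f="\<lambda>y. q y * g y" and B="Q * B"])
        show "\<bar>q y * g y\<bar> \<le> Q * B" for y unfolding abs_mult by (intro mult_mono qQ' B Q0) auto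
      qed (intro continuous_intros q cg)
      ultimately show ?thesis by (simp add: right_diff_distrib mult.assoc mult.left_commute)
    qed
    finally show "((\<lambda>h. (\<rho> (t + h) - \<rho> t) / h) \<circ> X) \<longlonglongrightarrow>
       (\<integral>\<omega>. E t \<omega> * (g' (Zc t \<omega>) - q (Zc t \<omega>) * g (Zc t \<omega>)) \<partial>P x)"
      by (simp add: comp_def quot)
  qed
  moreover have "at 0 within {-t<..} = at 0" using t by (intro at_within_open) auto
  ultimately show ?thesis unfolding DERIV_def \<rho>_def E_def by simp
qed

text \<open>The derivative of \<open>E\<^sup>x [exp (- A\<^sub>t) g (Z\<^sub>t)]\<close> is integrated against \<open>expo l\<close>; the boundary term is the value
  at time \<open>0\<close>, namely \<open>g x\<close>.\<close>

lemma Feynman_Kac: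
  assumes core: "core g g'" and l: "0 < l"
  shows "R q l (\<lambda>y. l * g y - g' y + q y * g y) x = l * g x"
proof -
  interpret prob_space "P x" by (rule prob_P)
  have cg: "continuous_on UNIV g" "continuous_on UNIV g'" using core by (auto simp: core_def)
  obtain B where B: "\<And>y. \<bar>g y\<bar> \<le> B" using core by (auto simp: core_def bounded_iff)
  obtain B' where B': "\<And>y. \<bar>g' y\<bar> \<le> B'" using core by (auto simp: core_def bounded_iff)
  have Q0: "0 \<le> Q" using qQ'[of vertex] by linarith
  have qgB: "\<bar>g' y - q y * g y\<bar> \<le> B' + Q * B" for y
  proof -
    have "\<bar>q y * g y\<bar> \<le> Q * B" unfolding abs_mult by (intro mult_mono qQ' B Q0) auto
    with B'[of y] show ?thesis by linarith
  qed
  have cqg: "continuous_on UNIV (\<lambda>y. g' y - q y * g y)" by (intro continuous_intros cg q)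
  define \<rho> where "\<rho> t = (\<integral>\<omega>. exp (- Af q t \<omega>) * g (Zc t \<omega>) \<partial>P x)" for t
  define \<rho>' where "\<rho>' t = (\<integral>\<omega>. exp (- Af q t \<omega>) * (g' (Zc t \<omega>) - q (Zc t \<omega>) * g (Zc t \<omega>)) \<partial>P x)" for t
  have c\<rho>: "continuous_on UNIV \<rho>" unfolding \<rho>_def by (rule Ef_continuous[OF cg(1) B])
  have c\<rho>': "continuous_on UNIV \<rho>'" unfolding \<rho>'_def by (rule Ef_continuous[OF cqg qgB])
  have "(\<integral>t. \<rho>' t \<partial>expo l) = l * ((\<integral>t. \<rho> t \<partial>expo l) - \<rho> 0)"
  proof (rule expo_derivative[OF l])
    show "continuous_on {0..} \<rho>" "continuous_on {0<..} \<rho>'" using c\<rho> c\<rho>' by (auto intro: continuous_on_subset)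
    show "\<bar>\<rho> t\<bar> \<le> B" for t unfolding \<rho>_def by (rule Ef_expectation_bound[OF cg(1) B])
    show "\<rho> \<in> borel_measurable borel" by (rule borel_measurable_continuous_onI[OF c\<rho>])
    show "(\<rho> has_real_derivative \<rho>' t) (at t)" if "0 < t" for t
      unfolding \<rho>_def[abs_def] \<rho>'_def by (rule killed_semigroup_derivative[OF core that])
    show "integrable (expo l) \<rho>'" unfolding \<rho>'_def[abs_def] by (rule Ef_expo_integrable[OF l cqg qgB])
  qed
  then have "R q l (\<lambda>y. g' y - q y * g y) x = l * R q l g x - l * \<rho> 0"
    by (simp add: R_def \<rho>_def \<rho>'_def algebra_simps)
  moreover have "\<rho> 0 = g x"
  proof -
    have "\<rho> 0 = (\<integral>\<omega>. g x \<partial>P x)"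
      unfolding \<rho>_def
    proof (rule integral_cong_AE)
      show "AE \<omega> in P x. exp (- Af q 0 \<omega>) * g (Zc 0 \<omega>) = g x"
        using Z_0[of x] by eventually_elim (simp add: Zc_eq)
      show "(\<lambda>\<omega>. exp (- Af q 0 \<omega>) * g (Zc 0 \<omega>)) \<in> borel_measurable (P x)"
        using Ef_measurable[OF cg(1), of 0 0] by (simp del: Af_0)
    qed simp
    then show ?thesis using prob_space by simp
  qed
  moreover have "R q l (\<lambda>y. l * g y + (-1) * (g' y - q y * g y)) x = l * R q l g x + (-1) * R q l (\<lambda>y. g' y - q y * g y) x"
    by (rule R_linear[OF l cg(1) B cqg qgB])
  moreover have "(\<lambda>y. l * g y + (-1) * (g' y - q y * g y)) = (\<lambda>y. l * g y - g' y + q y * g y)"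
    by (simp add: fun_eq_iff)
  ultimately show ?thesis by simp
qed

end

end

section \<open>Occupation densities as limits of additive functionals\<close>

lemma measurable_expo [simp]: "measurable (expo l) N = measurable borel N"
  by (rule measurable_cong_sets) simp_all

lemma integral_expo_scale:
  fixes f :: "real \<Rightarrow> real"
  assumes f [measurable]: "f \<in> borel_measurable borel" and N: "0 < N"
  shows "(\<integral>r. f r \<partial>expo N) = (\<integral>v. f (v / N) \<partial>expo 1)"
proof -
  have "(\<integral>r. f r \<partial>expo N) = (\<integral>r. exponential_density N r * f r \<partial>lborel)"
    by (rule integral_expo[OF f N])
  also have "\<dots> = \<bar>1 / N\<bar> *\<^sub>R (\<integral>v. exponential_density N (0 + (1 / N) * v) * f (0 + (1 / N) * v) \<partial>lborel)"
    by (rule lborel_integral_real_affine) (use N in simp)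
  also have "\<dots> = (\<integral>v. exponential_density 1 v * f (v / N) \<partial>lborel)"
    using N
    by (subst integral_scaleR_right[symmetric], intro Bochner_Integration.integral_cong)
       (auto simp: exponential_density_def divide_less_0_iff)
  also have "\<dots> = (\<integral>v. f (v / N) \<partial>expo 1)"
    by (rule integral_expo[symmetric]) auto
  finally show ?thesis .
qed

lemma distributed_expo: "distributed (expo l) lborel (\<lambda>x. x) (\<lambda>x. ennreal (exponential_density l x))"
proof -
  have "distr (expo l) lborel (\<lambda>x. x) = expo l" by (rule distr_id2) simp
  then show ?thesis unfolding distributed_def by (simp add: expo_def)
qed

lemma emeasure_expo_greaterThan:
  assumes l: "0 < l" and z: "0 \<le> z"
  shows "emeasure (expo l) {z<..} = ennreal (exp (- l * z))"
proof -
  interpret prob_space "expo l" by (rule prob_space_expo[OF l])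
  from exponential_distributedD_gt[OF distributed_expo z l] show ?thesis
    unfolding emeasure_eq_measure
    by (simp add: greaterThan_def mult.commute)
qed

lemma expo_first_moment: "integrable (expo 1) (\<lambda>v. v)" "(\<integral>v. v \<partial>expo 1) = 1"
proof -
  interpret prob_space "expo 1" by (rule prob_space_expo) simp
  note D = distributed_expo[of 1]
  show "integrable (expo 1) (\<lambda>v. v)"
    using erlang_ith_moment_integrable[OF _ D, of 1] by simp
  show "(\<integral>v. v \<partial>expo 1) = 1"
    using exponential_distributed_expectation[OF _ D] by simp
qed

text \<open>\<open>exp (- N z)\<close> is the probability that an exponential variable of rate \<open>N\<close> exceeds \<open>z\<close>. Hence the integral
  is the mean of \<open>K N\<close> times the occupation time below \<open>v / N\<close>, for \<open>v\<close> exponential of rate \<open>1\<close>. This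
  tends to \<open>v * \<Lambda>\<close>, dominated by a multiple of \<open>v\<close>, and \<open>v\<close> has mean one.\<close>

lemma occupation_exponential_limit:
  fixes z :: "real \<Rightarrow> real" and K \<Lambda> t :: real
  assumes [measurable]: "z \<in> borel_measurable borel" and z0: "\<And>s. 0 \<le> z s" and t: "0 \<le> t"
    and lim: "((\<lambda>e. K / e * measure lborel {s \<in> {0..t}. z s < e}) \<longlongrightarrow> \<Lambda>) (at_right 0)"
    and K: "0 < K"
  shows "(\<lambda>n. \<integral>s. indicator {0..t} s * (K * real (Suc n) * exp (- real (Suc n) * z s)) \<partial>lborel) \<longlonglongrightarrow> \<Lambda>"
proof -
  interpret E1: prob_space "expo 1" by (rule prob_space_expo) simp
  define occ where "occ e = measure lborel {s \<in> {0..t}. z s < e}" for e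
  have occ_em: "ennreal (occ e) = emeasure lborel {s \<in> {0..t}. z s < e}" for e
  proof -
    have "emeasure lborel {s \<in> {0..t}. z s < e} \<le> emeasure lborel {0..t}"
      by (rule emeasure_mono) auto
    also have "\<dots> < \<infinity>" using t by simp
    finally show ?thesis unfolding occ_def by (subst emeasure_eq_ennreal_measure) auto
  qed
  have occ_em': "emeasure lborel {s \<in> {0..t}. z s < e} = (\<integral>\<^sup>+s. indicator {0..t} s * (if z s < e then 1 else 0) \<partial>lborel)" for e
  proof -
    have "emeasure lborel {s \<in> {0..t}. z s < e} = (\<integral>\<^sup>+s. indicator {s \<in> {0..t}. z s < e} s \<partial>lborel)"
      by simp
    also have "\<dots> = (\<integral>\<^sup>+s. indicator {0..t} s * (if z s < e then 1 else 0) \<partial>lborel)"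
      by (intro nn_integral_cong) (auto simp: indicator_def)
    finally show ?thesis .
  qed
  have occ_m [measurable]: "occ \<in> borel_measurable borel"
    unfolding occ_def[abs_def] measure_def occ_em' by measurable
  have occ_le: "0 \<le> occ e" "occ e \<le> t" for e
  proof -
    show "0 \<le> occ e" by (simp add: occ_def)
    have "occ e \<le> measure lborel {0..t}"
      unfolding occ_def by (rule measure_mono_fmeasurable) (auto intro: fmeasurable_compact)
    then show "occ e \<le> t" using t by simp
  qed
  have rep: "(\<integral>s. indicator {0..t} s * (K * N * exp (- N * z s)) \<partial>lborel) = (\<integral>v. K * N * occ (v / N) \<partial>expo 1)"
    if N: "0 < N" for N
  proof -
    interpret EN: prob_space "expo N" by (rule prob_space_expo[OF N])
    interpret pair_sigma_finite lborel "expo N" ..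
    have "(\<integral>\<^sup>+s. ennreal (indicator {0..t} s * exp (- N * z s)) \<partial>lborel) =
        (\<integral>\<^sup>+s. indicator {0..t} s * emeasure (expo N) {z s<..} \<partial>lborel)"
      by (intro nn_integral_cong) (auto simp: emeasure_expo_greaterThan[OF N z0] indicator_def)
    also have "\<dots> = (\<integral>\<^sup>+s. \<integral>\<^sup>+r. indicator {0..t} s * (if z s < r then 1 else 0) \<partial>expo N \<partial>lborel)"
      by (intro nn_integral_cong) (subst emeasure_greaterThan_eq_nn_integral, auto simp: nn_integral_cmult)
    also have "\<dots> = (\<integral>\<^sup>+r. \<integral>\<^sup>+s. indicator {0..t} s * (if z s < r then 1 else 0) \<partial>lborel \<partial>expo N)"
      by (rule Fubini'[symmetric]) measurable
    also have "\<dots> = (\<integral>\<^sup>+r. ennreal (occ r) \<partial>expo N)"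
      unfolding occ_em occ_em' ..
    finally have nn: "(\<integral>\<^sup>+s. ennreal (indicator {0..t} s * exp (- N * z s)) \<partial>lborel) = (\<integral>\<^sup>+r. ennreal (occ r) \<partial>expo N)" .
    have "(\<integral>s. indicator {0..t} s * exp (- N * z s) \<partial>lborel) = enn2real (\<integral>\<^sup>+s. ennreal (indicator {0..t} s * exp (- N * z s)) \<partial>lborel)"
      by (rule integral_eq_nn_integral) auto
    also have "\<dots> = (\<integral>r. occ r \<partial>expo N)"
      unfolding nn by (rule integral_eq_nn_integral[symmetric]) (auto simp: occ_le)
    also have "\<dots> = (\<integral>v. occ (v / N) \<partial>expo 1)"
      by (rule integral_expo_scale[OF occ_m N])
    finally have "K * N * (\<integral>s. indicator {0..t} s * exp (- N * z s) \<partial>lborel) = K * N * (\<integral>v. occ (v / N) \<partial>expo 1)"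
      by simp
    then show ?thesis
      by (simp add: mult.left_commute[of "indicator _ _"] del: integral_mult_right_zero flip: integral_mult_right_zero)
  qed
  have occ_lim: "((\<lambda>e. K / e * occ e) \<longlongrightarrow> \<Lambda>) (at_right 0)" using lim by (simp add: occ_def)
  obtain C where C: "\<And>e. 0 < e \<Longrightarrow> K * occ e \<le> C * e"
  proof -
    have "\<forall>\<^sub>F e in at_right 0. K / e * occ e < \<Lambda> + 1"
      by (rule order_tendstoD[OF occ_lim]) simp
    then obtain d where d: "0 < d" "\<And>e. 0 < e \<Longrightarrow> e < d \<Longrightarrow> K / e * occ e < \<Lambda> + 1"
      unfolding eventually_at_right_field by auto
    define C where "C = max (\<Lambda> + 1) (K * t / d)"
    have "K * occ e \<le> C * e" if e: "0 < e" for e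
    proof (cases "e < d")
      case True
      have "K * occ e = (K / e * occ e) * e" using e by simp
      also have "\<dots> \<le> C * e" using d(2)[OF e True] e by (intro mult_right_mono) (auto simp: C_def)
      finally show ?thesis .
    next
      case False
      have "K * occ e \<le> K * t" using occ_le K by simp
      also have "\<dots> = (K * t / d) * d" using d by simp
      also have "\<dots> \<le> C * e" using False d K t by (intro mult_mono) (auto simp: C_def le_max_iff_disj)
      finally show ?thesis .
    qed
    then show ?thesis by (rule that)
  qed
  have "(\<lambda>n. \<integral>v. K * real (Suc n) * occ (v / real (Suc n)) \<partial>expo 1) \<longlonglongrightarrow> (\<integral>v. v * \<Lambda> \<partial>expo 1)"
  proof (rule integral_dominated_convergence[where w="\<lambda>v. C * v"])
    show "integrable (expo 1) (\<lambda>v. C * v)" using expo_first_moment(1) by simp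
    show "AE v in expo 1. (\<lambda>n. K * real (Suc n) * occ (v / real (Suc n))) \<longlonglongrightarrow> v * \<Lambda>"
      using AE_expo_pos[of 1]
    proof eventually_elim
      case (elim v)
      have "filterlim (\<lambda>n. v / real (Suc n)) (at_right 0) sequentially"
        unfolding filterlim_at
      proof (intro conjI)
        show "(\<lambda>n. v / real (Suc n)) \<longlonglongrightarrow> 0"
          using tendsto_mult[OF tendsto_const[of v] LIMSEQ_inverse_real_of_nat] by (simp add: divide_inverse)
      qed (use elim in auto)
      from tendsto_mult[OF tendsto_const[of v] filterlim_compose[OF occ_lim this]]
      show ?case using elim by (simp add: divide_simps mult.assoc)
    qed
    show "AE v in expo 1. norm (K * real (Suc n) * occ (v / real (Suc n))) \<le> C * v" for n
      using AE_expo_pos[of 1]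
    proof eventually_elim
      case (elim v)
      have "K * occ (v / real (Suc n)) \<le> C * (v / real (Suc n))" using elim by (intro C) simp
      then have "real (Suc n) * (K * occ (v / real (Suc n))) \<le> real (Suc n) * (C * (v / real (Suc n)))"
        by (intro mult_left_mono) auto
      moreover have "real (Suc n) * (C * (v / real (Suc n))) = C * v" by simp
      moreover have "0 \<le> K * real (Suc n) * occ (v / real (Suc n))" using K occ_le by (intro mult_nonneg_nonneg) auto
      ultimately show ?case by (simp add: mult_ac del: of_nat_Suc)
    qed
  qed measurable
  moreover have "(\<integral>v. v * \<Lambda> \<partial>expo 1) = \<Lambda>" using expo_first_moment by simp
  ultimately show ?thesis by (simp only: rep[OF of_nat_0_less_iff[THEN iffD2, OF zero_less_Suc]])
qed

section \<open>The resolvent killed by the local time at the vertex\<close>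

text \<open>\<open>K\<close> is the unknown constant in the occupation density; it turns out to be \<open>1/2\<close>.\<close>

locale star_BM_local_time = star_BM p M P Z
  for p :: "'n::finite \<Rightarrow> real" and M :: "'w measure" and P and Z +
  fixes L :: "real \<Rightarrow> 'w \<Rightarrow> real" and K :: real
  assumes L_measurable: "\<And>t. 0 \<le> t \<Longrightarrow> L t \<in> borel_measurable M"
    and L_0: "\<And>\<omega>. \<omega> \<in> space M \<Longrightarrow> L 0 \<omega> = 0"
    and L_mono: "\<And>\<omega>. \<omega> \<in> space M \<Longrightarrow> mono_on {0..} (\<lambda>t. L t \<omega>)"
    and L_continuous: "\<And>\<omega>. \<omega> \<in> space M \<Longrightarrow> continuous_on {0..} (\<lambda>t. L t \<omega>)"
    and K_pos: "0 < K"
    and occupation: "\<And>x. AE \<omega> in P x. \<forall>t\<ge>0.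
       ((\<lambda>e. K / e * measure lborel {s \<in> {0..t}. dist (Z s \<omega>) vertex < e}) \<longlongrightarrow> L t \<omega>) (at_right 0)"
    and norm: "local_time_normalized P Z L"
begin

definition Lc :: "real \<Rightarrow> 'w \<Rightarrow> real" where "Lc t = L (max 0 t)"

lemma Lc_eq: "0 \<le> t \<Longrightarrow> Lc t = L t"
  by (simp add: Lc_def max_def)

lemma Lc_measurable [measurable]: "Lc t \<in> borel_measurable M"
  by (simp add: Lc_def L_measurable)

lemma Lc_continuous: "\<omega> \<in> space M \<Longrightarrow> continuous_on UNIV (\<lambda>t. Lc t \<omega>)"
  unfolding Lc_def by (rule continuous_on_compose2[OF L_continuous]) (auto intro!: continuous_intros)

lemma Lc_nonneg: "\<omega> \<in> space M \<Longrightarrow> 0 \<le> Lc t \<omega>"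
  using mono_onD[OF L_mono[of \<omega>], of 0 "max 0 t"] L_0[of \<omega>] unfolding Lc_def by simp

text \<open>Killing rates concentrating at the vertex, scaled so that their additive functionals tend to
  \<open>a\<close> times the local time.\<close>

definition qn :: "real \<Rightarrow> nat \<Rightarrow> 'n star \<Rightarrow> real" where
  "qn a n y = a * K * real (Suc n) * exp (- real (Suc n) * dist y vertex)"

lemma qn_continuous: "continuous_on UNIV (qn a n)"
  unfolding qn_def[abs_def] by (intro continuous_intros)

lemma qn_nonneg: "0 \<le> a \<Longrightarrow> 0 \<le> qn a n y"
  using K_pos by (simp add: qn_def)

lemma qn_le: "0 \<le> a \<Longrightarrow> qn a n y \<le> a * K * real (Suc n)"
proof -
  assume a: "0 \<le> a"
  have "exp (- real (Suc n) * dist y vertex) \<le> 1"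
    unfolding exp_le_one_iff by (intro mult_nonpos_nonneg) auto
  then show ?thesis unfolding qn_def using a K_pos by (intro mult_left_le) auto
qed

lemma Af_qn_limit:
  "AE \<omega> in P x. \<forall>t. (\<lambda>n. Af (qn a n) t \<omega>) \<longlonglongrightarrow> a * Lc t \<omega>"
  using occupation[of x] AE_space
proof eventually_elim
  case (elim \<omega>)
  then have \<omega>: "\<omega> \<in> space M" by simp
  have pos: "(\<lambda>n. Af (qn a n) t \<omega>) \<longlonglongrightarrow> a * Lc t \<omega>" if t: "0 \<le> t" for t
  proof -
    have zm: "(\<lambda>s. dist (Zc s \<omega>) vertex) \<in> borel_measurable borel"
      by (intro borel_measurable_continuous_onI Zc_compose_continuous[OF \<omega>, of "\<lambda>y. dist y vertex"] borel_measurable_continuous_onI continuous_intros)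
    have "{s \<in> {0..t}. dist (Zc s \<omega>) vertex < e} = {s \<in> {0..t}. dist (Z s \<omega>) vertex < e}" for e
      by (auto simp: Zc_eq)
    with elim t have "((\<lambda>e. K / e * measure lborel {s \<in> {0..t}. dist (Zc s \<omega>) vertex < e}) \<longlongrightarrow> L t \<omega>) (at_right 0)"
      by simp
    from tendsto_mult[OF tendsto_const[of a] occupation_exponential_limit[OF zm _ t this K_pos]]
    show ?thesis
      using t by (simp add: Af_def qn_def Lc_eq mult_ac del: of_nat_Suc integral_mult_right_zero flip: integral_mult_right_zero)
  qed
  show ?case
  proof
    fix t show "(\<lambda>n. Af (qn a n) t \<omega>) \<longlonglongrightarrow> a * Lc t \<omega>"
    proof (cases "0 \<le> t")
      case True then show ?thesis by (rule pos)
    next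
      case False
      then show ?thesis using L_0[OF \<omega>] by (simp add: Lc_def)
    qed
  qed
qed

text \<open>\<open>l\<close> times the \<open>l\<close>-resolvent of the process killed at rate \<open>a\<close> by its local time at the vertex.\<close>

definition Ra :: "real \<Rightarrow> real \<Rightarrow> ('n star \<Rightarrow> real) \<Rightarrow> 'n star \<Rightarrow> real" where
  "Ra a l f x = (\<integral>t. \<integral>\<omega>. exp (- a * Lc t \<omega>) * f (Zc t \<omega>) \<partial>P x \<partial>expo l)"

lemma La_bound:
  assumes "0 \<le> a" "\<omega> \<in> space M" and B: "\<And>y. \<bar>f y\<bar> \<le> B"
  shows "\<bar>exp (- a * Lc t \<omega>) * f y\<bar> \<le> B"
proof -
  have "exp (- a * Lc t \<omega>) \<le> 1" using assms Lc_nonneg[of \<omega> t] by simp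
  then show ?thesis
    using mult_mono[of "exp (- a * Lc t \<omega>)" 1 "\<bar>f y\<bar>" B] B[of y] by (simp add: abs_mult)
qed

lemma La_measurable: 
  assumes "continuous_on UNIV f"
  shows "(\<lambda>\<omega>. exp (- a * Lc t \<omega>) * f (Zc s \<omega>)) \<in> borel_measurable M"
  using Zc_compose_measurable[OF assms, of s] by measurable

lemma La_continuous:
  assumes a: "0 \<le> a" and f: "continuous_on UNIV f" and B: "\<And>y. \<bar>f y\<bar> \<le> B"
  shows "continuous_on UNIV (\<lambda>t. \<integral>\<omega>. exp (- a * Lc t \<omega>) * f (Zc t \<omega>) \<partial>P x)"
proof -
  interpret prob_space "P x" by (rule prob_P)
  show ?thesis
  proof (rule continuous_on_integral_bounded)
    show "continuous_on UNIV (\<lambda>t. exp (- a * Lc t \<omega>) * f (Zc t \<omega>))" if "\<omega> \<in> space (P x)" for \<omega>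
      using that by (intro continuous_intros Zc_compose_continuous f Lc_continuous) auto
    show "\<bar>exp (- a * Lc t \<omega>) * f (Zc t \<omega>)\<bar> \<le> B" if "\<omega> \<in> space (P x)" for t \<omega>
      using that La_bound[OF a _ B] by simp
  qed (use La_measurable[OF f] in auto)
qed

lemma La_expectation_bound:
  assumes a: "0 \<le> a" and f: "continuous_on UNIV f" and B: "\<And>y. \<bar>f y\<bar> \<le> B"
  shows "\<bar>\<integral>\<omega>. exp (- a * Lc t \<omega>) * f (Zc t \<omega>) \<partial>P x\<bar> \<le> B"
proof -
  interpret prob_space "P x" by (rule prob_P)
  have i: "integrable (P x) (\<lambda>\<omega>. exp (- a * Lc t \<omega>) * f (Zc t \<omega>))"
    by (rule integrable_const_bound[where B=B], rule AE_I2) (use La_measurable[OF f] La_bound[OF a _ B] in auto)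
  have "\<bar>\<integral>\<omega>. exp (- a * Lc t \<omega>) * f (Zc t \<omega>) \<partial>P x\<bar> \<le> (\<integral>\<omega>. \<bar>exp (- a * Lc t \<omega>) * f (Zc t \<omega>)\<bar> \<partial>P x)"
    using integral_norm_bound by auto
  also have "\<dots> \<le> (\<integral>\<omega>. B \<partial>P x)"
    by (rule integral_mono) (use i La_bound[OF a _ B] in auto)
  also have "\<dots> = B" using prob_space by simp
  finally show ?thesis .
qed

lemma R_qn_limit:
  assumes a: "0 \<le> a" and l: "0 < l" and f: "continuous_on UNIV f" and B: "\<And>y. \<bar>f y\<bar> \<le> B"
  shows "(\<lambda>n. R (qn a n) l f x) \<longlonglongrightarrow> Ra a l f x"
proof -
  interpret Px: prob_space "P x" by (rule prob_P)
  interpret El: prob_space "expo l" by (rule prob_space_expo[OF l])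
  note q = qn_continuous qn_nonneg[OF a] qn_le[OF a]
  show ?thesis
    unfolding R_def Ra_def
  proof (rule El.bounded_convergence[where B=B])
    show "(\<lambda>t. \<integral>\<omega>. exp (- Af (qn a n) t \<omega>) * f (Zc t \<omega>) \<partial>P x) \<in> borel_measurable (expo l)" for n
      using borel_measurable_continuous_onI[OF Ef_continuous[OF q f B]] by simp
    show "(\<lambda>t. \<integral>\<omega>. exp (- a * Lc t \<omega>) * f (Zc t \<omega>) \<partial>P x) \<in> borel_measurable (expo l)"
      using borel_measurable_continuous_onI[OF La_continuous[OF a f B]] by simp
    show "AE t in expo l. \<bar>\<integral>\<omega>. exp (- Af (qn a n) t \<omega>) * f (Zc t \<omega>) \<partial>P x\<bar> \<le> B" for n
      by (rule AE_I2) (rule Ef_expectation_bound[OF q f B])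
    show "AE t in expo l. (\<lambda>n. \<integral>\<omega>. exp (- Af (qn a n) t \<omega>) * f (Zc t \<omega>) \<partial>P x)
        \<longlonglongrightarrow> (\<integral>\<omega>. exp (- a * Lc t \<omega>) * f (Zc t \<omega>) \<partial>P x)"
    proof (rule AE_I2, rule Px.bounded_convergence[where B=B])
      fix t
      show "(\<lambda>\<omega>. exp (- Af (qn a n) t \<omega>) * f (Zc t \<omega>)) \<in> borel_measurable (P x)" for n
        using Ef_measurable[OF q f] by simp
      show "(\<lambda>\<omega>. exp (- a * Lc t \<omega>) * f (Zc t \<omega>)) \<in> borel_measurable (P x)"
        using La_measurable[OF f] by simp
      show "AE \<omega> in P x. (\<lambda>n. exp (- Af (qn a n) t \<omega>) * f (Zc t \<omega>)) \<longlonglongrightarrow> exp (- a * Lc t \<omega>) * f (Zc t \<omega>)"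
        using Af_qn_limit[of a x]
      proof eventually_elim
        case (elim \<omega>)
        from spec[OF this, of t] show ?case by (auto intro!: tendsto_intros)
      qed
      show "AE \<omega> in P x. \<bar>exp (- Af (qn a n) t \<omega>) * f (Zc t \<omega>)\<bar> \<le> B" for n
        by (rule AE_I2) (rule Ef_bound[OF q B])
    qed
  qed
qed

text \<open>Either the exponential time comes first or the killing does. This is the Feynman-Kac identity
  for the constant function.\<close>

lemma R_1_plus_R_q:
  assumes q: "continuous_on UNIV q" "\<And>y. 0 \<le> q y" "\<And>y. q y \<le> Q" and l: "0 < l"
  shows "R q l q x = l * (1 - R q l (\<lambda>_. 1) x)"
proof -
  have "R q l (\<lambda>y. l * 1 - 0 + q y * 1) x = l * 1"
    by (rule Feynman_Kac[OF q core_const l])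
  moreover have "R q l (\<lambda>y. l * 1 + 1 * q y) x = l * R q l (\<lambda>_. 1) x + 1 * R q l q x"
    by (rule R_linear[OF q l _ _ q(1), of "\<lambda>_. 1" 1 Q]) (use q in auto)
  ultimately show ?thesis by (simp add: algebra_simps)
qed

lemma R_qn_mass_limit:
  assumes a: "0 \<le> a" and l: "0 < l"
  shows "(\<lambda>n. R (qn a n) l (qn a n) x) \<longlonglongrightarrow> l * (1 - Ra a l (\<lambda>_. 1) x)"
  unfolding R_1_plus_R_q[OF qn_continuous qn_nonneg[OF a] qn_le[OF a] l]
  by (intro tendsto_intros R_qn_limit[OF a l, where B=1]) auto

text \<open>The total mass of \<open>f \<mapsto> R (qn a n) l (qn a n * f) x\<close> is at most \<open>l\<close>, and outside any neighbourhood of the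
  vertex \<open>qn a n\<close> tends to zero uniformly.\<close>

lemma R_qn_concentration:
  assumes a: "0 \<le> a" and l: "0 < l"
    and \<psi>: "\<And>n. continuous_on UNIV (\<psi> n)" "\<And>n y. \<bar>\<psi> n y\<bar> \<le> C"
    and small: "\<And>\<eta>. 0 < \<eta> \<Longrightarrow> \<exists>\<delta>>0. \<forall>\<^sub>F n in sequentially. \<forall>y. dist y vertex \<le> \<delta> \<longrightarrow> \<bar>\<psi> n y\<bar> \<le> \<eta>"
  shows "(\<lambda>n. R (qn a n) l (\<lambda>y. qn a n y * \<psi> n y) x) \<longlonglongrightarrow> 0"
proof (rule LIMSEQ_I)
  fix e :: real assume e: "0 < e"
  have C0: "0 \<le> C" using \<psi>(2)[of 0 vertex] by linarith
  define \<eta> where "\<eta> = e / (2 * l)"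
  have \<eta>: "0 < \<eta>" using e l by (simp add: \<eta>_def)
  from small[OF \<eta>] obtain \<delta> where \<delta>: "0 < \<delta>"
    "\<forall>\<^sub>F n in sequentially. \<forall>y. dist y vertex \<le> \<delta> \<longrightarrow> \<bar>\<psi> n y\<bar> \<le> \<eta>" by blast
  define c where "c n = C * (a * K * real (Suc n) * exp (- real (Suc n) * \<delta>))" for n
  have c0: "0 \<le> c n" for n using C0 a K_pos by (simp add: c_def)
  have "(\<lambda>n. c n) \<longlonglongrightarrow> C * (a * K * 0)"
  proof -
    have "(\<lambda>n. real (Suc n) * exp (- real (Suc n) * \<delta>)) \<longlonglongrightarrow> 0"
    proof -
      have e1: "exp (- real (Suc n) * \<delta>) = exp (- \<delta>) ^ Suc n" for n
        by (simp only: exp_of_nat_mult[symmetric] mult_minus_left mult_minus_right)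
      have "(\<lambda>n. real n * exp (- \<delta>) ^ n) \<longlonglongrightarrow> 0"
        by (rule powser_times_n_limit_0) (use \<delta> in simp)
      from LIMSEQ_Suc[OF this] show ?thesis unfolding e1 .
    qed
    from tendsto_mult[OF tendsto_const[of C] tendsto_mult[OF tendsto_const[of "a * K"] this]]
    show ?thesis by (simp add: c_def mult.assoc)
  qed
  then have "\<forall>\<^sub>F n in sequentially. c n < e / 2" using e by (intro order_tendstoD(2)[of _ 0]) auto
  with \<delta>(2) have "\<forall>\<^sub>F n in sequentially. norm (R (qn a n) l (\<lambda>y. qn a n y * \<psi> n y) x - 0) < e"
  proof eventually_elim
    case (elim n)
    note q = qn_continuous[of a n] qn_nonneg[OF a, of n] qn_le[OF a, of n]
    have q': "\<bar>qn a n y\<bar> \<le> a * K * real (Suc n)" for y using q(2)[of y] q(3)[of y] by simp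
    have le: "\<bar>qn a n y * \<psi> n y\<bar> \<le> \<eta> * qn a n y + c n * 1" for y
    proof (cases "dist y vertex \<le> \<delta>")
      case True
      then have "qn a n y * \<bar>\<psi> n y\<bar> \<le> qn a n y * \<eta>" using elim q by (intro mult_left_mono) auto
      then show ?thesis using q(2)[of y] c0[of n] by (simp add: abs_mult mult.commute)
    next
      case False
      have "qn a n y \<le> a * K * real (Suc n) * exp (- real (Suc n) * \<delta>)"
        unfolding qn_def using False a K_pos by (intro mult_left_mono) auto
      then have "qn a n y * \<bar>\<psi> n y\<bar> \<le> a * K * real (Suc n) * exp (- real (Suc n) * \<delta>) * C"
        using q(2)[of y] \<psi>(2)[of n y] C0 by (intro mult_mono) (auto intro: order_trans)
      moreover have "0 \<le> \<eta> * qn a n y" using \<eta> q(2)[of y] by simp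
      ultimately show ?thesis using q(2)[of y] by (simp add: abs_mult c_def mult_ac del: of_nat_Suc)
    qed
    define D where "D = \<eta> * (a * K * real (Suc n)) + c n"
    have D: "\<bar>\<eta> * qn a n y + c n * 1\<bar> \<le> D" for y
    proof -
      have "\<eta> * qn a n y \<le> \<eta> * (a * K * real (Suc n))" using q(3)[of y] \<eta> by (intro mult_left_mono) auto
      moreover have "0 \<le> \<eta> * qn a n y" using \<eta> q(2)[of y] by simp
      ultimately show ?thesis using c0[of n] by (simp add: D_def)
    qed
    have le': "\<bar>qn a n y * \<psi> n y\<bar> \<le> D" for y using le[of y] D[of y] by linarith
    have cont: "continuous_on UNIV (\<lambda>y. qn a n y * \<psi> n y)" "continuous_on UNIV (\<lambda>y. \<eta> * qn a n y + c n * 1)"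
      "continuous_on UNIV (\<lambda>y. - 1 * (qn a n y * \<psi> n y))"
      by (intro continuous_intros q \<psi>)+
    have up: "R (qn a n) l (\<lambda>y. \<eta> * qn a n y + c n * 1) x \<le> \<eta> * l + c n"
    proof -
      have "R (qn a n) l (\<lambda>y. \<eta> * qn a n y + c n * 1) x = \<eta> * R (qn a n) l (qn a n) x + c n * R (qn a n) l (\<lambda>_. 1) x"
        by (rule R_linear[OF q l q(1) q', where C=1]) auto
      moreover have "0 \<le> R (qn a n) l (\<lambda>_. 1) x"
        unfolding R_def by (intro Bochner_Integration.integral_nonneg) auto
      moreover have "R (qn a n) l (\<lambda>_. 1) x \<le> 1"
        using R_bound[OF q l, of "\<lambda>_. 1" 1 x] by auto
      moreover have "R (qn a n) l (qn a n) x \<le> l"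
        unfolding R_1_plus_R_q[OF q l] using l calculation by simp
      ultimately show ?thesis
        using \<eta> c0[of n] by (simp add: add_mono mult_left_mono mult_left_le)
    qed
    have "R (qn a n) l (\<lambda>y. qn a n y * \<psi> n y) x \<le> R (qn a n) l (\<lambda>y. \<eta> * qn a n y + c n * 1) x"
      by (rule R_mono[OF q l cont(1) le' cont(2) D]) (use le in \<open>auto simp: abs_le_iff\<close>)
    moreover have "R (qn a n) l (\<lambda>y. - 1 * (qn a n y * \<psi> n y)) x \<le> R (qn a n) l (\<lambda>y. \<eta> * qn a n y + c n * 1) x"
      by (rule R_mono[OF q l cont(3) _ cont(2) D, where B=D]) (use le le' in \<open>auto simp: abs_le_iff\<close>)
    moreover have "R (qn a n) l (\<lambda>y. - 1 * (qn a n y * \<psi> n y)) x = - R (qn a n) l (\<lambda>y. qn a n y * \<psi> n y) x"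
      unfolding R_def by simp
    moreover have "\<eta> * l = e / 2" using l by (simp add: \<eta>_def)
    ultimately show ?case using up elim by simp
  qed
  then show "\<exists>n0. \<forall>n\<ge>n0. norm (R (qn a n) l (\<lambda>y. qn a n y * \<psi> n y) x - 0) < e"
    by (simp add: eventually_sequentially)
qed

text \<open>The limit of the Feynman-Kac identity with rate \<open>qn a n\<close>: the term \<open>q g\<close> only sees the value of \<open>g\<close> at
  the vertex, and its mass is \<open>l\<close> times the probability \<open>1 - Ra a l 1\<close> of being killed before the
  exponential time.\<close>

lemma Ra_core:
  assumes a: "0 \<le> a" and l: "0 < l" and core: "core g g'"
    and f: "\<And>y. l * g y - g' y = l * f y"
  shows "Ra a l f x = g x - g vertex * (1 - Ra a l (\<lambda>_. 1) x)"
proof -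
  have cg: "continuous_on UNIV g" "continuous_on UNIV g'" using core by (auto simp: core_def)
  obtain B where B: "\<And>y. \<bar>g y\<bar> \<le> B" using core by (auto simp: core_def bounded_iff)
  obtain B' where B': "\<And>y. \<bar>g' y\<bar> \<le> B'" using core by (auto simp: core_def bounded_iff)
  have B0: "0 \<le> B" using B[of vertex] by linarith
  have feq: "f = (\<lambda>y. g y - g' y / l)"
  proof
    fix y show "f y = g y - g' y / l" using f[of y] l by (simp add: field_simps)
  qed
  have cf: "continuous_on UNIV f" unfolding feq by (intro continuous_intros cg) (use l in auto)
  have Bf: "\<bar>f y\<bar> \<le> B + B' / l" for y
  proof -
    have "\<bar>g' y / l\<bar> \<le> B' / l" using B'[of y] l by (simp add: abs_divide divide_right_mono)
    then show ?thesis unfolding feq using B[of y] by linarith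
  qed
  define \<psi> where "\<psi> y = g y - g vertex" for y
  have c\<psi>: "continuous_on UNIV \<psi>" unfolding \<psi>_def by (intro continuous_intros cg)
  have B\<psi>: "\<bar>\<psi> y\<bar> \<le> 2 * B" for y using B[of y] B[of vertex] by (simp add: \<psi>_def)
  have "(\<lambda>n. l * R (qn a n) l f x + (g vertex * R (qn a n) l (qn a n) x + R (qn a n) l (\<lambda>y. qn a n y * \<psi> y) x))
      \<longlonglongrightarrow> l * Ra a l f x + (g vertex * (l * (1 - Ra a l (\<lambda>_. 1) x)) + 0)"
  proof (intro tendsto_add tendsto_mult tendsto_const R_qn_limit[OF a l cf Bf] R_qn_mass_limit[OF a l]
      R_qn_concentration[OF a l c\<psi> B\<psi>])
    fix \<eta> :: real assume "0 < \<eta>"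
    then obtain d where d: "0 < d" "\<And>y. dist y vertex < d \<Longrightarrow> dist (g y) (g vertex) < \<eta>"
      using cg(1) unfolding continuous_on_iff by (metis UNIV_I)
    show "\<exists>\<delta>>0. \<forall>\<^sub>F n in sequentially. \<forall>y. dist y vertex \<le> \<delta> \<longrightarrow> \<bar>\<psi> y\<bar> \<le> \<eta>"
    proof (intro exI[of _ "d / 2"] conjI always_eventually allI impI)
      fix y :: "'n star" assume "dist y vertex \<le> d / 2"
      with d have "dist (g y) (g vertex) < \<eta>" by (intro d(2)) linarith
      then show "\<bar>\<psi> y\<bar> \<le> \<eta>" by (simp add: \<psi>_def dist_real_def)
    qed (use d in simp)
  qed
  moreover have "l * R (qn a n) l f x + (g vertex * R (qn a n) l (qn a n) x + R (qn a n) l (\<lambda>y. qn a n y * \<psi> y) x) = l * g x" for n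
  proof -
    note q = qn_continuous[of a n] qn_nonneg[OF a, of n] qn_le[OF a, of n]
    let ?Q = "a * K * real (Suc n)"
    have Q0: "0 \<le> ?Q" using a K_pos by simp
    have q': "\<bar>qn a n y\<bar> \<le> ?Q" for y using q(2)[of y] q(3)[of y] by simp
    have q\<psi>: "continuous_on UNIV (\<lambda>y. qn a n y * \<psi> y)" "\<And>y. \<bar>qn a n y * \<psi> y\<bar> \<le> ?Q * (2 * B)"
      unfolding abs_mult by (intro continuous_intros q c\<psi>, intro mult_mono q' B\<psi> Q0, simp)
    have qg: "continuous_on UNIV (\<lambda>y. g vertex * qn a n y + 1 * (qn a n y * \<psi> y))"
      by (intro continuous_intros q c\<psi>)
    have qgB: "\<bar>g vertex * qn a n y + 1 * (qn a n y * \<psi> y)\<bar> \<le> B * ?Q + ?Q * (2 * B)" for y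
    proof -
      have "\<bar>g vertex * qn a n y\<bar> \<le> B * ?Q" unfolding abs_mult by (intro mult_mono B q' B0) simp
      then show ?thesis using q\<psi>(2)[of y] by linarith
    qed
    have "l * g x = R (qn a n) l (\<lambda>y. l * g y - g' y + qn a n y * g y) x"
      by (rule Feynman_Kac[OF q core l, symmetric])
    also have "(\<lambda>y. l * g y - g' y + qn a n y * g y) = (\<lambda>y. l * f y + 1 * (g vertex * qn a n y + 1 * (qn a n y * \<psi> y)))"
      by (simp add: fun_eq_iff f \<psi>_def algebra_simps)
    also have "R (qn a n) l \<dots> x = l * R (qn a n) l f x + 1 * R (qn a n) l (\<lambda>y. g vertex * qn a n y + 1 * (qn a n y * \<psi> y)) x"
      by (rule R_linear[OF q l cf Bf qg qgB])
    also have "R (qn a n) l (\<lambda>y. g vertex * qn a n y + 1 * (qn a n y * \<psi> y)) x =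
       g vertex * R (qn a n) l (qn a n) x + 1 * R (qn a n) l (\<lambda>y. qn a n y * \<psi> y) x"
      by (rule R_linear[OF q l q(1) q' q\<psi>])
    finally show ?thesis by simp
  qed
  ultimately have "l * g x = l * Ra a l f x + (g vertex * (l * (1 - Ra a l (\<lambda>_. 1) x)) + 0)"
    by (simp add: LIMSEQ_const_iff)
  then have "l * (g x) = l * (Ra a l f x + g vertex * (1 - Ra a l (\<lambda>_. 1) x))" by (simp add: algebra_simps)
  then show ?thesis using l by simp
qed

text \<open>The function \<open>exp (- s |x|)\<close> has slope \<open>- s\<close> at the vertex and so violates the vertex condition;
  subtracting \<open>s / N * exp (- N |x|)\<close> makes all slopes zero at a vanishing cost in the supremum norm.\<close>

lemma radial_exponential_core:
  fixes s N :: real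
  assumes s: "0 < s" and N: "0 < N"
  defines "g \<equiv> \<lambda>y :: 'n star. exp (- s * dist y vertex) - s / N * exp (- N * dist y vertex)"
  shows "core g (\<lambda>y. 1/2 * (s\<^sup>2 * exp (- s * dist y vertex) - s * N * exp (- N * dist y vertex)))"
proof (rule core_domain)
  let ?h = "\<lambda>y :: 'n star. s\<^sup>2 * exp (- s * dist y vertex) - s * N * exp (- N * dist y vertex)"
  let ?f1 = "\<lambda>r. - s * exp (- s * r) + s * exp (- N * r)"
  have gC: "g \<in> C0"
    using C0_add[OF exp_dist_C0[OF s] exp_dist_C0[OF N], of 1 "- (s / N)"] by (simp add: g_def)
  have hC: "?h \<in> C0"
    using C0_add[OF exp_dist_C0[OF s] exp_dist_C0[OF N], of "s\<^sup>2" "- (s * N)"] by simp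
  have d1: "((\<lambda>r. g (pt j r)) has_real_derivative ?f1 r) (at r)" if r: "0 < r" for j :: 'n and r
  proof -
    have "((\<lambda>r. exp (- s * r) - s / N * exp (- N * r)) has_real_derivative ?f1 r) (at r)"
      using N by (auto intro!: derivative_eq_intros)
    moreover have "\<forall>\<^sub>F r in nhds r. exp (- s * r) - s / N * exp (- N * r) = g (pt j r)"
      using eventually_nhds_in_open[of "{0<..}" r] r by (auto elim!: eventually_mono simp: g_def)
    ultimately show ?thesis by (subst (asm) DERIV_cong_ev[OF refl _ refl]) 
  qed
  have d2: "(?f1 has_real_derivative ?h (pt j r)) (at r)" if "0 < r" for j :: 'n and r
    using that by (auto intro!: derivative_eq_intros simp: power2_eq_square)
  have v: "(?f1 \<longlongrightarrow> 0) (at_right 0)"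
    by (auto intro!: tendsto_eq_intros)
  show "g \<in> star_domain p" "second_deriv_ext g ?h"
    using star_domainI[of g ?h "\<lambda>_. ?f1" "\<lambda>_. 0", OF gC hC d1 d2 v] by auto
qed

text \<open>For the function \<open>g\<close> of the preceding lemma, \<open>l g - 1/2 g''\<close> is \<open>c\<^sub>n * qn a n\<close> with \<open>c\<^sub>n\<close> tending to
  \<open>s / (2 a K)\<close>. So the Feynman-Kac identity expresses \<open>exp (- s |x|)\<close>, in the limit, as
  \<open>s / (2 a K) + 1\<close> times the probability of being killed.\<close>

lemma one_minus_Ra_one_K:
  assumes a: "0 < a" and l: "0 < l"
  defines "s \<equiv> sqrt (2 * l)"
  shows "1 - Ra a l (\<lambda>_. 1) x = exp (- s * dist x vertex) * (2 * a * K / (s + 2 * a * K))"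
proof -
  have s: "0 < s" "s\<^sup>2 = 2 * l" using l by (auto simp: s_def)
  have a0: "0 \<le> a" using a by simp
  define N where "N n = real (Suc n)" for n
  have N: "0 < N n" for n by (simp add: N_def)
  define g where "g n y = exp (- s * dist y vertex) - s / N n * exp (- N n * dist y vertex)" for n and y :: "'n star"
  define g' where "g' n y = 1/2 * (s\<^sup>2 * exp (- s * dist y vertex) - s * N n * exp (- N n * dist y vertex))" for n and y :: "'n star"
  define \<psi> where "\<psi> n y = g n y - 1" for n y
  have core: "core (g n) (g' n)" for n
    using radial_exponential_core[OF s(1) N[of n]] by (simp add: g_def[abs_def] g'_def[abs_def])
  have Ninf: "(\<lambda>n. 1 / N n) \<longlonglongrightarrow> 0"
    using LIMSEQ_inverse_real_of_nat by (simp add: N_def inverse_eq_divide)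
  define c where "c n = s / (2 * a * K) * (1 - s\<^sup>2 * (1 / N n) * (1 / N n))" for n
  have clim: "c \<longlonglongrightarrow> s / (2 * a * K) * (1 - s\<^sup>2 * 0 * 0)"
    unfolding c_def by (intro tendsto_intros Ninf)
  have lg: "l * g n y - g' n y = c n * qn a n y" for n y
  proof -
    have lss: "l = s * s / 2" using s(2) by (simp add: power2_eq_square)
    have "l * (e1 - s / N n * e2) - 1/2 * (s\<^sup>2 * e1 - s * N n * e2) = c n * (a * K * N n * e2)" for e1 e2
      using N[of n] a K_pos unfolding lss c_def by (simp add: field_simps power2_eq_square)
    then show ?thesis unfolding g_def g'_def qn_def N_def[symmetric] .
  qed
  have c\<psi>: "continuous_on UNIV (\<psi> n)" for n
    unfolding \<psi>_def g_def by (intro continuous_intros)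
  have s1: "1 / N n \<le> 1" for n by (simp add: N_def)
  have g_bd: "\<bar>\<psi> n y\<bar> \<le> (1 - exp (- s * dist y vertex)) + s * (1 / N n)" for n y
  proof -
    have "exp (- s * dist y vertex) \<le> 1" using s by simp
    moreover have "0 \<le> s / N n * exp (- N n * dist y vertex)" using s N[of n] by simp
    moreover have "s / N n * exp (- N n * dist y vertex) \<le> s * (1 / N n)"
      using s N[of n] by (simp add: divide_right_mono mult_left_le)
    ultimately show ?thesis unfolding \<psi>_def g_def by linarith
  qed
  have B\<psi>: "\<bar>\<psi> n y\<bar> \<le> 1 + s" for n y
  proof -
    have "s * (1 / N n) \<le> s" using s1[of n] s by (intro mult_left_le) auto
    moreover have "0 < exp (- s * dist y vertex)" by simp
    ultimately show ?thesis using g_bd[of n y] by linarith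
  qed
  have conc: "(\<lambda>n. R (qn a n) l (\<lambda>y. qn a n y * \<psi> n y) x) \<longlonglongrightarrow> 0"
  proof (rule R_qn_concentration[OF a0 l c\<psi> B\<psi>])
    fix \<eta> :: real assume \<eta>: "0 < \<eta>"
    have "\<forall>\<^sub>F n in sequentially. s * (1 / N n) < \<eta> / 2"
      using tendsto_mult[OF tendsto_const[of s] Ninf] \<eta> by (intro order_tendstoD) auto
    then have "\<forall>\<^sub>F n in sequentially. \<forall>y. dist y vertex \<le> \<eta> / (2 * s) \<longrightarrow> \<bar>\<psi> n y\<bar> \<le> \<eta>"
    proof eventually_elim
      case (elim n)
      show ?case
      proof (intro allI impI)
        fix y :: "'n star" assume "dist y vertex \<le> \<eta> / (2 * s)"
        then have "s * dist y vertex \<le> \<eta> / 2" using s by (simp add: field_simps)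
        moreover have "1 - exp (- s * dist y vertex) \<le> s * dist y vertex"
          using exp_ge_add_one_self[of "- s * dist y vertex"] by linarith
        ultimately show "\<bar>\<psi> n y\<bar> \<le> \<eta>" using g_bd[of n y] elim by linarith
      qed
    qed
    then show "\<exists>\<delta>>0. \<forall>\<^sub>F n in sequentially. \<forall>y. dist y vertex \<le> \<delta> \<longrightarrow> \<bar>\<psi> n y\<bar> \<le> \<eta>"
      using \<eta> s by (intro exI[of _ "\<eta> / (2 * s)"]) auto
  qed
  have "(\<lambda>n. (c n + 1) * R (qn a n) l (qn a n) x + R (qn a n) l (\<lambda>y. qn a n y * \<psi> n y) x)
    \<longlonglongrightarrow> (s / (2 * a * K) * (1 - s\<^sup>2 * 0 * 0) + 1) * (l * (1 - Ra a l (\<lambda>_. 1) x)) + 0"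
    by (intro tendsto_intros clim R_qn_mass_limit[OF a0 l] conc)
  moreover have "(c n + 1) * R (qn a n) l (qn a n) x + R (qn a n) l (\<lambda>y. qn a n y * \<psi> n y) x = l * g n x" for n
  proof -
    note q = qn_continuous[of a n] qn_nonneg[OF a0, of n] qn_le[OF a0, of n]
    let ?Q = "a * K * real (Suc n)"
    have Q0: "0 \<le> ?Q" using a K_pos by simp
    have q': "\<bar>qn a n y\<bar> \<le> ?Q" for y using q(2)[of y] q(3)[of y] by simp
    have q\<psi>: "continuous_on UNIV (\<lambda>y. qn a n y * \<psi> n y)" "\<And>y. \<bar>qn a n y * \<psi> n y\<bar> \<le> ?Q * (1 + s)"
      unfolding abs_mult by (intro continuous_intros q c\<psi>, intro mult_mono q' B\<psi> Q0, simp)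
    have "l * g n x = R (qn a n) l (\<lambda>y. l * g n y - g' n y + qn a n y * g n y) x"
      by (rule Feynman_Kac[OF q core l, symmetric])
    also have "(\<lambda>y. l * g n y - g' n y + qn a n y * g n y) = (\<lambda>y. (c n + 1) * qn a n y + 1 * (qn a n y * \<psi> n y))"
      by (simp add: fun_eq_iff lg \<psi>_def algebra_simps)
    also have "R (qn a n) l \<dots> x = (c n + 1) * R (qn a n) l (qn a n) x + 1 * R (qn a n) l (\<lambda>y. qn a n y * \<psi> n y) x"
      by (rule R_linear[OF q l q(1) q' q\<psi>])
    finally show ?thesis by simp
  qed
  moreover have "(\<lambda>n. l * g n x) \<longlonglongrightarrow> l * exp (- s * dist x vertex)"
  proof -
    have "(\<lambda>n. s / N n * exp (- N n * dist x vertex)) \<longlonglongrightarrow> 0"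
    proof (rule Lim_null_comparison)
      show "\<forall>\<^sub>F n in sequentially. norm (s / N n * exp (- N n * dist x vertex)) \<le> s * (1 / N n)"
      proof (intro always_eventually allI)
        fix n show "norm (s / N n * exp (- N n * dist x vertex)) \<le> s * (1 / N n)"
          using s N[of n] by (simp add: divide_right_mono mult_left_le)
      qed
      show "(\<lambda>n. s * (1 / N n)) \<longlonglongrightarrow> 0" using tendsto_mult[OF tendsto_const[of s] Ninf] by simp
    qed
    from tendsto_mult[OF tendsto_const[of l] tendsto_diff[OF tendsto_const this]]
    show ?thesis by (simp add: g_def)
  qed
  ultimately have "l * exp (- s * dist x vertex) = (s / (2 * a * K) * (1 - s\<^sup>2 * 0 * 0) + 1) * (l * (1 - Ra a l (\<lambda>_. 1) x)) + 0"
    by (simp add: LIMSEQ_unique)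
  then have "l * exp (- s * dist x vertex) = l * ((s / (2 * a * K) + 1) * (1 - Ra a l (\<lambda>_. 1) x))"
    by (simp add: mult.left_commute)
  then have "exp (- s * dist x vertex) = (s / (2 * a * K) + 1) * (1 - Ra a l (\<lambda>_. 1) x)"
    using l by (simp only: mult_cancel_left) auto
  moreover have "s / (2 * a * K) + 1 = (s + 2 * a * K) / (2 * a * K)"
    using a K_pos by (simp add: field_simps)
  moreover have "0 < s + 2 * a * K" using s a K_pos by (intro add_pos_pos) auto
  ultimately show ?thesis using a K_pos by (simp add: divide_simps)
qed

section \<open>The normalization of the local time\<close>

lemma gauss_eq: "0 < t \<Longrightarrow> gauss t x = gauss t 0 * exp (- x\<^sup>2 / (2 * t))"
  by (simp add: gauss_def)

lemma gauss_derivative: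
  assumes t: "0 < t"
  shows "((\<lambda>x. gauss t (x + w)) has_real_derivative - ((x + w) / t) * gauss t (x + w)) (at x)"
proof -
  have "((\<lambda>x. gauss t 0 * exp (- (x + w)\<^sup>2 / (2 * t))) has_real_derivative
      - ((x + w) / t) * (gauss t 0 * exp (- (x + w)\<^sup>2 / (2 * t)))) (at x)"
  proof -
    have "((\<lambda>x. - (x + w)\<^sup>2 / (2 * t)) has_real_derivative - ((x + w) / t)) (at x)"
      using t by (auto intro!: derivative_eq_intros simp: field_simps)
    from DERIV_cmult[OF DERIV_fun_exp[OF this], of "gauss t 0"] show ?thesis by (simp add: mult_ac)
  qed
  then show ?thesis by (simp only: gauss_eq[OF t, of "_ + w", symmetric])
qed

lemma gauss_at_top:
  assumes t: "0 < t"
  shows "((\<lambda>x. gauss t (x + w)) \<longlongrightarrow> 0) at_top"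
proof -
  have "filterlim (\<lambda>x::real. w + x) at_top at_top"
    by (rule filterlim_tendsto_add_at_top[OF tendsto_const filterlim_ident])
  then have "filterlim (\<lambda>x::real. (w + x)\<^sup>2) at_top at_top"
    by (rule filterlim_pow_at_top[OF _, rotated]) simp
  from filterlim_tendsto_pos_mult_at_top[OF tendsto_const _ this, of "1 / (2 * t)"]
  have "filterlim (\<lambda>x. - ((x + w)\<^sup>2 / (2 * t))) at_bot at_top"
    using t by (simp add: filterlim_uminus_at_bot add.commute)
  from tendsto_mult[OF tendsto_const[of "gauss t 0"] filterlim_compose[OF exp_at_bot this]]
  show ?thesis by (simp add: gauss_eq[OF t, of "_ + w"])
qed

lemma gauss_nonneg: "0 \<le> gauss t x"
  by (simp add: gauss_def)

lemma gauss_measurable [measurable]: "gauss t \<in> borel_measurable borel"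
  unfolding gauss_def[abs_def] by measurable

text \<open>Both integrations of the joint density are by the fundamental theorem of calculus, since
  \<open>x / t * gauss t x\<close> is minus the derivative of \<open>gauss t x\<close> in \<open>x\<close>.\<close>

lemma expected_local_time:
  assumes t: "0 < t"
  shows "integrable (P vertex) (Lc t)" "(\<integral>\<omega>. Lc t \<omega> \<partial>P vertex) = 2 * t * gauss t 0"
proof -
  let ?d = "\<lambda>(y, w). if 0 < y \<and> 0 < w then ennreal (2 * ((y + w) / t) * gauss t (y + w)) else 0"
  have D: "distributed (P vertex) (lborel \<Otimes>\<^sub>M lborel) (\<lambda>\<omega>. (dist (Z t \<omega>) vertex, L t \<omega>)) ?d"
    using norm t unfolding local_time_normalized_def by blast
  have dm [measurable]: "?d \<in> borel_measurable (lborel \<Otimes>\<^sub>M lborel)"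
    by measurable
  have "(\<integral>\<^sup>+\<omega>. ennreal (L t \<omega>) \<partial>P vertex) = (\<integral>\<^sup>+z. ?d z * ennreal (snd z) \<partial>(lborel \<Otimes>\<^sub>M lborel))"
    using distributed_nn_integral[OF D, of "\<lambda>z. ennreal (snd z)"] by simp
  also have "\<dots> = (\<integral>\<^sup>+w. \<integral>\<^sup>+y. ?d (y, w) * ennreal w \<partial>lborel \<partial>lborel)"
    by (subst lborel_pair.nn_integral_snd[symmetric]) auto
  also have "\<dots> = (\<integral>\<^sup>+w. ennreal (2 * w * gauss t w) * indicator {0..} w \<partial>lborel)"
  proof (rule nn_integral_cong)
    fix w :: real
    show "(\<integral>\<^sup>+y. ?d (y, w) * ennreal w \<partial>lborel) = ennreal (2 * w * gauss t w) * indicator {0..} w"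
    proof (cases "0 < w")
      case True
      have "(\<integral>\<^sup>+y. ?d (y, w) * ennreal w \<partial>lborel) =
          (\<integral>\<^sup>+y. ennreal (2 * w * ((y + w) / t * gauss t (y + w))) * indicator {0..} y \<partial>lborel)"
      proof (rule nn_integral_cong_AE)
        have "AE y in lborel. y \<noteq> (0::real)" by (rule AE_lborel_singleton)
        then show "AE y in lborel. ?d (y, w) * ennreal w =
            ennreal (2 * w * ((y + w) / t * gauss t (y + w))) * indicator {0..} y"
          by eventually_elim (use True t in \<open>auto simp: indicator_def gauss_nonneg ennreal_mult[symmetric] mult_ac\<close>)
      qed
      also have "\<dots> = ennreal (0 - (- 2 * w * gauss t (0 + w)))"
      proof (rule nn_integral_FTC_atLeast[where F="\<lambda>y. - 2 * w * gauss t (y + w)"])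
        show "((\<lambda>y. - 2 * w * gauss t (y + w)) has_real_derivative 2 * w * ((y + w) / t * gauss t (y + w))) (at y)" for y
          using DERIV_cmult[OF gauss_derivative[OF t, of w y], of "- 2 * w"] by (simp add: mult_ac)
        show "0 \<le> 2 * w * ((y + w) / t * gauss t (y + w))" if "0 \<le> y" for y
          using that True t gauss_nonneg by (intro mult_nonneg_nonneg) auto
        show "((\<lambda>y. - 2 * w * gauss t (y + w)) \<longlongrightarrow> 0) at_top"
          using tendsto_mult[OF tendsto_const[of "- 2 * w"] gauss_at_top[OF t, of w]] by simp
      qed measurable
      finally show ?thesis using True by simp
    next
      case False
      then show ?thesis by (cases "w = 0") auto
    qed
  qed
  also have "\<dots> = ennreal (0 - (- 2 * t * gauss t (0 + 0)))"
  proof (rule nn_integral_FTC_atLeast[where F="\<lambda>w. - 2 * t * gauss t (w + 0)"])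
    show "((\<lambda>w. - 2 * t * gauss t (w + 0)) has_real_derivative 2 * w * gauss t w) (at w)" for w
      using DERIV_cmult[OF gauss_derivative[OF t, of 0 w], of "- 2 * t"] t by (simp add: mult.assoc)
    show "0 \<le> 2 * w * gauss t w" if "0 \<le> w" for w
      using that gauss_nonneg by (intro mult_nonneg_nonneg) auto
    show "((\<lambda>w. - 2 * t * gauss t (w + 0)) \<longlongrightarrow> 0) at_top"
      using tendsto_mult[OF tendsto_const[of "- 2 * t"] gauss_at_top[OF t, of 0]] by simp
  qed measurable
  finally have nn: "(\<integral>\<^sup>+\<omega>. ennreal (Lc t \<omega>) \<partial>P vertex) = ennreal (2 * t * gauss t 0)"
    using t by (simp add: Lc_eq)
  have pos: "AE \<omega> in P vertex. 0 \<le> Lc t \<omega>"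
    by (rule AE_I2) (simp add: Lc_nonneg)
  show i: "integrable (P vertex) (Lc t)"
  proof (rule integrableI_nonneg)
    show "(\<integral>\<^sup>+\<omega>. ennreal (Lc t \<omega>) \<partial>P vertex) < \<infinity>" unfolding nn by simp
  qed (use pos in auto)
  have "ennreal (\<integral>\<omega>. Lc t \<omega> \<partial>P vertex) = ennreal (2 * t * gauss t 0)"
    using nn_integral_eq_integral[OF i pos] nn by simp
  then show "(\<integral>\<omega>. Lc t \<omega> \<partial>P vertex) = 2 * t * gauss t 0"
    using integral_nonneg_AE[OF pos] t gauss_nonneg[of t 0] by simp
qed

text \<open>\<open>2 * t * gauss t 0\<close> is \<open>sqrt (2 t / pi)\<close>; its mean under \<open>expo 1\<close> is a value of the Gamma function
  at \<open>3/2\<close>.\<close>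

lemma expo_sqrt_moment:
  "integrable (expo 1) (\<lambda>t. 2 * t * gauss t 0)" "(\<integral>t. 2 * t * gauss t 0 \<partial>expo 1) = 1 / sqrt 2"
proof -
  define f where "f t = exponential_density 1 t * (2 * t * gauss t 0)" for t :: real
  have f_eq: "f t = indicator {0..} t * (sqrt (2 / pi) * (t powr (3/2 - 1) / exp t))" for t
  proof (cases "0 < t")
    case True
    have "2 * t * (2 * pi * t) powr (- 1/2) = sqrt (2 / pi) * t powr (1/2)"
      using True by (simp add: powr_minus powr_half_sqrt real_sqrt_mult real_sqrt_divide field_simps
          power2_eq_square[symmetric] real_sqrt_pow2)
    then show ?thesis
      using True by (simp add: f_def gauss_def exponential_density_def exp_minus field_simps)
  next
    case False
    then show ?thesis by (cases "t = 0") (auto simp: f_def exponential_density_def)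
  qed
  have f0: "0 \<le> f t" for t unfolding f_eq by simp
  have [measurable]: "f \<in> borel_measurable borel" unfolding f_eq[abs_def] by measurable
  have gm: "(\<lambda>t. 2 * t * gauss t 0) \<in> borel_measurable borel" unfolding gauss_def by measurable
  have "((\<lambda>t. sqrt (2 / pi) * (t powr (3/2 - 1) / exp t)) has_integral sqrt (2 / pi) * Gamma (3/2)) {0..}"
    by (intro has_integral_mult_right Gamma_integral_real) simp
  then have "(f has_integral sqrt (2 / pi) * Gamma (3/2)) UNIV"
    by (subst (asm) has_integral_restrict_UNIV[symmetric])
       (auto elim!: has_integral_eq[rotated] simp: f_eq)
  from nn_integral_has_integral_lborel[OF _ f0 this]
  have nn: "(\<integral>\<^sup>+t. ennreal (f t) \<partial>lborel) = ennreal (sqrt (2 / pi) * Gamma (3/2))" by simp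
  have G: "Gamma (3/2 :: real) = sqrt pi / 2"
    using Gamma_plus1[of "1/2::real"] Gamma_one_half_real nonpos_Ints_nonpos[of "1/2::real"] by auto
  have val: "sqrt (2 / pi) * Gamma (3/2) = 1 / sqrt 2"
    unfolding G by (simp add: real_sqrt_divide field_simps)
  have fi: "integrable lborel f"
    by (rule integrableI_nonneg) (use nn f0 in auto)
  then show i: "integrable (expo 1) (\<lambda>t. 2 * t * gauss t 0)"
    unfolding expo_def by (subst integrable_density) (use gm exponential_density_nonneg[of 1] in \<open>auto simp: f_def[abs_def]\<close>)
  have "(\<integral>t. 2 * t * gauss t 0 \<partial>expo 1) = (\<integral>t. f t \<partial>lborel)"
    unfolding f_def by (rule integral_expo) (use gm in auto)
  also have "\<dots> = 1 / sqrt 2"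
    using integral_eq_nn_integral[of f lborel] f0 nn val by simp
  finally show "(\<integral>t. 2 * t * gauss t 0 \<partial>expo 1) = 1 / sqrt 2" .
qed

text \<open>Divide the killing probability from the vertex, for \<open>l = 1\<close>, by \<open>a\<close> and let \<open>a\<close> tend to zero:
  the limit is the mean of \<open>L\<close> at an exponential time, hence \<open>2 K / sqrt 2 = 1 / sqrt 2\<close>.\<close>

lemma K_eq_half: "K = 1/2"
proof -
  interpret P0: prob_space "P vertex" by (rule prob_P)
  interpret E1: prob_space "expo 1" by (rule prob_space_expo) simp
  define a where "a n = 1 / real (Suc n)" for n
  have a: "0 < a n" for n by (simp add: a_def)
  have a0: "a \<longlonglongrightarrow> 0" using LIMSEQ_inverse_real_of_nat by (simp add: a_def[abs_def] inverse_eq_divide)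
  define F where "F n u = (1 - exp (- a n * u)) / a n" for n u
  have F_bd: "0 \<le> F n u" "F n u \<le> u" if "0 \<le> u" for n u
  proof -
    show "0 \<le> F n u" using that a[of n] by (simp add: F_def)
    have "1 - exp (- a n * u) \<le> a n * u" using exp_ge_add_one_self[of "- a n * u"] by linarith
    then show "F n u \<le> u" using a[of n] by (simp add: F_def pos_divide_le_eq mult.commute)
  qed
  have F_lim: "(\<lambda>n. F n u) \<longlonglongrightarrow> u" for u
  proof -
    have "((\<lambda>x. 1 - exp (- x * u)) has_real_derivative u) (at 0)"
      by (auto intro!: derivative_eq_intros)
    then have "((\<lambda>h. (1 - exp (- h * u)) / h) \<longlongrightarrow> u) (at 0)"
      by (simp add: DERIV_def)
    moreover have "filterlim a (at 0) sequentially"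
      unfolding filterlim_at using a0 a by (simp add: less_imp_neq[OF a, symmetric])
    ultimately show ?thesis unfolding F_def by (rule filterlim_compose)
  qed
  have lim: "(\<lambda>n. \<integral>t. \<integral>\<omega>. F n (Lc t \<omega>) \<partial>P vertex \<partial>expo 1) \<longlonglongrightarrow> (\<integral>t. 2 * t * gauss t 0 \<partial>expo 1)"
  proof (rule integral_dominated_convergence[where w="\<lambda>t. 2 * t * gauss t 0"])
    have Fm: "(\<lambda>\<omega>. F n (Lc t \<omega>)) \<in> borel_measurable M" for n t
      unfolding F_def by measurable
    show "AE t in expo 1. (\<lambda>n. \<integral>\<omega>. F n (Lc t \<omega>) \<partial>P vertex) \<longlonglongrightarrow> 2 * t * gauss t 0"
      using AE_expo_pos[of 1]
    proof eventually_elim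
      case (elim t)
      have "(\<lambda>n. \<integral>\<omega>. F n (Lc t \<omega>) \<partial>P vertex) \<longlonglongrightarrow> (\<integral>\<omega>. Lc t \<omega> \<partial>P vertex)"
      proof (rule integral_dominated_convergence[where w="Lc t"])
        show "AE \<omega> in P vertex. norm (F n (Lc t \<omega>)) \<le> Lc t \<omega>" for n
          by (rule AE_I2) (use F_bd Lc_nonneg in auto)
      qed (use Fm F_lim expected_local_time(1)[OF elim] in auto)
      then show ?case by (simp only: expected_local_time(2)[OF elim])
    qed
    show "AE t in expo 1. norm (\<integral>\<omega>. F n (Lc t \<omega>) \<partial>P vertex) \<le> 2 * t * gauss t 0" for n
      using AE_expo_pos[of 1]
    proof eventually_elim
      case (elim t)
      have i: "integrable (P vertex) (\<lambda>\<omega>. F n (Lc t \<omega>))"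
        by (rule Bochner_Integration.integrable_bound[OF expected_local_time(1)[OF elim]])
           (use Fm F_bd Lc_nonneg in \<open>auto intro!: AE_I2\<close>)
      have "(\<integral>\<omega>. F n (Lc t \<omega>) \<partial>P vertex) \<le> (\<integral>\<omega>. Lc t \<omega> \<partial>P vertex)"
        by (rule integral_mono[OF i expected_local_time(1)[OF elim]]) (use F_bd Lc_nonneg in auto)
      moreover have "0 \<le> (\<integral>\<omega>. F n (Lc t \<omega>) \<partial>P vertex)"
        by (rule integral_nonneg_AE, rule AE_I2) (use F_bd Lc_nonneg in auto)
      ultimately show ?case by (simp add: expected_local_time(2)[OF elim])
    qed
    show "integrable (expo 1) (\<lambda>t. 2 * t * gauss t 0)" by (rule expo_sqrt_moment)
    then show "(\<lambda>t. 2 * t * gauss t 0) \<in> borel_measurable (expo 1)" by (rule borel_measurable_integrable)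
    show "(\<lambda>t. \<integral>\<omega>. F n (Lc t \<omega>) \<partial>P vertex) \<in> borel_measurable (expo 1)" for n
    proof -
      have "continuous_on UNIV (\<lambda>t. \<integral>\<omega>. F n (Lc t \<omega>) \<partial>P vertex)"
      proof (rule P0.continuous_on_integral_bounded)
        show "continuous_on UNIV (\<lambda>t. F n (Lc t \<omega>))" if "\<omega> \<in> space (P vertex)" for \<omega>
          unfolding F_def using that a[of n] by (intro continuous_intros Lc_continuous) auto
        show "\<bar>F n (Lc t \<omega>)\<bar> \<le> 1 / a n" if "\<omega> \<in> space (P vertex)" for t \<omega>
          using a[of n] Lc_nonneg[of \<omega> t] that by (simp add: F_def divide_right_mono)
      qed (use Fm in simp)
      from borel_measurable_continuous_onI[OF this] show ?thesis by simp
    qed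
  qed
  have one: "(\<integral>t. \<integral>\<omega>. F n (Lc t \<omega>) \<partial>P vertex \<partial>expo 1) = 2 * K / (sqrt 2 + 2 * a n * K)" for n
  proof -
    have a0: "0 \<le> a n" using a[of n] by simp
    have ie: "integrable (P vertex) (\<lambda>\<omega>. exp (- a n * Lc t \<omega>))" for t
    proof (rule P0.integrable_const_bound[where B=1])
      show "AE \<omega> in P vertex. norm (exp (- a n * Lc t \<omega>)) \<le> 1"
        by (rule AE_I2) (use La_bound[OF a0, of _ "\<lambda>_. 1" 1] in auto)
    qed simp
    have iE: "integrable (expo 1) (\<lambda>t. \<integral>\<omega>. exp (- a n * Lc t \<omega>) \<partial>P vertex)"
    proof (rule integrable_expo_bounded[where B=1])
      show "(\<lambda>t. \<integral>\<omega>. exp (- a n * Lc t \<omega>) \<partial>P vertex) \<in> borel_measurable borel"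
        using borel_measurable_continuous_onI[OF La_continuous[OF a0, of "\<lambda>_. 1" 1 vertex]] by simp
      show "\<bar>\<integral>\<omega>. exp (- a n * Lc t \<omega>) \<partial>P vertex\<bar> \<le> 1" for t
        using La_expectation_bound[OF a0, where f="\<lambda>_. 1" and B=1 and t=t and x=vertex] by simp
    qed simp
    have "(\<integral>t. \<integral>\<omega>. F n (Lc t \<omega>) \<partial>P vertex \<partial>expo 1) = (\<integral>t. (1 - (\<integral>\<omega>. exp (- a n * Lc t \<omega>) \<partial>P vertex)) / a n \<partial>expo 1)"
      unfolding F_def using ie P0.prob_space by simp
    also have "\<dots> = (1 - Ra (a n) 1 (\<lambda>_. 1) vertex) / a n"
      unfolding Ra_def using iE by (simp add: E1.prob_space[simplified])
    also have "\<dots> = 2 * K / (sqrt 2 + 2 * a n * K)"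
      using one_minus_Ra_one_K[OF a[of n], of 1 vertex] a[of n] by simp
    finally show ?thesis .
  qed
  have "(\<lambda>n. 2 * K / (sqrt 2 + 2 * a n * K)) \<longlonglongrightarrow> 2 * K / (sqrt 2 + 2 * 0 * K)"
    by (intro tendsto_intros a0) simp
  from LIMSEQ_unique[OF this lim[unfolded one expo_sqrt_moment(2)]] have "2 * K / sqrt 2 = 1 / sqrt 2" by simp
  then show ?thesis by simp
qed

lemma one_minus_Ra_one:
  assumes "0 < a" "0 < l"
  shows "1 - Ra a l (\<lambda>_. 1) x = exp (- sqrt (2 * l) * dist x vertex) * (a / (sqrt (2 * l) + a))"
  using one_minus_Ra_one_K[OF assms, of x] unfolding K_eq_half by simp

end

section \<open>Time change by a delayed clock\<close>

text \<open>The clock \<open>V\<close> runs at unit speed plus the delay \<open>J\<close>, and \<open>A\<close> is its inverse, constant across the jumps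
  of \<open>J\<close>. Where \<open>g\<close> is nonzero the delay is locally constant, so there \<open>V\<close> is locally a translation
  and the change of variables has Jacobian one. The set \<open>V ` D\<close> is exactly where \<open>g \<circ> A\<close> is nonzero, so
  the time spent in jumps does not contribute.\<close>

lemma time_change_integral:
  fixes J g :: "real \<Rightarrow> real" and l :: real
  defines "V \<equiv> \<lambda>s. s + J s"
  defines "A \<equiv> \<lambda>t. Inf {s. 0 \<le> s \<and> V s > t}"
  assumes l: "0 < l"
    and J0: "J 0 = 0" and Jmono: "\<And>s r. 0 \<le> s \<Longrightarrow> s \<le> r \<Longrightarrow> J s \<le> J r"
    and Jrc: "\<And>s. 0 \<le> s \<Longrightarrow> continuous (at_right s) J"
    and g: "continuous_on {0..} g" "\<And>s. 0 \<le> s \<Longrightarrow> \<bar>g s\<bar> \<le> B"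
    and loc: "\<And>s. 0 \<le> s \<Longrightarrow> g s \<noteq> 0 \<Longrightarrow> \<exists>d>0. \<forall>r\<ge>0. \<bar>r - s\<bar> < d \<longrightarrow> J r = J s"
  shows "\<And>t. 0 \<le> t \<Longrightarrow> 0 \<le> A t" "continuous_on {0..} A" "A 0 = 0"
    "(\<integral>t. g (A (max 0 t)) \<partial>expo l) = (\<integral>s. exp (- l * J (max 0 s)) * g (max 0 s) \<partial>expo l)"
proof -
  have Jnn: "0 \<le> J s" if "0 \<le> s" for s using Jmono[of 0 s] J0 that by simp
  have Vge: "s \<le> V s" if "0 \<le> s" for s using Jnn[OF that] by (simp add: V_def)
  have Vadd: "V s + (r - s) \<le> V r" if "0 \<le> s" "s \<le> r" for s r using Jmono[OF that] by (simp add: V_def)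
  have Vstrict: "V s < V r" if "0 \<le> s" "s < r" for s r using Vadd[of s r] that by simp
  define S where "S t = {s. 0 \<le> s \<and> V s > t}" for t
  have A_eq: "A t = Inf (S t)" for t by (simp add: A_def S_def)
  have S_ne: "S t \<noteq> {}" if "0 \<le> t" for t
  proof -
    have "t + 1 \<in> S t" using Vge[of "t + 1"] that by (simp add: S_def)
    then show ?thesis by blast
  qed
  have S_bdd: "bdd_below (S t)" for t by (rule bdd_belowI[of _ 0]) (simp add: S_def)
  show A0: "0 \<le> A t" if "0 \<le> t" for t
    unfolding A_eq by (rule cInf_greatest[OF S_ne[OF that]]) (simp add: S_def)
  have A_le: "A t \<le> s" if "s \<in> S t" for s t
    unfolding A_eq by (rule cInf_lower[OF that S_bdd])
  have A_lt: "V s > t" if At: "A t < s" and t: "0 \<le> t" for s t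
  proof -
    obtain s' where "s' \<in> S t" "s' < s"
      using At cInf_less_iff[OF S_ne[OF t] S_bdd] by (auto simp: A_eq)
    then show ?thesis using Vstrict[of s' s] by (simp add: S_def)
  qed
  have A_mono: "A t' \<le> A t" if "0 \<le> t'" "t' \<le> t" for t' t
    unfolding A_eq by (rule cInf_superset_mono) (use that S_ne S_bdd in \<open>auto simp: S_def\<close>)
  have A_Lip: "A t \<le> A t' + (t - t')" if "0 \<le> t'" "t' \<le> t" for t' t
  proof -
    have "A t - (t - t') \<le> A t'"
      unfolding A_eq[of t']
    proof (rule cInf_greatest[OF S_ne[OF that(1)]])
      fix r assume r: "r \<in> S t'"
      then have "r + (t - t') \<in> S t" using Vadd[of r "r + (t - t')"] that by (auto simp: S_def)
      from A_le[OF this] show "A t - (t - t') \<le> r" by simp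
    qed
    then show ?thesis by simp
  qed
  have "1-lipschitz_on {0..} A"
  proof (rule lipschitz_onI)
    fix t t' :: real assume "t \<in> {0..}" "t' \<in> {0..}"
    then show "dist (A t) (A t') \<le> 1 * dist t t'"
      using A_mono[of t t'] A_mono[of t' t] A_Lip[of t t'] A_Lip[of t' t]
      by (cases "t \<le> t'") (auto simp: dist_real_def)
  qed simp
  then show cA: "continuous_on {0..} A" by (rule lipschitz_on_continuous_on)
  have AV: "A (V s) = s" if "0 \<le> s" for s
  proof -
    have "S (V s) = {s<..}"
    proof (intro set_eqI iffI)
      fix r assume "r \<in> S (V s)"
      then have "0 \<le> r" "V s < V r" by (auto simp: S_def)
      then show "r \<in> {s<..}" using Vstrict[of r s] by (cases r s rule: linorder_cases) auto
    qed (use that Vstrict in \<open>auto simp: S_def\<close>)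
    then show ?thesis by (simp add: A_eq)
  qed
  show "A 0 = 0"
    using AV[of 0] J0 by (simp add: V_def)
  define D where "D = {s. 0 \<le> s \<and> g s \<noteq> 0}"
  have gm: "(\<lambda>s. g (max 0 s)) \<in> borel_measurable borel"
    by (rule clamped_borel_measurable[OF g(1)])
  have D_alt: "D = {s. 0 \<le> s \<and> g (max 0 s) \<noteq> 0}" by (auto simp: D_def max_def)
  have D_sets: "D \<in> sets borel" unfolding D_alt using gm by measurable
  \<comment> \<open>A time at which the clock shows a point of \<open>D\<close> is not inside a jump: near \<open>A t\<close> the delay is
    constant, and \<open>V\<close> exceeds \<open>t\<close> to the right of \<open>A t\<close> but not to the left.\<close>
  have AVt: "V (A t) = t" if t: "0 \<le> t" and gt: "g (A t) \<noteq> 0" for t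
  proof -
    let ?s = "A t"
    have s0: "0 \<le> ?s" by (rule A0[OF t])
    obtain d where d: "0 < d" "\<And>r. 0 \<le> r \<Longrightarrow> \<bar>r - ?s\<bar> < d \<Longrightarrow> J r = J ?s"
      using loc[OF s0 gt] by blast
    have "t \<le> V ?s"
    proof (rule field_le_epsilon)
      fix e :: real assume e: "0 < e"
      define r where "r = ?s + min e (d / 2)"
      have "J r = J ?s" using d e s0 by (intro d(2)) (auto simp: r_def min_def)
      moreover have "t < V r" using t d e by (intro A_lt) (auto simp: r_def)
      ultimately show "t \<le> V ?s + e" by (simp add: V_def r_def min_def split: if_splits)
    qed
    moreover have "V ?s \<le> t"
    proof (cases "?s = 0")
      case True
      then show ?thesis using J0 t by (simp add: V_def)
    next
      case False
      then have sp: "0 < ?s" using s0 by simp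
      show ?thesis
      proof (rule field_le_epsilon)
        fix e :: real assume e: "0 < e"
        define r where "r = ?s - min e (min (d / 2) ?s)"
        have r: "0 \<le> r" "r < ?s" using d e sp by (auto simp: r_def min_def)
        have "J r = J ?s" using d e r by (intro d(2)) (auto simp: r_def min_def split: if_splits)
        moreover have "r \<notin> S t" using A_le[of r t] r by auto
        then have "V r \<le> t" using r by (simp add: S_def)
        ultimately show "V ?s \<le> t + e" by (simp add: V_def r_def min_def split: if_splits)
      qed
    qed
    ultimately show ?thesis by simp
  qed
  have image: "V ` D = {t. 0 \<le> t \<and> g (A t) \<noteq> 0}"
  proof (intro set_eqI iffI)
    fix t assume "t \<in> V ` D"
    then obtain s where "0 \<le> s" "g s \<noteq> 0" "t = V s" by (auto simp: D_def)
    then show "t \<in> {t. 0 \<le> t \<and> g (A t) \<noteq> 0}" using AV[of s] Vge[of s] by auto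
  next
    fix t assume "t \<in> {t. 0 \<le> t \<and> g (A t) \<noteq> 0}"
    then have "V (A t) = t" "A t \<in> D" using AVt A0 by (auto simp: D_def)
    then show "t \<in> V ` D" by (metis imageI)
  qed
  define f where "f t = l * exp (- l * t) * g (A (max 0 t))" for t
  have gA: "continuous_on {0..} (\<lambda>t. g (A t))"
    by (rule continuous_on_compose2[OF g(1) cA]) (use A0 in auto)
  have gAm: "(\<lambda>t. g (A (max 0 t))) \<in> borel_measurable borel"
    by (rule clamped_borel_measurable[OF gA])
  have image_sets: "V ` D \<in> sets borel"
  proof -
    have "V ` D = {t. 0 \<le> t \<and> g (A (max 0 t)) \<noteq> 0}" unfolding image by (auto simp: max_def)
    then show ?thesis using gAm by simp
  qed
  have fm: "f \<in> borel_measurable borel" unfolding f_def[abs_def] using gAm by measurable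
  have f_ind: "indicator (V ` D) t *\<^sub>R f t = exponential_density l t * g (A (max 0 t))" for t
    unfolding image by (auto simp: indicator_def f_def exponential_density_def mult_ac max_def)
  have gAi: "integrable (expo l) (\<lambda>t. g (A (max 0 t)))"
    by (rule integrable_expo_bounded[OF l gAm, of B]) (use g A0 in auto)
  have f_int: "set_integrable lborel (V ` D) f"
    unfolding set_integrable_def f_ind
    using gAi unfolding expo_def
    by (subst (asm) integrable_density) (use l gAm exponential_density_nonneg in auto)
  have leb: "set_integrable lebesgue T h" if "set_integrable lborel T h" for T and h :: "real \<Rightarrow> real"
    using that integrable_completion[of "\<lambda>x. indicator T x *\<^sub>R h x" lborel] borel_measurable_integrable
    unfolding set_integrable_def by blast
  have dV: "(V has_field_derivative 1) (at s within D)" if s: "s \<in> D" for s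
  proof -
    have s': "0 \<le> s" "g s \<noteq> 0" using s by (auto simp: D_def)
    obtain d where d: "0 < d" "\<And>r. 0 \<le> r \<Longrightarrow> \<bar>r - s\<bar> < d \<Longrightarrow> J r = J s"
      using loc[OF s'] by blast
    have "((\<lambda>r. r + J s) has_field_derivative 1) (at s within D)"
      by (auto intro!: derivative_eq_intros)
    then show ?thesis
    proof (rule has_field_derivative_transform_within[OF _ d(1) s])
      fix r assume "r \<in> D" "dist r s < d"
      then show "r + J s = V r" using d(2)[of r] by (simp add: D_def V_def dist_real_def)
    qed
  qed
  have injV: "inj_on V D"
    by (rule inj_onI) (metis AV D_def mem_Collect_eq)
  have "(\<lambda>x. \<bar>1\<bar> * f (V x)) absolutely_integrable_on D \<and>
      integral D (\<lambda>x. \<bar>1\<bar> * f (V x)) = integral (V ` D) f"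
    by (subst has_absolute_integral_change_of_variables_1'[OF _ dV injV])
       (use D_sets leb[OF f_int] in auto)
  then have cov: "integral D (\<lambda>s. f (V s)) = integral (V ` D) f" by simp
  have Jm: "(\<lambda>s. J (max 0 s)) \<in> borel_measurable borel"
    by (rule borel_measurable_mono) (auto simp: mono_def intro!: Jmono)
  have fV_ind: "indicator D s *\<^sub>R f (V s) = exponential_density l s * (exp (- l * J (max 0 s)) * g (max 0 s))" for s
  proof (cases "0 \<le> s")
    case True
    have "exp (- l * V s) = exp (- l * s) * exp (- l * J s)"
      by (simp add: V_def exp_add[symmetric] algebra_simps)
    moreover have "A (max 0 (V s)) = s" using AV[OF True] Vge[OF True] True by (simp add: max_def)
    ultimately show ?thesis
      using True by (simp add: indicator_def D_def f_def exponential_density_def max_def mult_ac)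
  next
    case False
    then show ?thesis by (simp add: D_def exponential_density_def)
  qed
  have "set_integrable lborel D (\<lambda>s. f (V s))"
    unfolding set_integrable_def fV_ind
  proof -
    have "integrable (expo l) (\<lambda>s. exp (- l * J (max 0 s)) * g (max 0 s))"
    proof (rule integrable_expo_bounded[OF l, of _ B])
      show "(\<lambda>s. exp (- l * J (max 0 s)) * g (max 0 s)) \<in> borel_measurable borel"
        using Jm gm by measurable
      show "\<bar>exp (- l * J (max 0 s)) * g (max 0 s)\<bar> \<le> B" if "0 < s" for s
        using that g(2)[of s] Jnn[of s] l mult_mono[of "exp (- l * J s)" 1 "\<bar>g s\<bar>" B]
        by (simp add: abs_mult max_def)
    qed
    then show "integrable lborel (\<lambda>s. exponential_density l s * (exp (- l * J (max 0 s)) * g (max 0 s)))"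
      unfolding expo_def
      by (subst (asm) integrable_density) (use l Jm gm exponential_density_nonneg in auto)
  qed
  from set_borel_integral_eq_integral(2)[OF this] set_borel_integral_eq_integral(2)[OF f_int] cov
  have "(\<integral>t. exponential_density l t * g (A (max 0 t)) \<partial>lborel) =
      (\<integral>s. exponential_density l s * (exp (- l * J (max 0 s)) * g (max 0 s)) \<partial>lborel)"
    by (simp add: set_lebesgue_integral_def f_ind[simplified] fV_ind[simplified])
  then show "(\<integral>t. g (A (max 0 t)) \<partial>expo l) = (\<integral>s. exp (- l * J (max 0 s)) * g (max 0 s) \<partial>expo l)"
    using gAm Jm gm l by (subst (1 2) integral_expo) auto
qed

section \<open>Averaging over the subordinator\<close>

lemma right_continuous_compose_mono:
  fixes h :: "real \<Rightarrow> real" and \<gamma> :: "real \<Rightarrow> real"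
  assumes "continuous (at_right (\<gamma> s)) h" "continuous (at_right s) \<gamma>" "\<And>r. s < r \<Longrightarrow> \<gamma> s \<le> \<gamma> r"
  shows "continuous (at_right s) (\<lambda>r. h (\<gamma> r))"
proof -
  have "continuous (at (\<gamma> s) within {\<gamma> s..}) h"
    using assms(1) by (simp add: continuous_within at_within_Ici_at_right)
  then have "((\<lambda>r. h (\<gamma> r)) \<longlongrightarrow> h (\<gamma> s)) (at_right s)"
  proof (rule continuous_within_tendsto_compose)
    show "\<forall>\<^sub>F r in at_right s. \<gamma> r \<in> {\<gamma> s..}"
      using assms(3) by (auto simp: eventually_at_filter)
    show "(\<gamma> \<longlongrightarrow> \<gamma> s) (at_right s)" using assms(2) by (simp add: continuous_within)
  qed
  then show ?thesis by (simp add: continuous_within)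
qed

lemma (in prob_space) indep_set_integral_mult:
  fixes X Y :: "'a \<Rightarrow> real"
  assumes ind: "indep_set (sets F) (sets G)" and sp: "space F = space M" "space G = space M"
    and sub: "sets F \<subseteq> sets M" "sets G \<subseteq> sets M"
    and X: "X \<in> borel_measurable F" and Y: "Y \<in> borel_measurable G"
    and i: "integrable M X" "integrable M Y"
  shows "(\<integral>\<omega>. X \<omega> * Y \<omega> \<partial>M) = (\<integral>\<omega>. X \<omega> \<partial>M) * (\<integral>\<omega>. Y \<omega> \<partial>M)"
proof -
  have "indep_set (sigma_sets (space M) { X -` A \<inter> space M | A. A \<in> sets borel})
      (sigma_sets (space M) { Y -` A \<inter> space M | A. A \<in> sets borel})"
    unfolding indep_set_def
  proof (rule indep_sets_mono_sets[OF ind[unfolded indep_set_def]])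
    fix b :: bool
    have "sigma_sets (space M) { X -` A \<inter> space M | A. A \<in> sets borel} \<subseteq> sets F"
      unfolding sp(1)[symmetric] by (rule sets.sigma_sets_subset) (use X in \<open>auto intro: measurable_sets\<close>)
    moreover have "sigma_sets (space M) { Y -` A \<inter> space M | A. A \<in> sets borel} \<subseteq> sets G"
      unfolding sp(2)[symmetric] by (rule sets.sigma_sets_subset) (use Y in \<open>auto intro: measurable_sets\<close>)
    ultimately show "case_bool (sigma_sets (space M) { X -` A \<inter> space M | A. A \<in> sets borel})
        (sigma_sets (space M) { Y -` A \<inter> space M | A. A \<in> sets borel}) b \<subseteq> case_bool (sets F) (sets G) b"
      by (cases b) auto
  qed
  then have "indep_var borel X borel Y"
    unfolding indep_var_eq using i by (auto dest: borel_measurable_integrable)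
  from indep_var_lebesgue_integral[OF this i] show ?thesis .
qed

locale star_BM_subordinated = star_BM_local_time p M P Z L K
  for p :: "'n::finite \<Rightarrow> real" and M :: "'w measure" and P and Z and L and K +
  fixes \<phi> :: "real measure" and H :: "real \<Rightarrow> 'w \<Rightarrow> real" and \<mu> :: real
  assumes subord: "\<And>x. subordinator_with \<phi> (P x) H"
    and indep: "\<And>x. independent_processes (P x) Z H"
    and \<mu>_pos: "0 < \<mu>"
    and \<Phi>_pos: "\<And>l. 0 < l \<Longrightarrow> 0 < Laplace_exponent \<phi> l"
begin

lemma H_measurable: "0 \<le> t \<Longrightarrow> H t \<in> borel_measurable M"
  and H_0: "\<omega> \<in> space M \<Longrightarrow> H 0 \<omega> = 0"
  and H_mono: "\<omega> \<in> space M \<Longrightarrow> 0 \<le> s \<Longrightarrow> s \<le> t \<Longrightarrow> H s \<omega> \<le> H t \<omega>"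
  and H_rc: "\<omega> \<in> space M \<Longrightarrow> 0 \<le> t \<Longrightarrow> continuous (at_right t) (\<lambda>s. H s \<omega>)"
  using subord[of vertex] unfolding subordinator_with_def subordinator_def by (auto simp: mono_on_def)

lemma H_nonneg: "\<omega> \<in> space M \<Longrightarrow> 0 \<le> t \<Longrightarrow> 0 \<le> H t \<omega>"
  using H_mono[of \<omega> 0 t] H_0[of \<omega>] by simp

definition Hc :: "real \<Rightarrow> 'w \<Rightarrow> real" where "Hc t = H (max 0 t)"

lemma Hc_measurable [measurable]: "Hc t \<in> borel_measurable M"
  by (simp add: Hc_def H_measurable)

lemma Hc_rc: "\<omega> \<in> space M \<Longrightarrow> continuous (at_right t) (\<lambda>s. Hc s \<omega>)"
  unfolding Hc_def
  by (rule right_continuous_compose_mono[where \<gamma>="\<lambda>s. max 0 s"])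
     (auto intro!: H_rc continuous_max)

lemma Hc_nonneg: "\<omega> \<in> space M \<Longrightarrow> 0 \<le> Hc t \<omega>"
  by (simp add: Hc_def H_nonneg)

lemma Hc_random_time:
  assumes "\<tau> \<in> borel_measurable M"
  shows "(\<lambda>\<omega>. Hc (\<tau> \<omega>) \<omega>) \<in> borel_measurable M"
  by (rule right_continuous_at_random_time[OF Hc_measurable Hc_rc assms])

lemma integrable_bounded_P:
  fixes f :: "'w \<Rightarrow> real"
  assumes "f \<in> borel_measurable M" "\<And>\<omega>. \<omega> \<in> space M \<Longrightarrow> \<bar>f \<omega>\<bar> \<le> B"
  shows "integrable (P x) f"
proof -
  interpret prob_space "P x" by (rule prob_P)
  show ?thesis by (rule integrable_const_bound[where B=B]) (use assms in auto)
qed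

lemma H_Laplace:
  assumes "0 \<le> l" "0 \<le> t"
  shows "(\<integral>\<omega>. exp (- l * Hc t \<omega>) \<partial>P x) = exp (- t * Laplace_exponent \<phi> l)"
  using subord[of x] assms by (simp add: subordinator_with_def Hc_def)

abbreviation FZ :: "'w measure" where "FZ \<equiv> natural_filtration M Z \<infinity>"
abbreviation FH :: "'w measure" where "FH \<equiv> natural_filtration M H \<infinity>"

lemma indep_FZ_FH: "prob_space.indep_set (P x) (sets FZ) (sets FH)"
  using indep[of x] natural_filtration_cong_space[of "P x" M Z] natural_filtration_cong_space[of "P x" M H]
  by (simp add: independent_processes_def)

text \<open>Independence concerns the \<open>\<sigma>\<close>-algebra generated by \<open>Z\<close>, to which the local time belongs only up to a
  null set. The limit of the additive functionals provides a version that is measurable.\<close>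

lemma Lc_version:
  "\<exists>\<Lambda>. \<Lambda> \<in> borel_measurable FZ \<and> (\<forall>\<omega>. 0 \<le> \<Lambda> \<omega>) \<and> (AE \<omega> in P x. \<Lambda> \<omega> = Lc s \<omega>)"
proof -
  define \<Lambda> where "\<Lambda> \<omega> = max 0 (lim (\<lambda>n. Af (qn 1 n) s \<omega>))" for \<omega>
  have "subalgebra FZ (natural_filtration M Z (ennreal s))"
    unfolding subalgebra_def by (simp add: natural_filtration_mono)
  then have [measurable]: "Af (qn 1 n) s \<in> borel_measurable FZ" for n
    using measurable_from_subalg Af_adapted[OF qn_continuous] by blast
  have "\<Lambda> \<in> borel_measurable FZ" unfolding \<Lambda>_def[abs_def] by measurable
  moreover have "AE \<omega> in P x. \<Lambda> \<omega> = Lc s \<omega>"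
    using Af_qn_limit[of 1 x] AE_space
  proof eventually_elim
    case (elim \<omega>)
    then have "(\<lambda>n. Af (qn 1 n) s \<omega>) \<longlonglongrightarrow> 1 * Lc s \<omega>" by blast
    then have "lim (\<lambda>n. Af (qn 1 n) s \<omega>) = Lc s \<omega>" using limI by fastforce
    then show ?case using Lc_nonneg[of \<omega> s] elim by (simp add: \<Lambda>_def)
  qed
  ultimately show ?thesis by (intro exI[of _ \<Lambda>]) (auto simp: \<Lambda>_def)
qed

text \<open>The random time \<open>\<Lambda>\<close> is rounded up to a grid of mesh \<open>1 / (n + 1)\<close>. On each of the countably many
  events where it takes a given value, \<open>H\<close> is taken at a fixed time and independence applies; the events are
  summed up to a level \<open>m\<close>. The limit in the mesh uses the right-continuity of \<open>H\<close>.\<close>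

lemma subordinated_Laplace:
  assumes l: "0 < l" and \<Lambda>: "\<Lambda> \<in> borel_measurable FZ" "\<And>\<omega>. 0 \<le> \<Lambda> \<omega>"
    and G: "G \<in> borel_measurable FZ" "\<And>\<omega>. \<bar>G \<omega>\<bar> \<le> B"
  shows "(\<integral>\<omega>. exp (- l * Hc (\<Lambda> \<omega>) \<omega>) * G \<omega> \<partial>P x) =
    (\<integral>\<omega>. exp (- Laplace_exponent \<phi> l * \<Lambda> \<omega>) * G \<omega> \<partial>P x)"
proof -
  interpret prob_space "P x" by (rule prob_P)
  let ?\<Phi> = "Laplace_exponent \<phi> l"
  have \<Phi>0: "0 < ?\<Phi>" by (rule \<Phi>_pos[OF l])
  have FZM: "subalgebra M FZ" unfolding subalgebra_def
    using natural_filtration_subset[of Z M] Z_measurable by simp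
  have FHM: "subalgebra M FH" unfolding subalgebra_def
    using natural_filtration_subset[of H M] H_measurable by simp
  note toM = measurable_from_subalg[OF FZM]
  have B0: "0 \<le> B" using G(2)[of undefined] by linarith
  define k where "k n \<omega> = nat \<lfloor>real (Suc n) * \<Lambda> \<omega>\<rfloor>" for n \<omega>
  define t where "t n i = (real i + 1) / real (Suc n)" for n i
  have t0: "0 \<le> t n i" for n i by (simp add: t_def)
  have km: "k n \<in> measurable FZ (count_space UNIV)" for n
    unfolding k_def[abs_def] using \<Lambda>(1) by measurable
  have d_gt: "\<Lambda> \<omega> \<le> t n (k n \<omega>)" for n \<omega>
  proof -
    have "0 \<le> real (Suc n) * \<Lambda> \<omega>" using \<Lambda>(2) by simp
    then have "real (Suc n) * \<Lambda> \<omega> \<le> real (k n \<omega>) + 1"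
      unfolding k_def using floor_correct[of "real (Suc n) * \<Lambda> \<omega>"] by (simp del: of_nat_Suc)
    then show ?thesis by (simp add: t_def pos_le_divide_eq mult.commute del: of_nat_Suc)
  qed
  have d_le: "t n (k n \<omega>) \<le> \<Lambda> \<omega> + 1 / real (Suc n)" for n \<omega>
  proof -
    have "0 \<le> real (Suc n) * \<Lambda> \<omega>" using \<Lambda>(2) by simp
    then have "real (k n \<omega>) \<le> real (Suc n) * \<Lambda> \<omega>"
      unfolding k_def using floor_correct[of "real (Suc n) * \<Lambda> \<omega>"] by (simp del: of_nat_Suc)
    then show ?thesis by (simp add: t_def divide_simps mult.commute del: of_nat_Suc)
  qed
  have d_lim: "(\<lambda>n. t n (k n \<omega>)) \<longlonglongrightarrow> \<Lambda> \<omega>" for \<omega>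
  proof (rule tendsto_sandwich)
    show "\<forall>\<^sub>F n in sequentially. \<Lambda> \<omega> \<le> t n (k n \<omega>)"
      "\<forall>\<^sub>F n in sequentially. t n (k n \<omega>) \<le> \<Lambda> \<omega> + 1 / real (Suc n)"
      using d_gt d_le by (blast intro: always_eventually)+
    show "(\<lambda>n. \<Lambda> \<omega> + 1 / real (Suc n)) \<longlonglongrightarrow> \<Lambda> \<omega>"
      using tendsto_add[OF tendsto_const[of "\<Lambda> \<omega>"] LIMSEQ_inverse_real_of_nat] by (simp add: divide_inverse)
  qed simp
  have e1: "0 \<le> exp (- l * Hc r \<omega>)" "exp (- l * Hc r \<omega>) \<le> 1" if "\<omega> \<in> space M" for r \<omega>
    using Hc_nonneg[OF that, of r] l by auto
  have e2: "0 \<le> exp (- ?\<Phi> * t n i)" "exp (- ?\<Phi> * t n i) \<le> 1" for n i using \<Phi>0 t0 by auto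
  have Gm: "G \<in> borel_measurable M" by (rule toM[OF G(1)])
  have kM: "k n \<in> measurable M (count_space UNIV)" for n by (rule toM[OF km])
  have tkM: "(\<lambda>\<omega>. t n (k n \<omega>)) \<in> borel_measurable M" for n
    using kM by measurable
  have ind01: "\<bar>(if c then 1 else 0) * y\<bar> \<le> B" if "\<bar>y\<bar> \<le> B" for c and y :: real using that B0 by auto
  have step: "(\<integral>\<omega>. (if k n \<omega> < m then 1 else 0) * (exp (- l * Hc (t n (k n \<omega>)) \<omega>) * G \<omega>) \<partial>P x) =
      (\<integral>\<omega>. (if k n \<omega> < m then 1 else 0) * (exp (- ?\<Phi> * t n (k n \<omega>)) * G \<omega>) \<partial>P x)" for n m
  proof -
    define X where "X i \<omega> = (if k n \<omega> = i then 1 else 0) * G \<omega>" for i \<omega>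
    define Y where "Y i \<omega> = exp (- l * Hc (t n i) \<omega>)" for i \<omega>
    have XF: "X i \<in> borel_measurable FZ" for i
      unfolding X_def[abs_def] using km[of n] G(1) by measurable
    have YF: "Y i \<in> borel_measurable FH" for i
    proof -
      have "Hc (t n i) \<in> borel_measurable FH"
        unfolding Hc_def by (rule natural_filtration_adapted) auto
      then show ?thesis unfolding Y_def[abs_def] by measurable
    qed
    have Xi: "integrable (P x) (X i)" for i
      by (rule integrable_bounded_P[OF toM[OF XF]]) (unfold X_def, rule ind01[OF G(2)])
    have Yi: "integrable (P x) (Y i)" for i
      by (rule integrable_bounded_P[OF measurable_from_subalg[OF FHM YF], where B=1]) (use e1 in \<open>auto simp: Y_def\<close>)
    have XYi: "integrable (P x) (\<lambda>\<omega>. X i \<omega> * Y i \<omega>)" for i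
    proof (rule integrable_bounded_P[where B="B * 1"])
      show "(\<lambda>\<omega>. X i \<omega> * Y i \<omega>) \<in> borel_measurable M"
        using toM[OF XF] measurable_from_subalg[OF FHM YF] by measurable
      fix \<omega> assume "\<omega> \<in> space M"
      then show "\<bar>X i \<omega> * Y i \<omega>\<bar> \<le> B * 1"
        unfolding abs_mult X_def Y_def abs_exp_cancel
        by (intro mult_mono ind01[OF G(2), unfolded abs_mult] e1 B0) auto
    qed
    have XY: "(\<integral>\<omega>. X i \<omega> * Y i \<omega> \<partial>P x) = (\<integral>\<omega>. X i \<omega> * exp (- ?\<Phi> * t n i) \<partial>P x)" for i
    proof -
      have "(\<integral>\<omega>. X i \<omega> * Y i \<omega> \<partial>P x) = (\<integral>\<omega>. X i \<omega> \<partial>P x) * (\<integral>\<omega>. Y i \<omega> \<partial>P x)"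
        by (rule indep_set_integral_mult[OF indep_FZ_FH _ _ _ _ XF YF Xi Yi])
           (use FZM FHM in \<open>auto simp: subalgebra_def\<close>)
      also have "(\<integral>\<omega>. Y i \<omega> \<partial>P x) = exp (- ?\<Phi> * t n i)"
        unfolding Y_def using H_Laplace[of l "t n i" x] l t0 by (simp add: mult.commute)
      finally show ?thesis by simp
    qed
    have s1: "(if k n \<omega> < m then 1 else 0) * (exp (- l * Hc (t n (k n \<omega>)) \<omega>) * G \<omega>) = (\<Sum>i<m. X i \<omega> * Y i \<omega>)" for \<omega>
    proof -
      have "(\<Sum>i<m. X i \<omega> * Y i \<omega>) = (\<Sum>i<m. if i = k n \<omega> then G \<omega> * Y i \<omega> else 0)"
        by (intro sum.cong) (auto simp: X_def)
      then show ?thesis by (simp add: Y_def)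
    qed
    have s2: "(if k n \<omega> < m then 1 else 0) * (exp (- ?\<Phi> * t n (k n \<omega>)) * G \<omega>) = (\<Sum>i<m. X i \<omega> * exp (- ?\<Phi> * t n i))" for \<omega>
    proof -
      have "(\<Sum>i<m. X i \<omega> * exp (- ?\<Phi> * t n i)) = (\<Sum>i<m. if i = k n \<omega> then G \<omega> * exp (- ?\<Phi> * t n i) else 0)"
        by (intro sum.cong) (auto simp: X_def)
      then show ?thesis by simp
    qed
    show ?thesis
      unfolding s1 s2 using XYi Xi XY by (simp add: Bochner_Integration.integral_sum)
  qed
  have HtM: "(\<lambda>\<omega>. exp (- l * Hc (t n (k n \<omega>)) \<omega>) * G \<omega>) \<in> borel_measurable M" for n
    using Hc_random_time[OF tkM] Gm by measurable
  have \<Phi>M: "(\<lambda>\<omega>. exp (- ?\<Phi> * t n (k n \<omega>)) * G \<omega>) \<in> borel_measurable M" for n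
    using tkM Gm by measurable
  have bd1: "\<bar>exp (- l * Hc r \<omega>) * G \<omega>\<bar> \<le> B" if "\<omega> \<in> space M" for r \<omega>
    using mult_mono[of "exp (- l * Hc r \<omega>)" 1 "\<bar>G \<omega>\<bar>" B] e1[OF that] G(2) by (simp add: abs_mult)
  have bd2: "\<bar>exp (- ?\<Phi> * r) * G \<omega>\<bar> \<le> B" if "0 \<le> r" for r \<omega>
    using mult_mono[of "exp (- ?\<Phi> * r)" 1 "\<bar>G \<omega>\<bar>" B] \<Phi>0 that G(2) by (simp add: abs_mult)
  have ind_lim: "(\<lambda>m. (if k n \<omega> < m then 1 else 0) * y) \<longlonglongrightarrow> y" for n \<omega> and y :: real
  proof (rule tendsto_eventually)
    show "\<forall>\<^sub>F m in sequentially. (if k n \<omega> < m then 1 else 0) * y = y"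
      using eventually_gt_at_top[of "k n \<omega>"] by eventually_elim simp
  qed
  have indM: "(\<lambda>\<omega>. (if k n \<omega> < m then 1 else 0) * f \<omega>) \<in> borel_measurable M"
    if "f \<in> borel_measurable M" for f :: "'w \<Rightarrow> real" and n m
    using kM[of n] that by measurable
  have disc: "(\<integral>\<omega>. exp (- l * Hc (t n (k n \<omega>)) \<omega>) * G \<omega> \<partial>P x) = (\<integral>\<omega>. exp (- ?\<Phi> * t n (k n \<omega>)) * G \<omega> \<partial>P x)" for n
  proof (rule LIMSEQ_unique)
    show "(\<lambda>m. \<integral>\<omega>. (if k n \<omega> < m then 1 else 0) * (exp (- l * Hc (t n (k n \<omega>)) \<omega>) * G \<omega>) \<partial>P x)
      \<longlonglongrightarrow> (\<integral>\<omega>. exp (- l * Hc (t n (k n \<omega>)) \<omega>) * G \<omega> \<partial>P x)"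
    proof (rule bounded_convergence[where B=B])
      show "AE \<omega> in P x. \<bar>(if k n \<omega> < m then 1 else 0) * (exp (- l * Hc (t n (k n \<omega>)) \<omega>) * G \<omega>)\<bar> \<le> B" for m
        by (rule AE_I2) (rule ind01, use bd1 in auto)
    qed (use indM[OF HtM] HtM ind_lim in auto)
    show "(\<lambda>m. \<integral>\<omega>. (if k n \<omega> < m then 1 else 0) * (exp (- l * Hc (t n (k n \<omega>)) \<omega>) * G \<omega>) \<partial>P x)
      \<longlonglongrightarrow> (\<integral>\<omega>. exp (- ?\<Phi> * t n (k n \<omega>)) * G \<omega> \<partial>P x)"
      unfolding step
    proof (rule bounded_convergence[where B=B])
      show "AE \<omega> in P x. \<bar>(if k n \<omega> < m then 1 else 0) * (exp (- ?\<Phi> * t n (k n \<omega>)) * G \<omega>)\<bar> \<le> B" for m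
        by (rule AE_I2) (rule ind01, rule bd2[OF t0])
    qed (use indM[OF \<Phi>M] \<Phi>M ind_lim in auto)
  qed
  show ?thesis
  proof (rule LIMSEQ_unique)
    show "(\<lambda>n. \<integral>\<omega>. exp (- l * Hc (t n (k n \<omega>)) \<omega>) * G \<omega> \<partial>P x) \<longlonglongrightarrow> (\<integral>\<omega>. exp (- l * Hc (\<Lambda> \<omega>) \<omega>) * G \<omega> \<partial>P x)"
    proof (rule bounded_convergence[where B=B])
      show "(\<lambda>\<omega>. exp (- l * Hc (\<Lambda> \<omega>) \<omega>) * G \<omega>) \<in> borel_measurable (P x)"
        using Hc_random_time[OF toM[OF \<Lambda>(1)]] Gm by simp
      show "AE \<omega> in P x. (\<lambda>n. exp (- l * Hc (t n (k n \<omega>)) \<omega>) * G \<omega>) \<longlonglongrightarrow> exp (- l * Hc (\<Lambda> \<omega>) \<omega>) * G \<omega>"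
      proof (rule AE_I2)
        fix \<omega> assume "\<omega> \<in> space (P x)"
        then have "continuous (at (\<Lambda> \<omega>) within {\<Lambda> \<omega>..}) (\<lambda>s. Hc s \<omega>)"
          using Hc_rc[of \<omega> "\<Lambda> \<omega>"] by (simp add: continuous_within at_within_Ici_at_right)
        from continuous_within_tendsto_compose'[OF this _ d_lim] d_gt
        have "(\<lambda>n. Hc (t n (k n \<omega>)) \<omega>) \<longlonglongrightarrow> Hc (\<Lambda> \<omega>) \<omega>" by simp
        then show "(\<lambda>n. exp (- l * Hc (t n (k n \<omega>)) \<omega>) * G \<omega>) \<longlonglongrightarrow> exp (- l * Hc (\<Lambda> \<omega>) \<omega>) * G \<omega>"
          by (intro tendsto_intros)
      qed
      show "AE \<omega> in P x. \<bar>exp (- l * Hc (t n (k n \<omega>)) \<omega>) * G \<omega>\<bar> \<le> B" for n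
        by (rule AE_I2) (use bd1 in simp)
    qed (use HtM in simp)
    show "(\<lambda>n. \<integral>\<omega>. exp (- l * Hc (t n (k n \<omega>)) \<omega>) * G \<omega> \<partial>P x) \<longlonglongrightarrow> (\<integral>\<omega>. exp (- ?\<Phi> * \<Lambda> \<omega>) * G \<omega> \<partial>P x)"
      unfolding disc
    proof (rule bounded_convergence[where B=B])
      show "(\<lambda>\<omega>. exp (- ?\<Phi> * \<Lambda> \<omega>) * G \<omega>) \<in> borel_measurable (P x)"
        using toM[OF \<Lambda>(1)] Gm by simp
      show "AE \<omega> in P x. (\<lambda>n. exp (- ?\<Phi> * t n (k n \<omega>)) * G \<omega>) \<longlonglongrightarrow> exp (- ?\<Phi> * \<Lambda> \<omega>) * G \<omega>"
        by (rule AE_I2) (intro tendsto_intros d_lim)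
      show "AE \<omega> in P x. \<bar>exp (- ?\<Phi> * t n (k n \<omega>)) * G \<omega>\<bar> \<le> B" for n
        by (rule AE_I2) (rule bd2[OF t0])
    qed (use \<Phi>M in simp)
  qed
qed

lemma subordinated_expectation:
  assumes l: "0 < l" and f: "continuous_on UNIV f" and B: "\<And>y. \<bar>f y\<bar> \<le> B"
  shows "(\<integral>\<omega>. exp (- l * Hc (\<mu> * Lc s \<omega>) \<omega>) * f (Zc s \<omega>) \<partial>P x) =
    (\<integral>\<omega>. exp (- (\<mu> * Laplace_exponent \<phi> l) * Lc s \<omega>) * f (Zc s \<omega>) \<partial>P x)"
proof -
  obtain \<Lambda> where \<Lambda>: "\<Lambda> \<in> borel_measurable FZ" "\<And>\<omega>. 0 \<le> \<Lambda> \<omega>" "AE \<omega> in P x. \<Lambda> \<omega> = Lc s \<omega>"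
    using Lc_version[where x=x and s=s] by blast
  have FZM: "subalgebra M FZ" unfolding subalgebra_def
    using natural_filtration_subset[of Z M] Z_measurable by simp
  have G: "(\<lambda>\<omega>. f (Zc s \<omega>)) \<in> borel_measurable FZ"
    unfolding Zc_def by (rule measurable_compose[OF natural_filtration_adapted borel_measurable_continuous_onI[OF f]]) auto
  have \<Lambda>M: "\<Lambda> \<in> borel_measurable M" by (rule measurable_from_subalg[OF FZM \<Lambda>(1)])
  have fM: "(\<lambda>\<omega>. f (Zc s \<omega>)) \<in> borel_measurable M" by (rule Zc_compose_measurable[OF f])
  have "(\<integral>\<omega>. exp (- l * Hc (\<mu> * Lc s \<omega>) \<omega>) * f (Zc s \<omega>) \<partial>P x) = (\<integral>\<omega>. exp (- l * Hc (\<mu> * \<Lambda> \<omega>) \<omega>) * f (Zc s \<omega>) \<partial>P x)"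
  proof (rule integral_cong_AE)
    show "(\<lambda>\<omega>. exp (- l * Hc (\<mu> * Lc s \<omega>) \<omega>) * f (Zc s \<omega>)) \<in> borel_measurable (P x)"
      using Hc_random_time[of "\<lambda>\<omega>. \<mu> * Lc s \<omega>"] fM by simp
    show "(\<lambda>\<omega>. exp (- l * Hc (\<mu> * \<Lambda> \<omega>) \<omega>) * f (Zc s \<omega>)) \<in> borel_measurable (P x)"
      using Hc_random_time[of "\<lambda>\<omega>. \<mu> * \<Lambda> \<omega>"] fM \<Lambda>M by simp
    show "AE \<omega> in P x. exp (- l * Hc (\<mu> * Lc s \<omega>) \<omega>) * f (Zc s \<omega>) = exp (- l * Hc (\<mu> * \<Lambda> \<omega>) \<omega>) * f (Zc s \<omega>)"
      using \<Lambda>(3) by eventually_elim simp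
  qed
  also have "\<dots> = (\<integral>\<omega>. exp (- Laplace_exponent \<phi> l * (\<mu> * \<Lambda> \<omega>)) * f (Zc s \<omega>) \<partial>P x)"
  proof (rule subordinated_Laplace[OF l])
    show "(\<lambda>\<omega>. \<mu> * \<Lambda> \<omega>) \<in> borel_measurable FZ" using \<Lambda>(1) by measurable
    show "0 \<le> \<mu> * \<Lambda> \<omega>" for \<omega> using \<Lambda>(2) \<mu>_pos by simp
  qed (use G B in auto)
  also have "\<dots> = (\<integral>\<omega>. exp (- (\<mu> * Laplace_exponent \<phi> l) * Lc s \<omega>) * f (Zc s \<omega>) \<partial>P x)"
  proof (rule integral_cong_AE)
    show "AE \<omega> in P x. exp (- Laplace_exponent \<phi> l * (\<mu> * \<Lambda> \<omega>)) * f (Zc s \<omega>) =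
       exp (- (\<mu> * Laplace_exponent \<phi> l) * Lc s \<omega>) * f (Zc s \<omega>)"
      using \<Lambda>(3) by eventually_elim (simp add: mult_ac)
  qed (use \<Lambda>M fM in simp_all)
  finally show ?thesis .
qed

section \<open>The delayed process at an exponential time\<close>

text \<open>Away from the vertex, small neighbourhoods of the vertex collect no further occupation time.\<close>

lemma L_locally_constant:
  assumes occ: "\<forall>t\<ge>0. ((\<lambda>e. K / e * measure lborel {s \<in> {0..t}. dist (Z s \<omega>) vertex < e}) \<longlongrightarrow> L t \<omega>) (at_right 0)"
    and \<omega>: "\<omega> \<in> space M" and s: "0 \<le> s" "Zc s \<omega> \<noteq> vertex"
  shows "\<exists>d>0. \<forall>r\<ge>0. \<bar>r - s\<bar> < d \<longrightarrow> L r \<omega> = L s \<omega>"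
proof -
  define e0 where "e0 = dist (Zc s \<omega>) vertex / 2"
  have e0: "0 < e0" using s by (simp add: e0_def)
  have "continuous_on UNIV (\<lambda>r. dist (Zc r \<omega>) vertex)"
    by (rule Zc_compose_continuous[OF \<omega>, of "\<lambda>y. dist y vertex"]) (intro continuous_intros)
  then obtain d where d: "0 < d" "\<And>r. dist r s < d \<Longrightarrow> dist (dist (Zc r \<omega>) vertex) (dist (Zc s \<omega>) vertex) < e0"
    unfolding continuous_on_iff using e0 by (metis UNIV_I)
  have far: "e0 \<le> dist (Z u \<omega>) vertex" if "0 \<le> u" "\<bar>u - s\<bar> < d" for u
  proof -
    have "\<bar>dist (Z u \<omega>) vertex - dist (Zc s \<omega>) vertex\<bar> < e0"
      using d(2)[of u] that by (simp add: Zc_eq dist_real_def)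
    then show ?thesis unfolding e0_def by linarith
  qed
  have const: "L r \<omega> = L r' \<omega>" if r: "0 \<le> r" "r \<le> r'" "\<bar>r - s\<bar> < d" "\<bar>r' - s\<bar> < d" for r r'
  proof -
    have lim: "((\<lambda>e. K / e * measure lborel {u \<in> {0..r}. dist (Z u \<omega>) vertex < e}) \<longlongrightarrow> L r \<omega>) (at_right 0)"
      "((\<lambda>e. K / e * measure lborel {u \<in> {0..r'}. dist (Z u \<omega>) vertex < e}) \<longlongrightarrow> L r' \<omega>) (at_right 0)"
      using occ r by auto
    have "\<forall>\<^sub>F e in at_right 0. e < e0"
      using e0 by (intro eventually_at_rightI[of 0 e0]) auto
    then have "\<forall>\<^sub>F e in at_right 0. K / e * measure lborel {u \<in> {0..r'}. dist (Z u \<omega>) vertex < e} =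
       K / e * measure lborel {u \<in> {0..r}. dist (Z u \<omega>) vertex < e}"
    proof eventually_elim
      case (elim e)
      have "{u \<in> {0..r'}. dist (Z u \<omega>) vertex < e} = {u \<in> {0..r}. dist (Z u \<omega>) vertex < e}"
      proof (intro set_eqI iffI)
        fix u assume u: "u \<in> {u \<in> {0..r'}. dist (Z u \<omega>) vertex < e}"
        have "u \<le> r"
        proof (rule ccontr)
          assume "\<not> u \<le> r"
          then have "e0 \<le> dist (Z u \<omega>) vertex" using u r by (intro far) auto
          with u elim show False by auto
        qed
        then show "u \<in> {u \<in> {0..r}. dist (Z u \<omega>) vertex < e}" using u by auto
      qed (use r in auto)
      then show ?case by simp
    qed
    from tendsto_unique[OF _ Lim_transform_eventually[OF lim(2) this] lim(1)] show ?thesis by simp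
  qed
  show ?thesis
  proof (intro exI[of _ d] conjI allI impI)
    fix r :: real assume r: "0 \<le> r" "\<bar>r - s\<bar> < d"
    show "L r \<omega> = L s \<omega>"
    proof (cases "r \<le> s")
      case True
      show ?thesis by (rule const) (use r s(1) d(1) True in auto)
    next
      case False
      show ?thesis by (rule const[symmetric]) (use r s(1) d(1) False in auto)
    qed
  qed (rule d)
qed

text \<open>The delay \<open>H (\<mu> * L s)\<close> inherits monotonicity and right-continuity, since \<open>L\<close> is continuous and
  nondecreasing.\<close>

lemma delay_path:
  assumes \<omega>: "\<omega> \<in> space M"
  shows "H (\<mu> * L 0 \<omega>) \<omega> = 0"
    and "\<And>s r. 0 \<le> s \<Longrightarrow> s \<le> r \<Longrightarrow> H (\<mu> * L s \<omega>) \<omega> \<le> H (\<mu> * L r \<omega>) \<omega>"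
    and "\<And>s. 0 \<le> s \<Longrightarrow> continuous (at_right s) (\<lambda>s. H (\<mu> * L s \<omega>) \<omega>)"
    and "\<And>s. 0 \<le> s \<Longrightarrow> H (\<mu> * L s \<omega>) \<omega> = Hc (\<mu> * Lc s \<omega>) \<omega>"
proof -
  have L0: "0 \<le> \<mu> * L s \<omega>" if "0 \<le> s" for s
    using Lc_nonneg[OF \<omega>, of s] that \<mu>_pos by (simp add: Lc_eq)
  have Lm: "\<mu> * L s \<omega> \<le> \<mu> * L r \<omega>" if "0 \<le> s" "s \<le> r" for s r
    using mono_onD[OF L_mono[OF \<omega>], of s r] that \<mu>_pos by (intro mult_left_mono) auto
  show "H (\<mu> * L 0 \<omega>) \<omega> = 0" using L_0[OF \<omega>] H_0[OF \<omega>] by simp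
  show "H (\<mu> * L s \<omega>) \<omega> \<le> H (\<mu> * L r \<omega>) \<omega>" if "0 \<le> s" "s \<le> r" for s r
    by (rule H_mono[OF \<omega> L0 Lm]) (use that in auto)
  show "continuous (at_right s) (\<lambda>s. H (\<mu> * L s \<omega>) \<omega>)" if "0 \<le> s" for s
  proof (rule right_continuous_compose_mono[where \<gamma>="\<lambda>s. \<mu> * L s \<omega>"])
    show "continuous (at_right (\<mu> * L s \<omega>)) (\<lambda>r. H r \<omega>)" by (rule H_rc[OF \<omega> L0[OF that]])
    have "continuous (at s within {0..}) (\<lambda>r. L r \<omega>)"
      using L_continuous[OF \<omega>] that by (simp add: continuous_on_eq_continuous_within)
    then have "continuous (at_right s) (\<lambda>r. L r \<omega>)"
      by (rule continuous_within_subset) (use that in auto)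
    then show "continuous (at_right s) (\<lambda>r. \<mu> * L r \<omega>)" by (intro continuous_intros)
    show "\<mu> * L s \<omega> \<le> \<mu> * L r \<omega>" if "s < r" for r using Lm[of s r] \<open>0 \<le> s\<close> that by simp
  qed
  show "H (\<mu> * L s \<omega>) \<omega> = Hc (\<mu> * Lc s \<omega>) \<omega>" if "0 \<le> s" for s
    using L0[OF that] that by (simp add: Hc_def Lc_eq max_absorb2)
qed

lemma V_H_inv_eq: "V_H_inv \<mu> H L t \<omega> = Inf {s. 0 \<le> s \<and> s + H (\<mu> * L s \<omega>) \<omega> > t}"
  by (simp add: V_H_inv_def V_H_def)

lemma V_H_inv_path:
  assumes \<omega>: "\<omega> \<in> space M"
  shows "\<And>t. 0 \<le> t \<Longrightarrow> 0 \<le> V_H_inv \<mu> H L t \<omega>"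
    and "continuous_on {0..} (\<lambda>t. V_H_inv \<mu> H L t \<omega>)"
    and "V_H_inv \<mu> H L 0 \<omega> = 0"
proof -
  note tc = time_change_integral[of 1, OF zero_less_one delay_path(1-3)[OF \<omega>], where g="\<lambda>_. 0" and B=0]
  show "\<And>t. 0 \<le> t \<Longrightarrow> 0 \<le> V_H_inv \<mu> H L t \<omega>"
    unfolding V_H_inv_eq by (rule tc(1)) auto
  show "continuous_on {0..} (\<lambda>t. V_H_inv \<mu> H L t \<omega>)"
    unfolding V_H_inv_eq by (rule tc(2)) auto
  show "V_H_inv \<mu> H L 0 \<omega> = 0"
    unfolding V_H_inv_eq by (rule tc(3)) auto
qed

lemma time_change_path:
  assumes l: "0 < l" and f: "continuous_on UNIV f" and B: "\<And>y. \<bar>f y\<bar> \<le> B" and fv: "f vertex = 0"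
    and occ: "\<forall>t\<ge>0. ((\<lambda>e. K / e * measure lborel {s \<in> {0..t}. dist (Z s \<omega>) vertex < e}) \<longlongrightarrow> L t \<omega>) (at_right 0)"
    and \<omega>: "\<omega> \<in> space M"
  shows "(\<integral>t. f (Zc (V_H_inv \<mu> H L (max 0 t) \<omega>) \<omega>) \<partial>expo l) =
      (\<integral>s. exp (- l * Hc (\<mu> * Lc s \<omega>) \<omega>) * f (Zc s \<omega>) \<partial>expo l)"
proof -
  have gc: "continuous_on {0..} (\<lambda>s. f (Zc s \<omega>))"
    using Zc_compose_continuous[OF \<omega> f] by (rule continuous_on_subset) simp
  have loc: "\<exists>d>0. \<forall>r\<ge>0. \<bar>r - s\<bar> < d \<longrightarrow> H (\<mu> * L r \<omega>) \<omega> = H (\<mu> * L s \<omega>) \<omega>"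
    if "0 \<le> s" "f (Zc s \<omega>) \<noteq> 0" for s
  proof -
    have "Zc s \<omega> \<noteq> vertex" using that fv by auto
    from L_locally_constant[OF occ \<omega> that(1) this] obtain d where
      "0 < d" "\<forall>r\<ge>0. \<bar>r - s\<bar> < d \<longrightarrow> L r \<omega> = L s \<omega>" by blast
    then show ?thesis by (intro exI[of _ d]) auto
  qed
  have "(\<integral>t. f (Zc (V_H_inv \<mu> H L (max 0 t) \<omega>) \<omega>) \<partial>expo l) =
      (\<integral>s. exp (- l * H (\<mu> * L (max 0 s) \<omega>) \<omega>) * f (Zc (max 0 s) \<omega>) \<partial>expo l)"
    unfolding V_H_inv_eq
    by (rule time_change_integral(4)[OF l delay_path(1-3)[OF \<omega>] gc B loc])
  also have "\<dots> = (\<integral>s. exp (- l * Hc (\<mu> * Lc s \<omega>) \<omega>) * f (Zc s \<omega>) \<partial>expo l)"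
    by (intro Bochner_Integration.integral_cong)
       (simp_all add: delay_path(4)[OF \<omega>] Zc_def Lc_def)
  finally show ?thesis .
qed

text \<open>By monotonicity of \<open>V\<close>, the infimum lies below \<open>r\<close> iff \<open>V\<close> exceeds \<open>t\<close> at some rational below \<open>r\<close>.\<close>

lemma V_H_inv_measurable:
  assumes t: "0 \<le> t"
  shows "V_H_inv \<mu> H L t \<in> borel_measurable M"
proof (rule borel_measurableI_less)
  fix r :: real
  define V where "V s \<omega> = s + Hc (\<mu> * Lc s \<omega>) \<omega>" for s \<omega>
  have Vm: "V s \<in> borel_measurable M" for s
    unfolding V_def[abs_def] using Hc_random_time[of "\<lambda>\<omega>. \<mu> * Lc s \<omega>"] by simp
  have "{\<omega> \<in> space M. V_H_inv \<mu> H L t \<omega> < r} = (\<Union>q\<in>{q\<in>\<rat>. 0 \<le> q \<and> q < r}. {\<omega> \<in> space M. t < V q \<omega>})"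
  proof (intro set_eqI iffI)
    fix \<omega> assume \<omega>r: "\<omega> \<in> {\<omega> \<in> space M. V_H_inv \<mu> H L t \<omega> < r}"
    then have \<omega>: "\<omega> \<in> space M" by simp
    let ?S = "{s. 0 \<le> s \<and> s + H (\<mu> * L s \<omega>) \<omega> > t}"
    have "t + 1 \<in> ?S"
      using Hc_nonneg[OF \<omega>, of "\<mu> * Lc (t + 1) \<omega>"] delay_path(4)[OF \<omega>, of "t + 1"] t by simp
    then have ne: "?S \<noteq> {}" by blast
    have "bdd_below ?S" by (rule bdd_belowI[of _ 0]) simp
    from cInf_less_iff[OF ne this, of r] \<omega>r obtain s where s: "0 \<le> s" "t < s + H (\<mu> * L s \<omega>) \<omega>" "s < r"
      by (auto simp: V_H_inv_eq)
    obtain q where q: "q \<in> \<rat>" "s < q" "q < r" using Rats_dense_in_real[OF s(3)] by blast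
    have "s + H (\<mu> * L s \<omega>) \<omega> \<le> V q \<omega>"
      using delay_path(2)[OF \<omega>, of s q] delay_path(4)[OF \<omega>, of q] s q by (simp add: V_def)
    then show "\<omega> \<in> (\<Union>q\<in>{q\<in>\<rat>. 0 \<le> q \<and> q < r}. {\<omega> \<in> space M. t < V q \<omega>})"
      using q s \<omega> by (intro UN_I[of q]) auto
  next
    fix \<omega> assume "\<omega> \<in> (\<Union>q\<in>{q\<in>\<rat>. 0 \<le> q \<and> q < r}. {\<omega> \<in> space M. t < V q \<omega>})"
    then obtain q where q: "0 \<le> q" "q < r" "\<omega> \<in> space M" "t < V q \<omega>" by blast
    have "V_H_inv \<mu> H L t \<omega> \<le> q"
      unfolding V_H_inv_eq
      by (rule cInf_lower) (use q delay_path(4)[OF q(3) q(1)] in \<open>auto simp: V_def intro!: bdd_belowI[of _ 0]\<close>)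
    then show "\<omega> \<in> {\<omega> \<in> space M. V_H_inv \<mu> H L t \<omega> < r}" using q by simp
  qed
  also have "\<dots> \<in> sets M"
    by (rule sets.countable_UN') (use Vm in \<open>auto intro: countable_subset[OF _ countable_rat]\<close>)
  finally show "{\<omega> \<in> space M. V_H_inv \<mu> H L t \<omega> < r} \<in> sets M" .
qed

context
  fixes f :: "'n star \<Rightarrow> real" and B :: real
  assumes f: "continuous_on UNIV f" and B: "\<And>y. \<bar>f y\<bar> \<le> B"
begin

lemma Y_measurable: "(\<lambda>\<omega>. f (Zc (V_H_inv \<mu> H L (max 0 t) \<omega>) \<omega>)) \<in> borel_measurable M"
proof (rule right_continuous_at_random_time[where f="\<lambda>s \<omega>. f (Zc s \<omega>)"])
  show "continuous (at_right s) (\<lambda>s. f (Zc s \<omega>))" if "\<omega> \<in> space M" for s \<omega>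
    using Zc_compose_continuous[OF that f]
    by (auto simp: continuous_on_eq_continuous_at intro: continuous_within_subset)
qed (use Zc_compose_measurable[OF f] V_H_inv_measurable in auto)

lemma Y_continuous:
  "\<omega> \<in> space M \<Longrightarrow> continuous_on UNIV (\<lambda>t. f (Zc (V_H_inv \<mu> H L (max 0 t) \<omega>) \<omega>))"
  by (rule continuous_on_compose2[OF Zc_compose_continuous[OF _ f]])
     (auto intro!: continuous_on_compose2[OF V_H_inv_path(2)] continuous_intros)

lemma Y_expectation_continuous:
  "continuous_on UNIV (\<lambda>t. \<integral>\<omega>. f (Zc (V_H_inv \<mu> H L (max 0 t) \<omega>) \<omega>) \<partial>P x)"
proof -
  interpret prob_space "P x" by (rule prob_P)
  show ?thesis
    by (rule continuous_on_integral_bounded) (use Y_measurable Y_continuous B in auto)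
qed

lemma Y_expectation_bound:
  "\<bar>\<integral>\<omega>. f (Zc (V_H_inv \<mu> H L (max 0 t) \<omega>) \<omega>) \<partial>P x\<bar> \<le> B"
proof -
  interpret prob_space "P x" by (rule prob_P)
  let ?g = "\<lambda>\<omega>. f (Zc (V_H_inv \<mu> H L (max 0 t) \<omega>) \<omega>)"
  have i: "integrable (P x) ?g" by (rule integrable_bounded_P[OF Y_measurable B])
  have "\<bar>\<integral>\<omega>. ?g \<omega> \<partial>P x\<bar> \<le> (\<integral>\<omega>. \<bar>?g \<omega>\<bar> \<partial>P x)" using integral_norm_bound by auto
  also have "\<dots> \<le> (\<integral>\<omega>. B \<partial>P x)" by (rule integral_mono) (use i B in auto)
  also have "\<dots> = B" using prob_space by simp
  finally show ?thesis .
qed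

lemma expo_P_swap:
  fixes h :: "real \<Rightarrow> 'w \<Rightarrow> real"
  assumes l: "0 < l" and m: "\<And>t. h t \<in> borel_measurable M"
    and c: "\<And>t \<omega>. \<omega> \<in> space M \<Longrightarrow> continuous (at_right t) (\<lambda>t. h t \<omega>)"
    and C: "\<And>t \<omega>. \<omega> \<in> space M \<Longrightarrow> \<bar>h t \<omega>\<bar> \<le> C"
  shows "(\<integral>t. \<integral>\<omega>. h t \<omega> \<partial>P x \<partial>expo l) = (\<integral>\<omega>. \<integral>t. h t \<omega> \<partial>expo l \<partial>P x)"
    and "(\<lambda>\<omega>. \<integral>t. h t \<omega> \<partial>expo l) \<in> borel_measurable M"
proof -
  interpret E: prob_space "expo l" by (rule prob_space_expo[OF l])
  interpret Px: prob_space "P x" by (rule prob_P)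
  interpret pair_prob_space "expo l" "P x" ..
  have hm: "(\<lambda>(t, \<omega>). h t \<omega>) \<in> borel_measurable (borel \<Otimes>\<^sub>M M)"
    by (rule right_continuous_jointly_measurable[OF m c])
  then have hm': "(\<lambda>(t, \<omega>). h t \<omega>) \<in> borel_measurable (expo l \<Otimes>\<^sub>M P x)"
    by (simp cong: measurable_cong_sets)
  have int: "integrable (expo l \<Otimes>\<^sub>M P x) (\<lambda>(t, \<omega>). h t \<omega>)"
  proof (rule P.integrable_const_bound[where B=C])
    show "AE z in expo l \<Otimes>\<^sub>M P x. norm (case z of (t, \<omega>) \<Rightarrow> h t \<omega>) \<le> C"
      by (rule AE_I2) (auto simp: space_pair_measure C)
  qed (rule hm')
  show "(\<integral>t. \<integral>\<omega>. h t \<omega> \<partial>P x \<partial>expo l) = (\<integral>\<omega>. \<integral>t. h t \<omega> \<partial>expo l \<partial>P x)"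
    using Fubini_integral[OF int] by simp
  show "(\<lambda>\<omega>. \<integral>t. h t \<omega> \<partial>expo l) \<in> borel_measurable M"
    using borel_measurable_integrable[OF integrable_snd[OF int]] by simp
qed

text \<open>Along almost every path the time change applies, because \<open>f\<close> vanishes at the vertex and the local time is
  locally constant elsewhere.\<close>

lemma Y_Laplace:
  assumes l: "0 < l" and fv: "f vertex = 0"
  shows "(\<integral>t. \<integral>\<omega>. f (Zc (V_H_inv \<mu> H L (max 0 t) \<omega>) \<omega>) \<partial>P x \<partial>expo l) =
    Ra (\<mu> * Laplace_exponent \<phi> l) l f x"
proof -
  let ?k = "\<lambda>s \<omega>. exp (- l * Hc (\<mu> * Lc s \<omega>) \<omega>) * f (Zc s \<omega>)"
  let ?y = "\<lambda>t \<omega>. f (Zc (V_H_inv \<mu> H L (max 0 t) \<omega>) \<omega>)"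
  have yc: "continuous (at_right t) (\<lambda>t. ?y t \<omega>)" if "\<omega> \<in> space M" for t \<omega>
    using Y_continuous[OF that] by (auto simp: continuous_on_eq_continuous_at intro: continuous_within_subset)
  have km: "?k s \<in> borel_measurable M" for s
    using Hc_random_time[of "\<lambda>\<omega>. \<mu> * Lc s \<omega>"] Zc_compose_measurable[OF f, of s] by measurable
  have kc: "continuous (at_right s) (\<lambda>s. ?k s \<omega>)" if \<omega>: "\<omega> \<in> space M" for s \<omega>
  proof -
    have "continuous (at_right s) (\<lambda>s. Hc (\<mu> * Lc s \<omega>) \<omega>)"
    proof (rule right_continuous_compose_mono[where \<gamma>="\<lambda>s. \<mu> * Lc s \<omega>"])
      show "continuous (at_right s) (\<lambda>s. \<mu> * Lc s \<omega>)"
        using Lc_continuous[OF \<omega>]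
        by (intro continuous_intros) (auto simp: continuous_on_eq_continuous_at intro: continuous_within_subset)
      show "\<mu> * Lc s \<omega> \<le> \<mu> * Lc r \<omega>" if "s < r" for r
        using mono_onD[OF L_mono[OF \<omega>], of "max 0 s" "max 0 r"] that \<mu>_pos
        by (intro mult_left_mono) (auto simp: Lc_def)
    qed (rule Hc_rc[OF \<omega>])
    moreover have "continuous (at_right s) (\<lambda>s. f (Zc s \<omega>))"
      using Zc_compose_continuous[OF \<omega> f]
      by (auto simp: continuous_on_eq_continuous_at intro: continuous_within_subset)
    ultimately show ?thesis by (intro continuous_intros)
  qed
  have kB: "\<bar>?k s \<omega>\<bar> \<le> B" if "\<omega> \<in> space M" for s \<omega>
    using Hc_nonneg[OF that, of "\<mu> * Lc s \<omega>"] l mult_mono[of "exp (- l * Hc (\<mu> * Lc s \<omega>) \<omega>)" 1 "\<bar>f (Zc s \<omega>)\<bar>" B] B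
    by (simp add: abs_mult)
  note swy = expo_P_swap[OF l Y_measurable yc B] and swk = expo_P_swap[OF l km kc kB]
  have "(\<integral>t. \<integral>\<omega>. ?y t \<omega> \<partial>P x \<partial>expo l) = (\<integral>\<omega>. \<integral>t. ?y t \<omega> \<partial>expo l \<partial>P x)"
    by (rule swy(1))
  also have "\<dots> = (\<integral>\<omega>. \<integral>s. ?k s \<omega> \<partial>expo l \<partial>P x)"
  proof (rule integral_cong_AE)
    show "AE \<omega> in P x. (\<integral>t. ?y t \<omega> \<partial>expo l) = (\<integral>s. ?k s \<omega> \<partial>expo l)"
      using occupation[of x] AE_space
      by eventually_elim (rule time_change_path[OF l f B fv], auto)
    show "(\<lambda>\<omega>. \<integral>t. ?y t \<omega> \<partial>expo l) \<in> borel_measurable (P x)" using swy(2) by simp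
    show "(\<lambda>\<omega>. \<integral>s. ?k s \<omega> \<partial>expo l) \<in> borel_measurable (P x)" using swk(2) by simp
  qed
  also have "\<dots> = (\<integral>s. \<integral>\<omega>. ?k s \<omega> \<partial>P x \<partial>expo l)" by (rule swk(1)[symmetric])
  also have "\<dots> = Ra (\<mu> * Laplace_exponent \<phi> l) l f x"
    unfolding Ra_def subordinated_expectation[OF l f B] ..
  finally show ?thesis .
qed

end

text \<open>A solution \<open>v\<close> of the elastic problem misses the vertex condition of the domain by
  \<open>W = a (v(0) - u0(0))\<close>, and the solution \<open>W / s * exp (- s |x|)\<close> of the homogeneous equation has total
  slope \<open>- W\<close>. Their sum \<open>g\<close> is in the domain, and the two explicit formulas for the killed resolvent combine so
  that the exponential terms cancel.\<close>

lemma Ra_boundary_problem: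
  assumes a: "0 < a" and l: "0 < l" and v: "v \<in> C0" and u0: "u0 \<in> C0" and sp: "(\<Sum>k\<in>UNIV. p k) = 1"
    and d1: "\<And>j r. 0 < r \<Longrightarrow> ((\<lambda>s. v (pt j s)) has_real_derivative v1 j r) (at r)"
    and d2: "\<And>j r. 0 < r \<Longrightarrow> (v1 j has_real_derivative 2 * l * (v (pt j r) - u0 (pt j r))) (at r)"
    and lim: "\<And>j. (v1 j \<longlongrightarrow> D j) (at_right 0)"
    and bd: "(\<Sum>k\<in>UNIV. p k * D k) = a * (v vertex - u0 vertex)"
  shows "Ra a l (\<lambda>y. u0 y - u0 vertex) x = v x - u0 vertex"
proof -
  define s where "s = sqrt (2 * l)"
  have s: "0 < s" "s * s = 2 * l" using l by (auto simp: s_def)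
  define W where "W = a * (v vertex - u0 vertex)"
  define E where "E y = exp (- s * dist y vertex)" for y :: "'n star"
  define g where "g y = v y + W / s * E y" for y
  define h where "h y = 2 * l * (v y - u0 y) + W * s * E y" for y
  have EC: "E \<in> C0" using exp_dist_C0[OF s(1)] by (simp add: E_def[abs_def])
  have gC: "g \<in> C0" using C0_add[OF v EC, of 1 "W / s"] by (simp add: g_def[abs_def])
  have vu: "(\<lambda>y. v y - u0 y) \<in> C0" using C0_add[OF v u0, of 1 "-1"] by simp
  have hC: "h \<in> C0" using C0_add[OF vu EC, of "2 * l" "W * s"] by (simp add: h_def[abs_def])
  have ED: "((\<lambda>r. c * E (pt j r)) has_real_derivative c * (- s * exp (- s * r))) (at r)" if r: "0 < r" for c r and j :: 'n
  proof -
    have "((\<lambda>r. c * exp (- s * r)) has_real_derivative c * (- s * exp (- s * r))) (at r)"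
      by (auto intro!: derivative_eq_intros)
    moreover have "\<forall>\<^sub>F r in nhds r. 0 < r"
      using eventually_nhds_in_open[of "{0<..}" r] r by simp
    then have "\<forall>\<^sub>F r in nhds r. c * exp (- s * r) = c * E (pt j r)"
      by eventually_elim (simp add: E_def)
    ultimately show ?thesis by (subst (asm) DERIV_cong_ev[OF refl _ refl])
  qed
  have "g \<in> star_domain p" "second_deriv_ext g h"
  proof -
    let ?g1 = "\<lambda>j r. v1 j r + W / s * (- s * exp (- s * r))"
    have 1: "((\<lambda>r. g (pt j r)) has_real_derivative ?g1 j r) (at r)" if "0 < r" for j r
      unfolding g_def by (intro DERIV_add d1 ED that)
    have 2: "(?g1 j has_real_derivative h (pt j r)) (at r)" if "0 < r" for j r
    proof -
      have "((\<lambda>r. W / s * (- s * exp (- s * r))) has_real_derivative W * s * exp (- s * r)) (at r)"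
        using s(1) by (auto intro!: derivative_eq_intros)
      from DERIV_add[OF d2[OF that] this] show ?thesis using that by (simp add: h_def E_def)
    qed
    have 3: "(?g1 j \<longlongrightarrow> D j - W) (at_right 0)" for j
    proof -
      have "((\<lambda>r. W / s * (- s * exp (- s * r))) \<longlongrightarrow> W / s * (- s * exp (- s * 0))) (at_right 0)"
        by (intro tendsto_intros)
      from tendsto_add[OF lim[of j] this] show ?thesis using s(1) by simp
    qed
    have 4: "(\<Sum>k\<in>UNIV. p k * (D k - W)) = 0"
      using bd sp by (simp add: right_diff_distrib sum_subtractf W_def flip: sum_distrib_right)
    show "g \<in> star_domain p" "second_deriv_ext g h"
      using star_domainI[of g h ?g1 "\<lambda>j. D j - W", OF gC hC 1 2 3 4] by auto
  qed
  from core_domain[OF this] have core: "core g (\<lambda>y. 1/2 * h y)" .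
  have "l * g y - 1/2 * h y = l * u0 y" for y
  proof -
    have "s * s / 2 * (W / s * E y) = W * s / 2 * E y" using s(1) by simp
    then have "l * (W / s * E y) = W * s / 2 * E y" unfolding s(2) by simp
    then have "l * g y = l * v y + W * s / 2 * E y" by (simp only: g_def distrib_left)
    then show ?thesis by (simp add: h_def algebra_simps)
  qed
  from Ra_core[OF less_imp_le[OF a] l core this]
  have R0: "Ra a l u0 x = g x - g vertex * (1 - Ra a l (\<lambda>_. 1) x)" .
  obtain B where B: "\<And>y. \<bar>u0 y\<bar> \<le> B" using C0_bounded[OF u0] by (auto simp: bounded_iff)
  have cu: "continuous_on UNIV u0" using u0 by (simp add: C0_def)
  have lin: "Ra a l (\<lambda>y. u0 y - u0 vertex) x = Ra a l u0 x - u0 vertex * Ra a l (\<lambda>_. 1) x"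
  proof -
    note a0 = less_imp_le[OF a]
    have int: "integrable (P x) (\<lambda>\<omega>. exp (- a * Lc t \<omega>) * f (Zc t \<omega>))"
      if "continuous_on UNIV f" "\<And>y. \<bar>f y\<bar> \<le> C" for f C t
      by (rule integrable_bounded_P[where B=C, OF La_measurable[OF that(1)]]) (rule La_bound[OF a0 _ that(2)])
    have inte: "integrable (expo l) (\<lambda>t. \<integral>\<omega>. exp (- a * Lc t \<omega>) * f (Zc t \<omega>) \<partial>P x)"
      if "continuous_on UNIV f" "\<And>y. \<bar>f y\<bar> \<le> C" for f C
      by (rule integrable_expo_bounded[OF l borel_measurable_continuous_onI[OF La_continuous[OF a0 that]] La_expectation_bound[OF a0 that]])
    have "(\<integral>\<omega>. exp (- a * Lc t \<omega>) * (u0 (Zc t \<omega>) - u0 vertex) \<partial>P x) =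
      (\<integral>\<omega>. exp (- a * Lc t \<omega>) * u0 (Zc t \<omega>) \<partial>P x) - u0 vertex * (\<integral>\<omega>. exp (- a * Lc t \<omega>) * 1 \<partial>P x)" for t
      using int[OF cu B, of t] int[of "\<lambda>_. 1" 1 t] by (simp add: right_diff_distrib)
    then show ?thesis
      unfolding Ra_def using inte[OF cu B] inte[of "\<lambda>_. 1" 1] by simp
  qed
  define q where "q = 1 - Ra a l (\<lambda>_. 1) x"
  have q: "q = E x * (a / (s + a))"
    unfolding q_def one_minus_Ra_one[OF a l] by (simp add: E_def s_def)
  have sa: "s + a \<noteq> 0" using s a by simp
  have "Ra a l (\<lambda>y. u0 y - u0 vertex) x = g x - g vertex * q - u0 vertex * (1 - q)"
    unfolding lin R0 by (simp add: q_def)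
  also have "\<dots> = v x - u0 vertex + (W / s * E x - (v vertex - u0 vertex + W / s) * q)"
    by (simp add: g_def E_def algebra_simps)
  also have "(v vertex - u0 vertex + W / s) * q = W / s * E x"
  proof -
    define d where "d = v vertex - u0 vertex"
    have "d + a * d / s = d * (s + a) / s" using s(1) by (simp add: field_simps)
    then have "(d + a * d / s) * (E x * (a / (s + a))) = a * d / s * E x"
      using sa by (simp add: mult_ac)
    then show ?thesis unfolding q W_def d_def .
  qed
  finally show ?thesis by simp
qed

end

section \<open>The Laplace transform of the non-local operator\<close>

lemma continuous_on_case_prod_compose:
  assumes "continuous_on S (\<lambda>(t, x). f t x)" "continuous_on A a" "continuous_on A b"
    and "\<And>z. z \<in> A \<Longrightarrow> (a z, b z) \<in> S"
  shows "continuous_on A (\<lambda>z. f (a z) (b z))"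
proof -
  have "continuous_on A (\<lambda>z. case (a z, b z) of (t, x) \<Rightarrow> f t x)"
    by (rule continuous_on_compose2[OF assms(1) continuous_on_Pair[OF assms(2,3)]]) (use assms(4) in auto)
  then show ?thesis by simp
qed

text \<open>The non-local operator is the convolution of \<open>\<rho>'\<close> with the tail of \<open>\<phi>\<close>. The bound by the potential density
  \<open>k\<close> makes \<open>\<rho>'\<close> integrable against \<open>exp (- l t)\<close>, which then gives the transform of the convolution as a product.
  The indicators select the positive times, where alone \<open>\<rho>'\<close> is controlled.\<close>

lemma nonlocal_Laplace:
  fixes \<rho> :: "real \<Rightarrow> real" and Q :: "'w measure"
  assumes Levy: "Levy_measure \<phi>" and \<Phi>: "\<And>l. 0 < l \<Longrightarrow> 0 < Laplace_exponent \<phi> l"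
    and H: "subordinator_with \<phi> Q H"
    and k: "k \<in> borel_measurable borel" "\<And>s. 0 \<le> k s"
    and \<kappa>: "potential_measure Q H = density lborel (\<lambda>s. ennreal (k s))"
    and d: "\<And>t. 0 < t \<Longrightarrow> (\<rho> has_real_derivative \<rho>' t) (at t)" and c': "continuous_on {0<..} \<rho>'"
    and bd: "\<And>t. 0 < t \<Longrightarrow> \<bar>\<rho>' t\<bar> \<le> M0 * k t"
    and c: "continuous_on {0..} \<rho>" and B: "\<And>t. 0 \<le> t \<Longrightarrow> \<bar>\<rho> t\<bar> \<le> B"
    and l: "0 < l"
  defines "N \<equiv> \<lambda>t. LBINT s=0..t. \<rho>' s * tail \<phi> (t - s)"
  shows "integrable (expo l) (\<lambda>t. indicator {0<..} t * N t)"
    "(\<integral>t. indicator {0<..} t * N t \<partial>expo l) = Laplace_exponent \<phi> l * ((\<integral>t. \<rho> (max 0 t) \<partial>expo l) - \<rho> 0)"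
proof -
  let ?\<Phi> = "Laplace_exponent \<phi> l"
  have M0: "M0 * k t \<le> \<bar>M0\<bar> * k t" for t using k(2)[of t] by (intro mult_right_mono) auto
  have ik: "integrable (expo l) k"
  proof (rule integrableI_nonneg)
    have "(\<integral>\<^sup>+t. ennreal (k t) \<partial>expo l) = (\<integral>\<^sup>+t. ennreal (exponential_density l t) * ennreal (k t) \<partial>lborel)"
      unfolding expo_def by (subst nn_integral_density) (use k(1) in auto)
    also have "\<dots> \<le> (\<integral>\<^sup>+t. ennreal l * (ennreal (k t) * ennreal (exp (- l * t))) \<partial>lborel)"
      using l k(2) by (intro nn_integral_mono)
        (auto simp: exponential_density_def ennreal_mult[symmetric] mult_ac)
    also have "\<dots> = ennreal l * (\<integral>\<^sup>+t. ennreal (k t) * ennreal (exp (- l * t)) \<partial>lborel)"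
      by (rule nn_integral_cmult) (use k(1) in auto)
    also have "(\<integral>\<^sup>+t. ennreal (k t) * ennreal (exp (- l * t)) \<partial>lborel) = (\<integral>\<^sup>+t. ennreal (exp (- l * t)) \<partial>potential_measure Q H)"
      unfolding \<kappa> by (subst nn_integral_density) (use k(1) in auto)
    also have "\<dots> = ennreal (1 / ?\<Phi>)" by (rule potential_measure_Laplace[OF H l \<Phi>[OF l]])
    also have "ennreal l * ennreal (1 / ?\<Phi>) < \<infinity>" by (simp add: ennreal_mult_less_top)
    finally show "(\<integral>\<^sup>+t. ennreal (k t) \<partial>expo l) < \<infinity>" .
  qed (use k in auto)
  define r where "r t = indicator {0<..} t * \<rho>' t" for t
  have rm: "r \<in> borel_measurable borel"
    using borel_measurable_continuous_on_indicator[OF _ c'] by (simp add: r_def[abs_def])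
  have ir: "integrable (expo l) r"
  proof (rule Bochner_Integration.integrable_bound[OF integrable_mult_right[OF ik, of "\<bar>M0\<bar>"]])
    show "AE t in expo l. norm (r t) \<le> norm (\<bar>M0\<bar> * k t)"
      using AE_expo_pos[of l]
    proof eventually_elim
      case (elim t)
      then show ?case using bd[OF elim] M0[of t] k(2)[of t] by (simp add: r_def abs_mult)
    qed
  qed (use rm in simp)
  have Nr: "indicator {0<..} t * N t = (LBINT s=0..t. r s * tail \<phi> (t - s))" if "0 \<le> t" for t
  proof (cases "t = 0")
    case True
    then show ?thesis by (simp add: zero_ereal_def)
  next
    case False
    then have "0 < t" using that by simp
    then show ?thesis
      unfolding N_def
      by (auto simp: interval_lebesgue_integral_def set_lebesgue_integral_def r_def zero_ereal_def
          intro!: Bochner_Integration.integral_cong split: split_indicator)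
  qed
  note conv = convolution_expo[OF l ir tail_expo(1)[OF Levy l]]
  have Nm: "(\<lambda>t. indicator {0<..} t * (LBINT s=0..t. r s * tail \<phi> (t - s))) \<in> borel_measurable borel"
    using conv(1)[THEN borel_measurable_integrable] by simp
  have Neq: "indicator {0<..} t * N t = indicator {0<..} t * (LBINT s=0..t. r s * tail \<phi> (t - s))" for t
    using Nr[of t] by (auto simp: indicator_def)
  have AEN: "AE t in expo l. (LBINT s=0..t. r s * tail \<phi> (t - s)) = indicator {0<..} t * N t"
    using AE_expo_pos[of l] by eventually_elim (rule Nr[symmetric], simp)
  have Nm': "(\<lambda>t. indicator {0<..} t * N t) \<in> borel_measurable (expo l)"
    unfolding Neq using Nm by simp
  show "integrable (expo l) (\<lambda>t. indicator {0<..} t * N t)"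
    by (rule integrable_cong_AE_imp[OF conv(1) Nm']) (use AEN in auto)
  have rr: "(\<integral>t. r t \<partial>expo l) = l * ((\<integral>t. \<rho> (max 0 t) \<partial>expo l) - \<rho> (max 0 0))"
  proof (rule expo_derivative[OF l])
    show "continuous_on {0..} (\<lambda>t. \<rho> (max 0 t))"
      by (rule continuous_on_compose2[OF c]) (auto intro!: continuous_intros)
    show "(\<lambda>t. \<rho> (max 0 t)) \<in> borel_measurable borel" by (rule clamped_borel_measurable[OF c])
    show "((\<lambda>t. \<rho> (max 0 t)) has_real_derivative r t) (at t)" if t: "0 < t" for t
    proof -
      have "\<forall>\<^sub>F s in nhds t. 0 < s" using eventually_nhds_in_open[of "{0<..}" t] t by simp
      then have "\<forall>\<^sub>F s in nhds t. \<rho> s = \<rho> (max 0 s)" by eventually_elim (simp add: max_def)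
      with d[OF t] show ?thesis using t by (subst (asm) DERIV_cong_ev[OF refl _ refl]) (simp_all add: r_def)
    qed
    show "continuous_on {0<..} r"
      by (rule continuous_on_eq[OF c']) (simp add: r_def)
  qed (use B ir in auto)
  have "(\<integral>t. indicator {0<..} t * N t \<partial>expo l) = (\<integral>t. (LBINT s=0..t. r s * tail \<phi> (t - s)) \<partial>expo l)"
    by (rule integral_cong_AE) (use AEN Nm' conv(1) in \<open>auto elim: eventually_mono\<close>)
  also have "\<dots> = (\<integral>t. r t \<partial>expo l) * ?\<Phi> / l"
    using conv(2) tail_expo(2)[OF Levy l] by simp
  also have "\<dots> = ?\<Phi> * ((\<integral>t. \<rho> (max 0 t) \<partial>expo l) - \<rho> 0)"
    unfolding rr using l by simp
  finally show "(\<integral>t. indicator {0<..} t * N t \<partial>expo l) = ?\<Phi> * ((\<integral>t. \<rho> (max 0 t) \<partial>expo l) - \<rho> 0)" .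
qed

section \<open>The averaged solution\<close>

text \<open>Taylor's formula with integral remainder, read backwards: it encodes \<open>f'' = F\<close> and the slope \<open>D\<close> at \<open>0\<close>
  without mentioning derivatives, which makes it stable under limits.\<close>

lemma second_order_integral_form:
  fixes F :: "real \<Rightarrow> real"
  assumes F: "continuous_on {0..} F" and f: "\<And>r. 0 \<le> r \<Longrightarrow> f r = c + r * D + integral {0..r} (\<lambda>y. (r - y) * F y)"
  defines "f1 \<equiv> \<lambda>r. D + integral {0..r} F"
  shows "\<And>r. 0 < r \<Longrightarrow> (f has_real_derivative f1 r) (at r)"
    "\<And>r. 0 < r \<Longrightarrow> (f1 has_real_derivative F r) (at r)"
    "(f1 \<longlongrightarrow> D) (at_right 0)"
proof -
  have cF: "continuous_on {0..b} F" for b using F by (rule continuous_on_subset) auto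
  have dI: "((\<lambda>r. integral {0..r} G) has_real_derivative G r) (at r)"
    if G: "continuous_on {0..} G" and r: "0 < r" for G and r :: real
  proof -
    have "((\<lambda>r. integral {0..r} G) has_real_derivative G r) (at r within {0..r+1})"
      by (rule integral_has_real_derivative) (use r continuous_on_subset[OF G] in auto)
    moreover have "at r within {0..r+1} = at r" using r by (intro at_within_interior) auto
    ultimately show ?thesis by simp
  qed
  have cyF: "continuous_on {0..} (\<lambda>y. y * F y)" by (intro continuous_intros F)
  show "(f1 has_real_derivative F r) (at r)" if "0 < r" for r
    unfolding f1_def by (auto intro!: derivative_eq_intros dI[OF F that])
  show "(f has_real_derivative f1 r) (at r)" if r: "0 < r" for r
  proof -
    have "((\<lambda>r. c + r * D + (r * integral {0..r} F - integral {0..r} (\<lambda>y. y * F y))) has_real_derivative f1 r) (at r)"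
      unfolding f1_def by (auto intro!: derivative_eq_intros dI[OF F r] dI[OF cyF r])
    moreover have "\<forall>\<^sub>F r in nhds r. 0 < r" using eventually_nhds_in_open[of "{0<..}" r] r by simp
    then have "\<forall>\<^sub>F r in nhds r. c + r * D + (r * integral {0..r} F - integral {0..r} (\<lambda>y. y * F y)) = f r"
    proof eventually_elim
      case (elim r)
      have "integral {0..r} (\<lambda>y. (r - y) * F y) = integral {0..r} (\<lambda>y. r * F y - y * F y)"
        by (simp add: left_diff_distrib)
      also have "\<dots> = integral {0..r} (\<lambda>y. r * F y) - integral {0..r} (\<lambda>y. y * F y)"
        by (intro Henstock_Kurzweil_Integration.integral_diff integrable_continuous_real continuous_intros cF)
      also have "integral {0..r} (\<lambda>y. r * F y) = r * integral {0..r} F" by simp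
      finally show ?case using f[of r] elim by simp
    qed
    ultimately show ?thesis by (subst (asm) DERIV_cong_ev[OF refl _ refl])
  qed
  have "continuous_on {0..1} f1"
    unfolding f1_def
    by (intro continuous_intros indefinite_integral_continuous_1 integrable_continuous_real cF)
  then have "(f1 \<longlongrightarrow> f1 0) (at 0 within {0..1})" by (auto simp: continuous_on_def)
  moreover have "at 0 within {0..1} = at_right (0::real)"
    by (rule at_within_Icc_at_right) simp
  ultimately show "(f1 \<longlongrightarrow> D) (at_right 0)" by (simp add: f1_def)
qed

locale star_heat_solution =
  fixes u :: "real \<Rightarrow> 'n::finite star \<Rightarrow> real" and B :: real
  assumes C12: "u \<in> C12"
    and bound: "\<And>t x. 0 \<le> t \<Longrightarrow> \<bar>u t x\<bar> \<le> B"
    and cont: "continuous_on ({0..} \<times> UNIV) (\<lambda>(t, x). u t x)"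
    and heat: "\<And>t j r. 0 < t \<Longrightarrow> 0 < r \<Longrightarrow>
      deriv (\<lambda>s. u s (pt j r)) t = 1/2 * (deriv ^^ 2) (\<lambda>y. u t (pt j y)) r"
    and initial_C0: "u 0 \<in> C0"
begin

definition uc :: "real \<Rightarrow> 'n star \<Rightarrow> real" where "uc t = u (max 0 t)"

lemma uc_eq: "0 \<le> t \<Longrightarrow> uc t = u t"
  by (simp add: uc_def max_def)

lemma uc_bound: "\<bar>uc t x\<bar> \<le> B"
  by (simp add: uc_def bound)

lemma uc_continuous_t: "continuous_on UNIV (\<lambda>t. uc t x)"
  unfolding uc_def by (rule continuous_on_case_prod_compose[OF cont]) (auto intro!: continuous_intros)

lemma uc_continuous_x: "continuous_on UNIV (\<lambda>x. uc t x)"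
  unfolding uc_def by (rule continuous_on_case_prod_compose[OF cont]) (auto intro!: continuous_intros)

lemma uc_measurable_t: "(\<lambda>t. uc t x) \<in> borel_measurable borel"
  by (rule borel_measurable_continuous_onI[OF uc_continuous_t])

text \<open>\<open>U l UNIV\<close> is the solution averaged over an exponential time. The sets \<open>I n\<close> introduced below cut time off
  at \<open>0\<close> and at infinity, where the derivatives of \<open>u\<close> are not controlled.\<close>

definition U :: "real \<Rightarrow> real set \<Rightarrow> 'n star \<Rightarrow> real" where
  "U l I x = (\<integral>t. indicator I t * uc t x \<partial>expo l)"

lemma U_bound:
  assumes l: "0 < l" and [measurable]: "I \<in> sets borel"
  shows "\<bar>U l I x\<bar> \<le> B"
proof -
  interpret prob_space "expo l" by (rule prob_space_expo[OF l])
  note [measurable] = uc_measurable_t[of x]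
  have B0: "0 \<le> B" using uc_bound[of 0 x] by linarith
  have b: "\<bar>indicator I t * uc t x\<bar> \<le> B" for t
    using uc_bound[of t x] B0 by (auto simp: indicator_def)
  have i: "integrable (expo l) (\<lambda>t. indicator I t * uc t x)"
    by (rule integrable_expo_bounded[OF l _ b]) measurable
  have "\<bar>U l I x\<bar> \<le> (\<integral>t. \<bar>indicator I t * uc t x\<bar> \<partial>expo l)"
    unfolding U_def using integral_norm_bound by auto
  also have "\<dots> \<le> (\<integral>t. B \<partial>expo l)" by (rule integral_mono) (use i b in auto)
  also have "\<dots> = B" using prob_space by simp
  finally show ?thesis .
qed

lemma U_continuous:
  assumes l: "0 < l" and [measurable]: "I \<in> sets borel"
  shows "continuous_on UNIV (U l I)"
  unfolding continuous_on_sequentially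
proof (intro allI ballI impI)
  interpret prob_space "expo l" by (rule prob_space_expo[OF l])
  note [measurable] = uc_measurable_t
  fix X :: "nat \<Rightarrow> 'n star" and x assume X: "(\<forall>n. X n \<in> UNIV) \<and> X \<longlonglongrightarrow> x"
  have B0: "0 \<le> B" using uc_bound[of 0 x] by linarith
  have "(\<lambda>n. \<integral>t. indicator I t * uc t (X n) \<partial>expo l) \<longlonglongrightarrow> (\<integral>t. indicator I t * uc t x \<partial>expo l)"
  proof (rule bounded_convergence[where B=B])
    show "AE t in expo l. (\<lambda>n. indicator I t * uc t (X n)) \<longlonglongrightarrow> indicator I t * uc t x"
    proof (rule AE_I2)
      fix t
      have "(\<lambda>n. uc t (X n)) \<longlonglongrightarrow> uc t x"
        using uc_continuous_x[of t] X by (auto simp: continuous_on_sequentially comp_def)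
      then show "(\<lambda>n. indicator I t * uc t (X n)) \<longlonglongrightarrow> indicator I t * uc t x" by (intro tendsto_intros)
    qed
    show "AE t in expo l. \<bar>indicator I t * uc t (X n)\<bar> \<le> B" for n
      by (rule AE_I2) (use uc_bound B0 in \<open>auto simp: indicator_def\<close>)
  qed measurable
  then show "(U l I \<circ> X) \<longlonglongrightarrow> U l I x" by (simp add: U_def comp_def)
qed

definition I :: "nat \<Rightarrow> real set" where "I n = {1 / real (Suc n)..real (Suc n)}"

lemma I_sets [measurable, simp]: "I n \<in> sets borel"
  by (simp add: I_def)

lemma I_pos: "t \<in> I n \<Longrightarrow> 0 < t"
  unfolding I_def by (auto intro: less_le_trans[of 0 "1 / real (Suc n)"])

lemma I_exhaust:
  assumes t: "0 < t"
  shows "\<forall>\<^sub>F n in sequentially. t \<in> I n"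
proof -
  have "\<forall>\<^sub>F n in sequentially. inverse (real (Suc n)) < t"
    using LIMSEQ_inverse_real_of_nat t by (rule order_tendstoD)
  moreover have "\<forall>\<^sub>F n in sequentially. t \<le> real (Suc n)"
  proof -
    obtain m where "t \<le> real m" using real_arch_simple by blast
    then show ?thesis
      by (intro eventually_mono[OF eventually_ge_at_top[of m]]) (auto intro: order_trans)
  qed
  ultimately show ?thesis
    by eventually_elim (simp add: I_def inverse_eq_divide)
qed

lemma expo_I_limit:
  fixes f :: "real \<Rightarrow> real"
  assumes i: "integrable (expo l) f"
  shows "(\<lambda>n. \<integral>t. indicator (I n) t * f t \<partial>expo l) \<longlonglongrightarrow> (\<integral>t. f t \<partial>expo l)"
proof (rule integral_dominated_convergence[where w="\<lambda>t. \<bar>f t\<bar>"])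
  note [measurable] = borel_measurable_integrable[OF i]
  show "(\<lambda>t. indicator (I n) t * f t) \<in> borel_measurable (expo l)" for n by measurable
  show "AE t in expo l. (\<lambda>n. indicator (I n) t * f t) \<longlonglongrightarrow> f t"
    using AE_expo_pos[of l]
  proof eventually_elim
    case (elim t)
    show ?case
      by (rule tendsto_eventually) (use I_exhaust[OF elim] in eventually_elim, simp)
  qed
qed (use i in \<open>auto simp: indicator_def\<close>)

lemma expo_I_Henstock:
  assumes l: "0 < l" and f: "continuous_on (I n) f" and m: "f \<in> borel_measurable borel"
  shows "(\<integral>t. indicator (I n) t * f t \<partial>expo l) = integral (I n) (\<lambda>t. l * exp (- l * t) * f t)"
proof -
  note [measurable] = m
  have "(\<integral>t. indicator (I n) t * f t \<partial>expo l) = (\<integral>t. exponential_density l t * (indicator (I n) t * f t) \<partial>lborel)"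
    by (rule integral_expo) (use l in auto)
  also have "\<dots> = (LINT t:I n|lborel. l * exp (- l * t) * f t)"
    unfolding set_lebesgue_integral_def
    using I_pos[of _ n]
    by (intro Bochner_Integration.integral_cong) (force simp: exponential_density_def indicator_def mult_ac)+
  also have "\<dots> = integral (I n) (\<lambda>t. l * exp (- l * t) * f t)"
    unfolding I_def
    by (intro set_borel_integral_eq_integral(2) borel_integrable_atLeastAtMost' continuous_intros
        f[unfolded I_def])
  finally show ?thesis .
qed

text \<open>For each \<open>t > 0\<close>, Taylor's formula along the ray holds with remainder \<open>2 \<partial>\<^sub>t u\<close> by the heat equation. Integrating it
  over \<open>I n\<close> and exchanging the integrals, the time derivative is integrated by parts. What remains involves
  only bounded quantities, so \<open>n\<close> may tend to infinity, and taking \<open>r = 1\<close> shows that the averaged slopes at the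
  vertex converge as well.\<close>

lemma ray_identity:
  assumes l: "0 < l"
  obtains ux D where
    "continuous_on {0<..} (\<lambda>t. ux t 0)"
    "\<And>t. 0 < t \<Longrightarrow> vertex_deriv (u t) j = ux t (0::real)"
    "(\<lambda>n. integral (I n) (\<lambda>t. l * exp (- l * t) * ux t 0)) \<longlonglongrightarrow> D"
    "\<And>r. 0 \<le> r \<Longrightarrow> U l UNIV (pt j r) = U l UNIV vertex + r * D +
      integral {0..r} (\<lambda>y. (r - y) * (2 * l * (U l UNIV (pt j y) - u 0 (pt j y))))"
proof -
  obtain ut where ut: "continuous_on ({0<..} \<times> UNIV) (\<lambda>(t, x). ut t x)"
    "\<And>t x. 0 < t \<Longrightarrow> ((\<lambda>s. u s x) has_real_derivative ut t x) (at t)"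
    using C12 unfolding C12_def by blast
  from C12[unfolded C12_def mem_Collect_eq, THEN conjunct2, THEN spec, of j]
  obtain ux uxx where space: "continuous_on ({0<..} \<times> {0..}) (\<lambda>(t, r). ux t r) \<and>
      continuous_on ({0<..} \<times> {0..}) (\<lambda>(t, r). uxx t r) \<and>
      (\<forall>t>0. \<forall>r\<ge>0. ((\<lambda>y. u t (pt j y)) has_real_derivative ux t r) (at r within {0..}) \<and>
        (ux t has_real_derivative uxx t r) (at r within {0..}))"
    by (elim exE)
  have ux: "continuous_on ({0<..} \<times> {0..}) (\<lambda>(t, r). ux t r)"
    by (rule conjunct1[OF space])
  have dx: "((\<lambda>y. u t (pt j y)) has_real_derivative ux t r) (at r within {0..})"
    and dxx: "(ux t has_real_derivative uxx t r) (at r within {0..})" if "0 < t" "0 \<le> r" for t r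
    using conjunct2[OF conjunct2[OF space]] that by simp_all
  have within: "at r within {0..} = at r" if "0 < r" for r :: real
    using that by (intro at_within_interior) auto
  have pde: "uxx t r = 2 * ut t (pt j r)" if t: "0 < t" and r: "0 < r" for t r
  proof -
    have "deriv (\<lambda>y. u t (pt j y)) y = ux t y" if "0 < y" for y
      using DERIV_imp_deriv dx[OF t, of y] within[OF that] that by auto
    moreover have "\<forall>\<^sub>F y in nhds r. 0 < y" using eventually_nhds_in_open[of "{0<..}" r] r by simp
    ultimately have "\<forall>\<^sub>F y in nhds r. ux t y = deriv (\<lambda>y. u t (pt j y)) y"
      by (auto elim: eventually_mono)
    moreover have "(ux t has_real_derivative uxx t r) (at r)" using dxx[OF t, of r] within[OF r] r by simp
    ultimately have "(deriv (\<lambda>y. u t (pt j y)) has_real_derivative uxx t r) (at r)"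
      by (subst (asm) DERIV_cong_ev[OF refl _ refl])
    then have "(deriv ^^ 2) (\<lambda>y. u t (pt j y)) r = uxx t r"
      by (simp add: numeral_2_eq_2 DERIV_imp_deriv)
    moreover have "deriv (\<lambda>s. u s (pt j r)) t = ut t (pt j r)"
      by (rule DERIV_imp_deriv[OF ut(2)[OF t]])
    ultimately show ?thesis using heat[OF t r, of j] by simp
  qed
  have cux0: "continuous_on {0<..} (\<lambda>t. ux t 0)"
    by (rule continuous_on_case_prod_compose[OF ux]) (auto intro!: continuous_intros)
  have cuxt: "continuous_on {0..} (\<lambda>r. ux t r)" if "0 < t" for t
    by (rule continuous_on_case_prod_compose[OF ux]) (use that in \<open>auto intro!: continuous_intros\<close>)
  have cut: "continuous_on ({0<..} \<times> {0..}) (\<lambda>(t, y). ut t (pt j y))"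
    unfolding split_beta'
    by (rule continuous_on_case_prod_compose[OF ut(1)])
       (auto intro!: continuous_intros continuous_on_compose2[OF pt_continuous[of j]])
  have vd: "vertex_deriv (u t) j = ux t 0" if t: "0 < t" for t
    unfolding vertex_deriv_def
  proof (rule tendsto_Lim)
    have "(ux t \<longlongrightarrow> ux t 0) (at 0 within {0..})" using cuxt[OF t] by (auto simp: continuous_on_def)
    then have "(ux t \<longlongrightarrow> ux t 0) (at_right 0)" by (simp add: at_within_Ici_at_right)
    then show "((\<lambda>r. deriv (\<lambda>s. u t (pt j s)) r) \<longlongrightarrow> ux t 0) (at_right 0)"
    proof (rule Lim_transform_eventually)
      have "ux t r = deriv (\<lambda>s. u t (pt j s)) r" if "0 < r" for r
        using DERIV_imp_deriv[of "\<lambda>y. u t (pt j y)" "ux t r" r] dx[OF t, of r] within[OF that] that by simp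
      then show "\<forall>\<^sub>F r in at_right 0. ux t r = deriv (\<lambda>s. u t (pt j s)) r"
        by (auto simp: eventually_at_filter)
    qed
  qed simp
  have Taylor: "u t (pt j r) = u t vertex + r * ux t 0 + integral {0..r} (\<lambda>y. (r - y) * (2 * ut t (pt j y)))"
    if t: "0 < t" and r: "0 \<le> r" for t r
  proof -
    have "((\<lambda>y. (r - y) * uxx t y) has_integral (u t (pt j r) + (r - r) * ux t r) - (u t (pt j 0) + (r - 0) * ux t 0)) {0..r}"
    proof (rule fundamental_theorem_of_calculus[OF r])
      fix y assume y: "y \<in> {0..r}"
      have "((\<lambda>y. u t (pt j y) + (r - y) * ux t y) has_real_derivative (r - y) * uxx t y) (at y within {0..r})"
        using y by (auto intro!: derivative_eq_intros DERIV_subset[OF dx[OF t]] DERIV_subset[OF dxx[OF t]])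
      then show "((\<lambda>y. u t (pt j y) + (r - y) * ux t y) has_vector_derivative (r - y) * uxx t y) (at y within {0..r})"
        by (simp add: has_real_derivative_iff_has_vector_derivative)
    qed
    then have "integral {0..r} (\<lambda>y. (r - y) * uxx t y) = u t (pt j r) - (u t vertex + r * ux t 0)"
      by (simp add: integral_unique)
    moreover have "integral {0..r} (\<lambda>y. (r - y) * uxx t y) = integral {0..r} (\<lambda>y. (r - y) * (2 * ut t (pt j y)))"
      by (rule integral_spike[of "{0}"]) (use pde[OF t] in auto)
    ultimately show ?thesis by simp
  qed
  define E where "E n x = exp (- l * real (Suc n)) * u (real (Suc n)) x - exp (- l * (1 / real (Suc n))) * u (1 / real (Suc n)) x" for n x
  have cut1: "continuous_on (I n) (\<lambda>t. ut t x)" for n x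
    by (rule continuous_on_case_prod_compose[OF ut(1)]) (use I_pos in \<open>auto intro!: continuous_intros\<close>)
  have cu1: "continuous_on (I n) (\<lambda>t. u t x)" for n x
  proof (rule continuous_on_eq)
    show "continuous_on (I n) (\<lambda>t. uc t x)" using uc_continuous_t by (rule continuous_on_subset) simp
    show "uc t x = u t x" if "t \<in> I n" for t using I_pos[OF that] by (simp add: uc_eq)
  qed
  have U_H: "U l (I n) x = integral (I n) (\<lambda>t. l * exp (- l * t) * u t x)" for n x
  proof -
    have "U l (I n) x = integral (I n) (\<lambda>t. l * exp (- l * t) * uc t x)"
      unfolding U_def by (rule expo_I_Henstock[OF l _ uc_measurable_t])
        (use uc_continuous_t in \<open>rule continuous_on_subset\<close>, simp)
    also have "\<dots> = integral (I n) (\<lambda>t. l * exp (- l * t) * u t x)"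
      by (rule Henstock_Kurzweil_Integration.integral_cong) (use I_pos in \<open>force simp: uc_eq\<close>)
    finally show ?thesis .
  qed
  have inner: "integral (I n) (\<lambda>t. l * exp (- l * t) * (2 * ut t x)) = 2 * l * (E n x + U l (I n) x)" for n x
  proof -
    have le: "1 / real (Suc n) \<le> real (Suc n)" by (rule order_trans[of _ 1]) auto
    have "((\<lambda>t. exp (- l * t) * ut t x - l * exp (- l * t) * u t x) has_integral E n x) (I n)"
      unfolding E_def I_def
    proof (rule fundamental_theorem_of_calculus[OF le])
      fix t assume "t \<in> {1 / real (Suc n)..real (Suc n)}"
      then have t: "0 < t" using I_pos[of t n] by (simp add: I_def)
      have "((\<lambda>t. exp (- l * t) * u t x) has_real_derivative exp (- l * t) * ut t x - l * exp (- l * t) * u t x) (at t)"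
        by (auto intro!: derivative_eq_intros ut(2)[OF t] simp: algebra_simps)
      then show "((\<lambda>t. exp (- l * t) * u t x) has_vector_derivative exp (- l * t) * ut t x - l * exp (- l * t) * u t x)
          (at t within {1 / real (Suc n)..real (Suc n)})"
        by (simp add: has_real_derivative_iff_has_vector_derivative has_vector_derivative_at_within)
    qed
    then have "integral (I n) (\<lambda>t. exp (- l * t) * ut t x - l * exp (- l * t) * u t x) = E n x"
      by (rule integral_unique)
    moreover have "integral (I n) (\<lambda>t. exp (- l * t) * ut t x - l * exp (- l * t) * u t x) =
       integral (I n) (\<lambda>t. exp (- l * t) * ut t x) - U l (I n) x"
      unfolding U_H
      by (rule Henstock_Kurzweil_Integration.integral_diff)
         (use cut1[of n x] cu1[of n x] in \<open>auto simp: I_def intro!: integrable_continuous_real continuous_intros\<close>)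
    moreover have "integral (I n) (\<lambda>t. l * exp (- l * t) * (2 * ut t x)) = 2 * l * integral (I n) (\<lambda>t. exp (- l * t) * ut t x)"
      by (subst integral_mult_right[symmetric]) (simp add: mult_ac)
    ultimately show ?thesis by simp
  qed
  \<comment> \<open>\<open>Dn\<close> and \<open>Rn\<close> are the averaged slope and the averaged remainder.\<close>
  define Dn where "Dn n = integral (I n) (\<lambda>t. l * exp (- l * t) * ux t 0)" for n
  define Rn where "Rn n r = integral {0..r} (\<lambda>y. (r - y) * (2 * l * (E n (pt j y) + U l (I n) (pt j y))))" for n r
  have U_n: "U l (I n) (pt j r) = U l (I n) vertex + r * Dn n + Rn n r" if r: "0 \<le> r" for n r
  proof -
    have cux: "continuous_on (I n) (\<lambda>t. ux t 0)" using cux0 by (rule continuous_on_subset) (use I_pos in auto)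
    let ?f = "\<lambda>t y. l * exp (- l * t) * ((r - y) * (2 * ut t (pt j y)))"
    have sub: "cbox (1 / real (Suc n), 0) (real (Suc n), r) \<subseteq> {0<..} \<times> {0..}"
      using I_pos[of _ n] by (auto simp: cbox_Pair_eq I_def)
    have cf: "continuous_on (cbox (1 / real (Suc n), 0) (real (Suc n), r)) (\<lambda>(t, y). ?f t y)"
      using continuous_on_subset[OF cut sub]
      by (auto simp: split_beta' intro!: continuous_intros)
    have cg: "continuous_on (I n) (\<lambda>t. integral {0..r} (?f t))"
      using integral_continuous_on_param[OF cf[unfolded cbox_Pair_eq]]
      by (simp only: I_def cbox_interval)
    have "U l (I n) (pt j r) = integral (I n) (\<lambda>t. l * exp (- l * t) * u t vertex + r * (l * exp (- l * t) * ux t 0) + integral {0..r} (?f t))"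
      unfolding U_H
    proof (rule Henstock_Kurzweil_Integration.integral_cong)
      fix t assume "t \<in> I n"
      then have t: "0 < t" by (rule I_pos)
      have "l * exp (- l * t) * u t (pt j r) = l * exp (- l * t) * (u t vertex + r * ux t 0 + integral {0..r} (\<lambda>y. (r - y) * (2 * ut t (pt j y))))"
        using Taylor[OF t r] by simp
      also have "\<dots> = l * exp (- l * t) * u t vertex + r * (l * exp (- l * t) * ux t 0) + l * exp (- l * t) * integral {0..r} (\<lambda>y. (r - y) * (2 * ut t (pt j y)))"
        by (simp add: algebra_simps)
      also have "l * exp (- l * t) * integral {0..r} (\<lambda>y. (r - y) * (2 * ut t (pt j y))) = integral {0..r} (?f t)"
        by (rule integral_mult_right[symmetric])
      finally show "l * exp (- l * t) * u t (pt j r) =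
         l * exp (- l * t) * u t vertex + r * (l * exp (- l * t) * ux t 0) + integral {0..r} (?f t)" .
    qed
    also have "\<dots> = U l (I n) vertex + r * Dn n + integral (I n) (\<lambda>t. integral {0..r} (?f t))"
    proof -
      have i: "(\<lambda>t. l * exp (- l * t) * u t vertex) integrable_on I n" "(\<lambda>t. r * (l * exp (- l * t) * ux t 0)) integrable_on I n"
        "(\<lambda>t. integral {0..r} (?f t)) integrable_on I n"
        using cu1[of n vertex] cux cg unfolding I_def
        by (auto intro!: integrable_continuous_real continuous_intros)
      show ?thesis
        using i integrable_add[OF i(1,2)]
        by (simp add: U_H Dn_def Henstock_Kurzweil_Integration.integral_add)
    qed
    also have "integral (I n) (\<lambda>t. integral {0..r} (?f t)) = integral {0..r} (\<lambda>y. integral (I n) (\<lambda>t. ?f t y))"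
      using integral_swap_continuous[OF cf] by (simp add: I_def cbox_interval)
    also have "\<dots> = Rn n r"
      unfolding Rn_def
    proof (rule Henstock_Kurzweil_Integration.integral_cong)
      fix y
      have "integral (I n) (\<lambda>t. ?f t y) = (r - y) * integral (I n) (\<lambda>t. l * exp (- l * t) * (2 * ut t (pt j y)))"
        by (subst integral_mult_right[symmetric]) (simp add: mult_ac)
      then show "integral (I n) (\<lambda>t. ?f t y) = (r - y) * (2 * l * (E n (pt j y) + U l (I n) (pt j y)))"
        by (simp only: inner)
    qed
    finally show ?thesis .
  qed
  have U_lim: "(\<lambda>n. U l (I n) x) \<longlonglongrightarrow> U l UNIV x" for x
  proof -
    have "integrable (expo l) (\<lambda>t. uc t x)"
      by (rule integrable_expo_bounded[OF l uc_measurable_t uc_bound])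
    from expo_I_limit[OF this] show ?thesis by (simp add: U_def)
  qed
  have E_lim: "(\<lambda>n. E n x) \<longlonglongrightarrow> - u 0 x" for x
  proof -
    have n0: "(\<lambda>n. 1 / real (Suc n)) \<longlonglongrightarrow> 0"
      using LIMSEQ_inverse_real_of_nat by (simp add: inverse_eq_divide)
    have "(\<lambda>n. uc (1 / real (Suc n)) x) \<longlonglongrightarrow> uc 0 x"
      using uc_continuous_t[of x] n0 by (auto simp: continuous_on_sequentially comp_def)
    then have 1: "(\<lambda>n. exp (- l * (1 / real (Suc n))) * u (1 / real (Suc n)) x) \<longlonglongrightarrow> exp (- l * 0) * u 0 x"
      by (intro tendsto_intros n0) (simp add: uc_eq)
    have "(\<lambda>n. exp (- l * real (Suc n)) * u (real (Suc n)) x) \<longlonglongrightarrow> 0"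
    proof (rule Lim_null_comparison)
      show "\<forall>\<^sub>F n in sequentially. norm (exp (- l * real (Suc n)) * u (real (Suc n)) x) \<le> exp (- l) ^ Suc n * B"
      proof (intro always_eventually allI)
        fix n
        have "exp (- l) ^ Suc n = exp (- l * real (Suc n))"
          by (simp only: exp_of_nat_mult[symmetric] mult.commute)
        then show "norm (exp (- l * real (Suc n)) * u (real (Suc n)) x) \<le> exp (- l) ^ Suc n * B"
          using bound[of "real (Suc n)" x] by (simp add: abs_mult del: of_nat_Suc)
      qed
      have "(\<lambda>n. exp (- l) ^ n) \<longlonglongrightarrow> 0" by (rule LIMSEQ_realpow_zero) (use l in auto)
      from tendsto_mult_left_zero[OF LIMSEQ_Suc[OF this]] show "(\<lambda>n. exp (- l) ^ Suc n * B) \<longlonglongrightarrow> 0" .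
    qed
    from tendsto_diff[OF this 1] show ?thesis by (simp add: E_def)
  qed
  define F where "F y = 2 * l * (U l UNIV (pt j y) - u 0 (pt j y))" for y
  have R_lim: "(\<lambda>n. Rn n r) \<longlonglongrightarrow> integral {0..r} (\<lambda>y. (r - y) * F y)" if r: "0 \<le> r" for r
    unfolding Rn_def
  proof (rule dominated_convergence(2)[where h="\<lambda>_. r * (2 * l * (3 * B))"])
    fix n
    have cU: "continuous_on {0..r} (\<lambda>y. U l (I n) (pt j y))"
      by (rule continuous_on_compose2[OF U_continuous[OF l I_sets] continuous_on_subset[OF pt_continuous]]) auto
    have cE: "continuous_on {0..r} (\<lambda>y. u t (pt j y))" if "0 \<le> t" for t
      unfolding uc_eq[OF that, symmetric]
      by (rule continuous_on_compose2[OF uc_continuous_x continuous_on_subset[OF pt_continuous]]) auto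
    show "(\<lambda>y. (r - y) * (2 * l * (E n (pt j y) + U l (I n) (pt j y)))) integrable_on {0..r}"
      unfolding E_def
      by (intro integrable_continuous_real continuous_intros cU cE) auto
    fix y assume y: "y \<in> {0..r}"
    have "\<bar>E n (pt j y)\<bar> \<le> 2 * B"
    proof -
      have e: "\<bar>exp (- l * t) * u t (pt j y)\<bar> \<le> B" if "0 \<le> t" for t
        using bound[OF that, of "pt j y"] that l mult_mono[of "exp (- l * t)" 1 "\<bar>u t (pt j y)\<bar>" B]
        by (simp add: abs_mult)
      have "\<bar>E n (pt j y)\<bar> \<le> \<bar>exp (- l * real (Suc n)) * u (real (Suc n)) (pt j y)\<bar> +
          \<bar>exp (- l * (1 / real (Suc n))) * u (1 / real (Suc n)) (pt j y)\<bar>"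
        unfolding E_def by (rule abs_triangle_ineq4)
      then show ?thesis using e[of "real (Suc n)"] e[of "1 / real (Suc n)"] by simp
    qed
    with U_bound[OF l I_sets, of n "pt j y"] have "\<bar>E n (pt j y) + U l (I n) (pt j y)\<bar> \<le> 3 * B" by linarith
    then have "\<bar>r - y\<bar> * (2 * l * \<bar>E n (pt j y) + U l (I n) (pt j y)\<bar>) \<le> r * (2 * l * (3 * B))"
      using y l by (intro mult_mono mult_left_mono mult_nonneg_nonneg) auto
    then show "norm ((r - y) * (2 * l * (E n (pt j y) + U l (I n) (pt j y)))) \<le> r * (2 * l * (3 * B))"
      using l by (simp add: abs_mult)
  next
    fix y
    have "(\<lambda>n. (r - y) * (2 * l * (E n (pt j y) + U l (I n) (pt j y)))) \<longlonglongrightarrow> (r - y) * (2 * l * (- u 0 (pt j y) + U l UNIV (pt j y)))"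
      by (intro tendsto_intros E_lim U_lim)
    then show "(\<lambda>n. (r - y) * (2 * l * (E n (pt j y) + U l (I n) (pt j y)))) \<longlonglongrightarrow> (r - y) * F y"
      by (simp add: F_def)
  qed auto
  define D where "D = U l UNIV (pt j 1) - U l UNIV vertex - integral {0..1} (\<lambda>y. (1 - y) * F y)"
  have "Dn = (\<lambda>n. U l (I n) (pt j 1) - U l (I n) vertex - Rn n 1)" using U_n[of 1] by (simp add: fun_eq_iff)
  then have D_lim: "Dn \<longlonglongrightarrow> D"
    unfolding D_def by (simp only:) (intro tendsto_diff U_lim R_lim, simp)
  have "U l UNIV (pt j r) = U l UNIV vertex + r * D + integral {0..r} (\<lambda>y. (r - y) * F y)" if r: "0 \<le> r" for r
  proof (rule LIMSEQ_unique[OF U_lim])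
    show "(\<lambda>n. U l (I n) (pt j r)) \<longlonglongrightarrow> U l UNIV vertex + r * D + integral {0..r} (\<lambda>y. (r - y) * F y)"
      unfolding U_n[OF r] by (intro tendsto_intros U_lim D_lim R_lim r)
  qed
  with cux0 vd D_lim show ?thesis
    by (intro that[of ux D]) (auto simp: Dn_def[abs_def] F_def[abs_def])
qed

section \<open>The representation theorem\<close>

end

context star_heat_solution
begin

text \<open>Averaging the vertex condition: the weighted sum of the averaged slopes is \<open>\<mu>\<close> times the average of the
  non-local term over \<open>I n\<close>, which converges since that term is integrable against \<open>exp (- l t)\<close>.\<close>

lemma elliptic_problem:
  fixes p :: "'n \<Rightarrow> real" and N :: "real \<Rightarrow> real"
  assumes l: "0 < l" and N: "continuous_on {0<..} N" "integrable (expo l) (\<lambda>t. indicator {0<..} t * N t)"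
    and flux: "\<And>t. 0 < t \<Longrightarrow> (\<Sum>k\<in>UNIV. p k * vertex_deriv (u t) k) = \<mu> * N t"
  obtains v1 D where
    "\<And>j r. 0 < r \<Longrightarrow> ((\<lambda>s. U l UNIV (pt j s)) has_real_derivative v1 j r) (at r)"
    "\<And>j r. 0 < r \<Longrightarrow> (v1 j has_real_derivative 2 * l * (U l UNIV (pt j r) - u 0 (pt j r))) (at r)"
    "\<And>j. (v1 j \<longlongrightarrow> D j) (at_right 0)"
    "(\<Sum>k\<in>UNIV. p k * D k) = \<mu> * (\<integral>t. indicator {0<..} t * N t \<partial>expo l)"
proof -
  define ray_data where "ray_data j ux d \<longleftrightarrow> continuous_on {0<..} (\<lambda>t. ux t 0) \<and>
    (\<forall>t>0. vertex_deriv (u t) j = ux t (0::real)) \<and>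
    (\<lambda>n. integral (I n) (\<lambda>t. l * exp (- l * t) * ux t 0)) \<longlonglongrightarrow> d \<and>
    (\<forall>r\<ge>0. U l UNIV (pt j r) = U l UNIV vertex + r * d +
      integral {0..r} (\<lambda>y. (r - y) * (2 * l * (U l UNIV (pt j y) - u 0 (pt j y)))))" for j ux d
  have "\<exists>ux d. ray_data j ux d" for j
    unfolding ray_data_def by (rule ray_identity[OF l, of j]) blast
  then obtain ux D where "\<And>j. ray_data j (ux j) (D j)" by metis
  then have ux: "\<And>j. continuous_on {0<..} (\<lambda>t. ux j t (0::real))"
    and vd: "\<And>j t. 0 < t \<Longrightarrow> vertex_deriv (u t) j = ux j t 0"
    and Dlim: "\<And>j. (\<lambda>n. integral (I n) (\<lambda>t. l * exp (- l * t) * ux j t 0)) \<longlonglongrightarrow> D j"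
    and ray: "\<And>j r. 0 \<le> r \<Longrightarrow> U l UNIV (pt j r) = U l UNIV vertex + r * D j +
      integral {0..r} (\<lambda>y. (r - y) * (2 * l * (U l UNIV (pt j y) - u 0 (pt j y))))"
    unfolding ray_data_def by blast+
  have cF: "continuous_on {0..} (\<lambda>y. 2 * l * (U l UNIV (pt j y) - u 0 (pt j y)))" for j
    using initial_C0
    by (intro continuous_intros continuous_on_compose2[OF U_continuous[OF l] pt_continuous]
        continuous_on_compose2[of UNIV "u 0", OF _ pt_continuous]) (auto simp: C0_def)
  have "(\<Sum>k\<in>UNIV. p k * D k) = \<mu> * (\<integral>t. indicator {0<..} t * N t \<partial>expo l)"
  proof (rule LIMSEQ_unique)
    show "(\<lambda>n. \<Sum>k\<in>UNIV. p k * integral (I n) (\<lambda>t. l * exp (- l * t) * ux k t 0)) \<longlonglongrightarrow> (\<Sum>k\<in>UNIV. p k * D k)"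
      by (intro tendsto_intros Dlim)
    have "(\<Sum>k\<in>UNIV. p k * integral (I n) (\<lambda>t. l * exp (- l * t) * ux k t 0)) =
        \<mu> * (\<integral>t. indicator (I n) t * (indicator {0<..} t * N t) \<partial>expo l)" for n
    proof -
      have cI: "continuous_on (I n) (\<lambda>t. ux k t 0)" for k
        using ux[of k] by (rule continuous_on_subset) (use I_pos in auto)
      have cN: "continuous_on (I n) (\<lambda>t. indicator {0<..} t * N t)"
        by (rule continuous_on_eq[OF continuous_on_subset[OF N(1)]]) (use I_pos in \<open>auto simp: indicator_def\<close>)
      have mN: "(\<lambda>t. indicator {0<..} t * N t) \<in> borel_measurable borel"
        using borel_measurable_integrable[OF N(2)] by simp
      have "(\<Sum>k\<in>UNIV. p k * integral (I n) (\<lambda>t. l * exp (- l * t) * ux k t 0)) =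
          (\<Sum>k\<in>UNIV. integral (I n) (\<lambda>t. p k * (l * exp (- l * t) * ux k t 0)))"
        by simp
      also have "\<dots> = integral (I n) (\<lambda>t. \<Sum>k\<in>UNIV. p k * (l * exp (- l * t) * ux k t 0))"
        using cI unfolding I_def
        by (intro Henstock_Kurzweil_Integration.integral_sum[symmetric])
           (auto intro!: integrable_continuous_real continuous_intros)
      also have "\<dots> = integral (I n) (\<lambda>t. \<mu> * (l * exp (- l * t) * (indicator {0<..} t * N t)))"
      proof (rule Henstock_Kurzweil_Integration.integral_cong)
        fix t assume "t \<in> I n"
        then have t: "0 < t" by (rule I_pos)
        have "(\<Sum>k\<in>UNIV. p k * (l * exp (- l * t) * ux k t 0)) = l * exp (- l * t) * (\<Sum>k\<in>UNIV. p k * ux k t 0)"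
          by (simp add: sum_distrib_left mult_ac)
        also have "(\<Sum>k\<in>UNIV. p k * ux k t 0) = \<mu> * N t" using flux[OF t] vd[OF t] by simp
        finally show "(\<Sum>k\<in>UNIV. p k * (l * exp (- l * t) * ux k t 0)) = \<mu> * (l * exp (- l * t) * (indicator {0<..} t * N t))"
          using t by simp
      qed
      also have "\<dots> = \<mu> * integral (I n) (\<lambda>t. l * exp (- l * t) * (indicator {0<..} t * N t))"
        by (rule integral_mult_right)
      also have "integral (I n) (\<lambda>t. l * exp (- l * t) * (indicator {0<..} t * N t)) = (\<integral>t. indicator (I n) t * (indicator {0<..} t * N t) \<partial>expo l)"
        by (rule expo_I_Henstock[OF l cN mN, symmetric])
      finally show ?thesis .
    qed
    then show "(\<lambda>n. \<Sum>k\<in>UNIV. p k * integral (I n) (\<lambda>t. l * exp (- l * t) * ux k t 0)) \<longlonglongrightarrow>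
        \<mu> * (\<integral>t. indicator {0<..} t * N t \<partial>expo l)"
      by (simp only:) (intro tendsto_mult tendsto_const expo_I_limit[OF N(2)])
  qed
  with second_order_integral_form[OF cF ray] show ?thesis
    by (intro that[of "\<lambda>j r. D j + integral {0..r} (\<lambda>y. 2 * l * (U l UNIV (pt j y) - u 0 (pt j y)))" D]) auto
qed

lemma U_C0:
  assumes l: "0 < l"
    and d1: "\<And>j r. 0 < r \<Longrightarrow> ((\<lambda>s. U l UNIV (pt j s)) has_real_derivative v1 j r) (at r)"
    and d2: "\<And>j r. 0 < r \<Longrightarrow> (v1 j has_real_derivative 2 * l * (U l UNIV (pt j r) - u 0 (pt j r))) (at r)"
  shows "U l UNIV \<in> C0"
  unfolding C0_def mem_Collect_eq
proof (intro conjI allI impI)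
  show "continuous_on UNIV (U l UNIV)" by (rule U_continuous[OF l]) simp
  fix e :: real assume e: "0 < e"
  have "\<exists>R. \<forall>r>R. \<bar>U l UNIV (pt j r)\<bar> < e" for j
  proof (rule bounded_solution_vanishes_at_infinity[OF l _ d1 d2 _ e])
    show "\<bar>U l UNIV (pt j r)\<bar> \<le> B" for r by (rule U_bound[OF l]) simp
    fix e' :: real assume "0 < e'"
    then obtain R where R: "\<And>x. dist x vertex > R \<Longrightarrow> \<bar>u 0 x\<bar> < e'"
      using initial_C0 unfolding C0_def by blast
    show "\<exists>R. \<forall>r>R. \<bar>u 0 (pt j r)\<bar> < e'"
      by (rule exI[of _ "max 0 R"]) (auto intro!: R)
  qed
  then obtain R where R: "\<And>j r. r > R j \<Longrightarrow> \<bar>U l UNIV (pt j r)\<bar> < e" by metis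
  show "\<exists>R. \<forall>x. dist x vertex > R \<longrightarrow> \<bar>U l UNIV x\<bar> < e"
  proof (intro exI[of _ "Max (range R)"] allI impI)
    fix x :: "'n star" assume x: "Max (range R) < dist x vertex"
    obtain j r where jr: "0 \<le> r" "x = pt j r" by (cases x rule: star_cases)
    have "R j \<le> Max (range R)" by (rule Max_ge) auto
    with x jr show "\<bar>U l UNIV x\<bar> < e" using R[of j r] by simp
  qed
qed

end

theorem theorem22:
  fixes p :: "'n::finite \<Rightarrow> real"
    and b c \<mu> :: real
    and \<phi> :: "real measure"
    and M :: "'w measure"
    and P :: "'n star \<Rightarrow> 'w measure"
    and Z :: "real \<Rightarrow> 'w \<Rightarrow> 'n star"
    and L H :: "real \<Rightarrow> 'w \<Rightarrow> real"
    and u0 :: "'n star \<Rightarrow> real"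
    and u :: "real \<Rightarrow> 'n star \<Rightarrow> real"
  assumes weights: "\<And>k. 0 \<le> p k \<and> p k \<le> 1" "(\<Sum>k\<in>UNIV. p k) = 1"
    and constants: "0 < b" "0 < c" "b + c = 1" "\<mu> = c / b"
    and BM: "star_Brownian_motion p M P Z"
    and local_time: "vertex_local_time M P Z L" "local_time_normalized P Z L"
    and Levy: "Levy_measure \<phi>" "emeasure \<phi> {0<..} = \<infinity>"
    and subord: "\<And>x. subordinator_with \<phi> (P x) H"
    and indep: "\<And>x. independent_processes (P x) Z H"
    and u0: "u0 \<in> C0"
    and u: "u \<in> C12 \<inter> D_L \<phi> (potential_measure (P vertex) H)"
    and bounded: "bounded ((\<lambda>(t, x). u t x) ` ({0..} \<times> UNIV))"
    and continuous: "continuous_on ({0..} \<times> UNIV) (\<lambda>(t, x). u t x)"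
    and heat: "\<And>t j r. 0 < t \<Longrightarrow> 0 < r \<Longrightarrow>
      deriv (\<lambda>s. u s (pt j r)) t = 1/2 * (deriv ^^ 2) (\<lambda>y. u t (pt j y)) r"
    and boundary: "\<And>t. 0 < t \<Longrightarrow>
      c * nonlocal \<phi> u t vertex = b * (\<Sum>k\<in>UNIV. p k * vertex_deriv (u t) k)"
    and initial: "\<And>x. u 0 x = u0 x"
  shows "\<forall>t>0. \<forall>x.
      u t x = (\<integral>\<omega>. u0 (Y_process \<mu> H L Z t \<omega>) \<partial>P x) \<and>
      (\<integral>\<omega>. u0 (Y_process \<mu> H L Z t \<omega>) \<partial>P x) = (\<integral>\<omega>. u0 (Z (V_H_inv \<mu> H L t \<omega>) \<omega>) \<partial>P x)"
proof -
  have \<Phi>: "0 < Laplace_exponent \<phi> l" if "0 < l" for l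
    by (rule Laplace_exponent_pos[OF Levy that])
  obtain K where K: "0 < K" "\<And>x. AE \<omega> in P x. \<forall>t\<ge>0.
       ((\<lambda>e. K / e * measure lborel {s \<in> {0..t}. dist (Z s \<omega>) vertex < e}) \<longlongrightarrow> L t \<omega>) (at_right 0)"
    using local_time(1) unfolding vertex_local_time_def by blast
  have \<mu>: "0 < \<mu>" using constants by simp
  interpret star_BM_subordinated p M P Z L K \<phi> H \<mu>
  proof
    show "star_Brownian_motion p M P Z" by (rule BM)
    show "local_time_normalized P Z L" by (rule local_time(2))
  qed (use local_time(1) K subord indep \<mu> \<Phi> in \<open>auto simp: vertex_local_time_def\<close>)
  obtain B where B: "\<And>t x. 0 \<le> t \<Longrightarrow> \<bar>u t x\<bar> \<le> B"
    using bounded by (auto simp: bounded_iff)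
  have u0_eq: "u 0 = u0" using initial by (rule ext)
  interpret sol: star_heat_solution u B
    by standard (use u B continuous heat u0 u0_eq in auto)
  define \<rho> where "\<rho> t = u t vertex" for t
  have DL: "(\<forall>t>0. \<rho> differentiable (at t))" "continuous_on {0<..} (deriv \<rho>)"
    "continuous_on {0<..} (\<lambda>t. nonlocal \<phi> u t vertex)"
    "\<exists>k M0. k \<in> borel_measurable borel \<and> (\<forall>s. 0 \<le> k s) \<and>
         potential_measure (P vertex) H = density lborel (\<lambda>s. ennreal (k s)) \<and>
         0 < M0 \<and> (\<forall>t>0. \<bar>deriv \<rho> t\<bar> \<le> M0 * k t)"
    using u unfolding D_L_def Let_def \<rho>_def[abs_def] by blast+
  then obtain k M0 where k: "k \<in> borel_measurable borel" "\<And>s. 0 \<le> k s"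
    "potential_measure (P vertex) H = density lborel (\<lambda>s. ennreal (k s))"
    "\<And>t. 0 < t \<Longrightarrow> \<bar>deriv \<rho> t\<bar> \<le> M0 * k t" by blast
  have d\<rho>: "(\<rho> has_real_derivative deriv \<rho> t) (at t)" if "0 < t" for t
    using DL(1) that DERIV_deriv_iff_real_differentiable by blast
  have c\<rho>: "continuous_on {0..} \<rho>"
    unfolding \<rho>_def by (rule continuous_on_case_prod_compose[OF continuous]) (auto intro!: continuous_intros)
  have N_eq: "nonlocal \<phi> u t vertex = (LBINT s=0..t. deriv \<rho> s * tail \<phi> (t - s))" for t
    by (simp add: nonlocal_def \<rho>_def[abs_def])
  \<comment> \<open>Subtracting the value at the vertex makes the time spent there irrelevant.\<close>
  define w where "w y = u0 y - u0 vertex" for y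
  have cu0: "continuous_on UNIV u0" using u0 by (simp add: C0_def)
  have cw: "continuous_on UNIV w" unfolding w_def by (intro continuous_intros cu0)
  have wB: "\<bar>w y\<bar> \<le> 2 * B" for y
    using B[of 0 y] B[of 0 vertex] unfolding u0_eq w_def by simp
  have w0: "w vertex = 0" by (simp add: w_def)
  define Y where "Y t \<omega> = w (Zc (V_H_inv \<mu> H L (max 0 t) \<omega>) \<omega>)" for t \<omega>
  have Laplace: "(\<integral>t. (\<integral>\<omega>. Y t \<omega> \<partial>P x) - (sol.uc t x - u0 vertex) \<partial>expo l) = 0" if l: "0 < l" for l x
  proof -
    interpret E: prob_space "expo l" by (rule prob_space_expo[OF l])
    define a where "a = \<mu> * Laplace_exponent \<phi> l"
    have a: "0 < a" unfolding a_def using \<mu> \<Phi>[OF l] by simp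
    let ?V = "sol.U l UNIV"
    note NL = nonlocal_Laplace[OF Levy(1) \<Phi> subord k(1-3) d\<rho> DL(2) k(4) c\<rho> _ l, of B, folded N_eq]
    have NL1: "integrable (expo l) (\<lambda>t. indicator {0<..} t * nonlocal \<phi> u t vertex)"
      by (rule NL(1)) (simp_all add: \<rho>_def B)
    have NL2: "(\<integral>t. indicator {0<..} t * nonlocal \<phi> u t vertex \<partial>expo l) =
        Laplace_exponent \<phi> l * ((\<integral>t. \<rho> (max 0 t) \<partial>expo l) - \<rho> 0)"
      by (rule NL(2)) (simp_all add: \<rho>_def B)
    have V0: "?V vertex = (\<integral>t. \<rho> (max 0 t) \<partial>expo l)"
      by (simp add: sol.U_def sol.uc_def \<rho>_def)
    have flux: "(\<Sum>k\<in>UNIV. p k * vertex_deriv (u t) k) = \<mu> * nonlocal \<phi> u t vertex" if "0 < t" for t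
    proof -
      have "(\<Sum>k\<in>UNIV. p k * vertex_deriv (u t) k) = c * nonlocal \<phi> u t vertex / b"
        using boundary[OF that] constants(1) by (simp add: nonzero_eq_divide_eq mult.commute)
      then show ?thesis by (simp add: constants(4))
    qed
    obtain v1 D where v: "\<And>j r. 0 < r \<Longrightarrow> ((\<lambda>s. ?V (pt j s)) has_real_derivative v1 j r) (at r)"
      "\<And>j r. 0 < r \<Longrightarrow> (v1 j has_real_derivative 2 * l * (?V (pt j r) - u 0 (pt j r))) (at r)"
      "\<And>j. (v1 j \<longlongrightarrow> D j) (at_right 0)"
      "(\<Sum>k\<in>UNIV. p k * D k) = \<mu> * (\<integral>t. indicator {0<..} t * nonlocal \<phi> u t vertex \<partial>expo l)"
      using sol.elliptic_problem[OF l DL(3) NL1 flux] by blast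
    have bd: "(\<Sum>k\<in>UNIV. p k * D k) = a * (?V vertex - u0 vertex)"
      unfolding v(4) NL2 V0 by (simp add: a_def \<rho>_def u0_eq)
    have "Ra a l w x = ?V x - u0 vertex"
      unfolding w_def
      by (rule Ra_boundary_problem[OF a l sol.U_C0[OF l v(1,2)] u0 weights(2) v(1) v(2)[unfolded u0_eq] v(3) bd])
    moreover have "(\<integral>t. \<integral>\<omega>. Y t \<omega> \<partial>P x \<partial>expo l) = Ra a l w x"
      unfolding Y_def a_def by (rule Y_Laplace[OF cw wB l w0])
    moreover have "(\<integral>t. (\<integral>\<omega>. Y t \<omega> \<partial>P x) - (sol.uc t x - u0 vertex) \<partial>expo l) =
        (\<integral>t. \<integral>\<omega>. Y t \<omega> \<partial>P x \<partial>expo l) - (?V x - u0 vertex)"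
    proof -
      have i1: "integrable (expo l) (\<lambda>t. \<integral>\<omega>. Y t \<omega> \<partial>P x)"
        unfolding Y_def
        by (rule integrable_expo_bounded[OF l borel_measurable_continuous_onI[OF Y_expectation_continuous[OF cw wB]]
              Y_expectation_bound[OF cw wB]])
      have i2: "integrable (expo l) (\<lambda>t. sol.uc t x)"
        by (rule integrable_expo_bounded[OF l sol.uc_measurable_t sol.uc_bound])
      show ?thesis using i1 i2 E.prob_space by (simp add: sol.U_def)
    qed
    ultimately show ?thesis by simp
  qed
  have main: "(\<integral>\<omega>. Y t \<omega> \<partial>P x) = u t x - u0 vertex" if t: "0 < t" for t x
  proof -
    let ?f = "\<lambda>t. (\<integral>\<omega>. Y t \<omega> \<partial>P x) - (sol.uc t x - u0 vertex)"
    have cf: "continuous_on UNIV ?f"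
      unfolding Y_def
      by (intro continuous_intros Y_expectation_continuous[OF cw wB] sol.uc_continuous_t)
    have "?f t = 0"
    proof (rule Laplace_unique[where f="?f" and B="2 * B + 2 * B"])
      show "continuous_on {0..} ?f" using cf by (rule continuous_on_subset) simp
      show "?f \<in> borel_measurable borel" by (rule borel_measurable_continuous_onI[OF cf])
      show "\<bar>?f s\<bar> \<le> 2 * B + 2 * B" for s
        using Y_expectation_bound[OF cw wB, where t=s and x=x] sol.uc_bound[of s x] B[of 0 vertex]
        unfolding u0_eq Y_def by simp
    qed (use Laplace t in auto)
    then show ?thesis using t by (simp add: sol.uc_eq)
  qed
  have "u t x = (\<integral>\<omega>. u0 (Z (V_H_inv \<mu> H L t \<omega>) \<omega>) \<partial>P x)" if t: "0 < t" for t x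
  proof -
    interpret Px: prob_space "P x" by (rule prob_P)
    have "(\<integral>\<omega>. u0 (Z (V_H_inv \<mu> H L t \<omega>) \<omega>) \<partial>P x) = (\<integral>\<omega>. Y t \<omega> + u0 vertex \<partial>P x)"
      using V_H_inv_path(1) t
      by (intro Bochner_Integration.integral_cong) (simp_all add: Y_def w_def Zc_eq)
    also have "\<dots> = (\<integral>\<omega>. Y t \<omega> \<partial>P x) + u0 vertex"
      using integrable_bounded_P[OF Y_measurable[OF cw wB, of t] wB, of x] Px.prob_space by (simp add: Y_def)
    finally show ?thesis using main[OF t, of x] by simp
  qed
  then show ?thesis by (simp add: Y_process_def)
qed

end
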